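(* Let $I=(c,d)\subset\mathbb{R}$ be an open interval, $p\in(1,\infty)$, $p'=\frac{p}{p-1}$, $\nu\in\{1,2\}$, and let $w$ be a Lebesgue measurable function on $I$ with $w>0$ a.e. on $I$ and $w^p\in L^1_{\mathrm{loc},(\nu,2)}$. Let $g\in\mathfrak{M}(I)$. Then $J_{Ch_{p,w}(I)}(g)<\infty$ if and only if $g$ admits a representative (a function equal to $g$ a.e. on $I$) $\tilde g\in AC_{\mathrm{loc}}(I)\cap L^\infty(I)$ such that $D\tilde g\in L^{p'}_{1/w}(I)$ and, for some $b\in I$, $$\tilde g(x)=(-1)^\nu\chi_{I_{\nu,b}}(x)\int_{I_{\nu,x}^*}D\tilde g,\qquad x\in I.$$ In this case, $J_{Ch_{p,w}(I)}(g)=\|D\tilde g\|_{L^{p'}_{1/w}(I)}$.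
   Context: The interval $I=(c,d)$ may be bounded or unbounded ($-\infty\le c<d\le\infty$). $\mathfrak{M}(I)$ is the space of all Lebesgue measurable functions $f:I\to[-\infty,\infty]$ (functions equal a.e. are identified). For $x\in I$ put $I_{1,x}:=I_{2,x}^*:=(c,x]$ and $I_{1,x}^*:=I_{2,x}:=[x,d)$. For $\nu\in\{1,2\}$: $$L^1_{\mathrm{loc},(\nu,1)}:=\Big\{f\in\mathfrak{M}(I):\int_{I_{\nu,x}}|f|<\infty\ \forall x\in I\Big\},\qquad L^1_{\mathrm{loc},(\nu,2)}:=\Big\{f\in\mathfrak{M}(I):\int_{I_{\nu,x}^*}|f|<\infty\ \forall x\in I\Big\}.$$ The weighted altered Cesàro–Copson space is $Ch_{p,w}(I):=\{f\in L^1_{\mathrm{loc},(\nu,1)}:\|f\|_{Ch_{p,w}(I)}<\infty\}$, where $$\|f\|_{Ch_{p,w}(I)}:=\left(\int_I\left|w(x)\int_{I_{\nu,x}}f\right|^p dx\right)^{1/p}.$$ For $g\in\mathfrak{M}(I)$, $$J_{Ch_{p,w}(I)}(g):=\sup_{h\in Ch_{p,w}(I),\,h\neq0}\frac{\left|\int_I hg\right|}{\|h\|_{Ch_{p,w}(I)}},$$ with the convention that $J_{Ch_{p,w}(I)}(g)=\infty$ if $hg$ is not Lebesgue integrable on $I$ for some $h\in Ch_{p,w}(I)$. $AC_{\mathrm{loc}}(I)$ is the set of functions absolutely continuous on every compact subinterval of $I$; $D\tilde g$ is the (a.e.) derivative of $\tilde g$; $\chi_E$ is the indicator function of $E$. $L^{p'}_{1/w}(I)$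 is the space of $v\in\mathfrak{M}(I)$ with $\|v\|_{L^{p'}_{1/w}(I)}:=\|v\,\tfrac1w\|_{L^{p'}(I)}<\infty$. *)

theory Defs
  imports "HOL-Analysis.Analysis" "HOL-Probability.Essential_Supremum"
begin

text \<open>
  Functions on \<open>I\<close> with values in \<open>[-\<infinity>, \<infinity>]\<close> are total functions of type
  \<^typ>\<open>real \<Rightarrow> ereal\<close> whose values outside \<open>I\<close> are never used; functions that agree
  a.e. on \<open>I\<close> are not identified on the level of types, so "\<open>h \<noteq> 0\<close>" is spelled out as
  "not a.e. zero". Products are those of \<^typ>\<open>ereal\<close>, in particular \<open>0 * \<infinity> = 0\<close>.
\<close>

definition measurable_funs :: "real set \<Rightarrow> (real \<Rightarrow> ereal) set" where
  "measurable_funs I = borel_measurable (lebesgue_on I)"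

definition ext_integrable_on :: "(real \<Rightarrow> ereal) \<Rightarrow> real set \<Rightarrow> bool" where
  "ext_integrable_on f E \<longleftrightarrow>
     f \<in> borel_measurable (lebesgue_on E) \<and> (\<integral>\<^sup>+ x. e2ennreal \<bar>f x\<bar> \<partial>lebesgue_on E) < \<infinity>"

text \<open>An integrable function is a.e. finite, so passing to real values does not change its integral.\<close>

definition ext_integral :: "real set \<Rightarrow> (real \<Rightarrow> ereal) \<Rightarrow> real" where
  "ext_integral E f = (\<integral>x. real_of_ereal (f x) \<partial>lebesgue_on E)"

text \<open>Powers on \<open>[0, \<infinity>]\<close>, only used with exponents \<open>p > 0\<close>.\<close>

definition ennpowr :: "ennreal \<Rightarrow> real \<Rightarrow> ennreal" where
  "ennpowr x p = (if x = \<infinity> then \<infinity> else ennreal (enn2real x powr p))"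

definition Lp_norm :: "real set \<Rightarrow> real \<Rightarrow> (real \<Rightarrow> ereal) \<Rightarrow> ennreal" where
  "Lp_norm I p f = ennpowr (\<integral>\<^sup>+ x. ennpowr (e2ennreal \<bar>f x\<bar>) p \<partial>lebesgue_on I) (1 / p)"

text \<open>The sets \<open>I\<^bsub>\<nu>,x\<^esub>\<close> and \<open>I\<^sup>*\<^bsub>\<nu>,x\<^esub>\<close>, for \<open>\<nu> \<in> {1, 2}\<close>.\<close>

definition I_sub :: "real set \<Rightarrow> nat \<Rightarrow> real \<Rightarrow> real set" where
  "I_sub I \<nu> x = {y \<in> I. if \<nu> = 1 then y \<le> x else x \<le> y}"

definition I_sub_star :: "real set \<Rightarrow> nat \<Rightarrow> real \<Rightarrow> real set" where
  "I_sub_star I \<nu> x = {y \<in> I. if \<nu> = 1 then x \<le> y else y \<le> x}"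

definition L1_loc_1 :: "real set \<Rightarrow> nat \<Rightarrow> (real \<Rightarrow> ereal) set" where
  "L1_loc_1 I \<nu> = {f \<in> measurable_funs I.
     \<forall>x\<in>I. (\<integral>\<^sup>+ y. e2ennreal \<bar>f y\<bar> \<partial>lebesgue_on (I_sub I \<nu> x)) < \<infinity>}"

definition L1_loc_2 :: "real set \<Rightarrow> nat \<Rightarrow> (real \<Rightarrow> ereal) set" where
  "L1_loc_2 I \<nu> = {f \<in> measurable_funs I.
     \<forall>x\<in>I. (\<integral>\<^sup>+ y. e2ennreal \<bar>f y\<bar> \<partial>lebesgue_on (I_sub_star I \<nu> x)) < \<infinity>}"

definition Ch_norm :: "real set \<Rightarrow> nat \<Rightarrow> real \<Rightarrow> (real \<Rightarrow> ereal) \<Rightarrow> (real \<Rightarrow> ereal) \<Rightarrow> ennreal" where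
  "Ch_norm I \<nu> p w f = Lp_norm I p (\<lambda>x. w x * ereal (ext_integral (I_sub I \<nu> x) f))"

definition Ch_space :: "real set \<Rightarrow> nat \<Rightarrow> real \<Rightarrow> (real \<Rightarrow> ereal) \<Rightarrow> (real \<Rightarrow> ereal) set" where
  "Ch_space I \<nu> p w = {f \<in> L1_loc_1 I \<nu>. Ch_norm I \<nu> p w f < \<infinity>}"

definition J_Ch :: "real set \<Rightarrow> nat \<Rightarrow> real \<Rightarrow> (real \<Rightarrow> ereal) \<Rightarrow> (real \<Rightarrow> ereal) \<Rightarrow> ennreal" where
  "J_Ch I \<nu> p w g =
     (if \<forall>h \<in> Ch_space I \<nu> p w. ext_integrable_on (\<lambda>x. h x * g x) I
      then SUP h \<in> {h \<in> Ch_space I \<nu> p w. \<not> (AE x in lebesgue_on I. h x = 0)}.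
             ennreal \<bar>ext_integral I (\<lambda>x. h x * g x)\<bar> / Ch_norm I \<nu> p w h
      else \<infinity>)"

definition abs_continuous_on_Icc :: "real \<Rightarrow> real \<Rightarrow> (real \<Rightarrow> real) \<Rightarrow> bool" where
  "abs_continuous_on_Icc a b f \<longleftrightarrow>
     (\<forall>\<epsilon>>0. \<exists>\<delta>>0. \<forall>(n::nat) s t.
        (\<forall>i<n. a \<le> s i \<and> s i \<le> t i \<and> t i \<le> b) \<and>
        (\<forall>i<n. \<forall>j<n. i \<noteq> j \<longrightarrow> {s i<..<t i} \<inter> {s j<..<t j} = {}) \<and>
        (\<Sum>i<n. t i - s i) < \<delta> \<longrightarrow>
        (\<Sum>i<n. \<bar>f (t i) - f (s i)\<bar>) < \<epsilon>)"

definition AC_loc :: "real set \<Rightarrow> (real \<Rightarrow> real) set" where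
  "AC_loc I = {f. \<forall>a b. a \<le> b \<and> {a..b} \<subseteq> I \<longrightarrow> abs_continuous_on_Icc a b f}"

definition L_infinity :: "real set \<Rightarrow> (real \<Rightarrow> ereal) set" where
  "L_infinity I = {f \<in> measurable_funs I. esssup (lebesgue_on I) (\<lambda>x. \<bar>f x\<bar>) < \<infinity>}"

definition Lp_inv_weight_norm :: "real set \<Rightarrow> real \<Rightarrow> (real \<Rightarrow> ereal) \<Rightarrow> (real \<Rightarrow> ereal) \<Rightarrow> ennreal" where
  "Lp_inv_weight_norm I q w v = Lp_norm I q (\<lambda>x. v x * (1 / w x))"

definition Lp_inv_weight :: "real set \<Rightarrow> real \<Rightarrow> (real \<Rightarrow> ereal) \<Rightarrow> (real \<Rightarrow> ereal) set" where
  "Lp_inv_weight I q w = {v \<in> measurable_funs I. Lp_inv_weight_norm I q w v < \<infinity>}"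

text \<open>
  The representatives \<open>\<gamma>\<close> of \<open>g\<close> in question. \<^term>\<open>deriv \<gamma>\<close> has an unspecified value
  where \<open>\<gamma>\<close> is not differentiable, which for \<open>\<gamma>\<close> in \<^term>\<open>AC_loc I\<close> is a null set.
\<close>

definition Ch_representative ::
    "real set \<Rightarrow> nat \<Rightarrow> real \<Rightarrow> (real \<Rightarrow> ereal) \<Rightarrow> (real \<Rightarrow> ereal) \<Rightarrow> (real \<Rightarrow> real) \<Rightarrow> bool" where
  "Ch_representative I \<nu> p w g \<gamma> \<longleftrightarrow>
     (AE x in lebesgue_on I. g x = ereal (\<gamma> x)) \<and>
     \<gamma> \<in> AC_loc I \<and> (\<lambda>x. ereal (\<gamma> x)) \<in> L_infinity I \<and>
     (\<lambda>x. ereal (deriv \<gamma> x)) \<in> Lp_inv_weight I (p / (p - 1)) w \<and>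
     (\<exists>b\<in>I. \<forall>x\<in>I. \<gamma> x =
        (-1) ^ \<nu> * indicator (I_sub I \<nu> b) x * (\<integral>y. deriv \<gamma> y \<partial>lebesgue_on (I_sub_star I \<nu> x)))"

end

theory Submission
  imports Defs
begin

text \<open>
  Write \<open>F\<^sub>h x\<close> for the integral of \<open>h\<close> over \<open>I\<^bsub>\<nu>,x\<^esub>\<close>, so that \<open>F\<^sub>h\<close> is, up to a sign depending on
  \<open>\<nu>\<close>, a primitive of \<open>h\<close>, and the norm of \<open>h\<close> is the weighted \<open>L\<^sup>p\<close> norm of \<open>F\<^sub>h\<close>. Formally an
  integration by parts turns the pairing of \<open>h\<close> with \<open>g\<close> into that of \<open>F\<^sub>h\<close> with \<open>D g\<close>, and the theorem
  is the duality of \<open>L\<^sup>p\<close> and \<open>L\<^sup>q\<close>, \<open>1 / p + 1 / q = 1\<close>, transported by this identity. Call the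
  end of \<open>I\<close> from which \<open>I\<^bsub>\<nu>,x\<^esub>\<close> starts the near end, the other one the far end.

  If \<open>\<gamma>\<close> represents \<open>g\<close>, the boundary terms vanish: near the near end \<open>F\<^sub>h\<close> tends to \<open>0\<close> and \<open>\<gamma>\<close> is
  bounded, near the far end \<open>\<gamma>\<close> is \<open>0\<close>. Hoelder's inequality then bounds the functional
  (\<open>representative_bound\<close>, \<open>representative_J_le\<close>).

  Conversely let the functional be finite, with value \<open>C\<close>. Compactly supported \<open>h\<close> with integral \<open>0\<close>
  are allowed as test functions. Choosing for \<open>h\<close> differences of approximate point masses at
  points \<open>s\<close> and \<open>t\<close>, which makes \<open>F\<^sub>h\<close> approximate the indicator of the interval between them,
  bounds \<open>\<Sum> \<alpha> i (g (t i) - g (s i))\<close> by \<open>C\<close> times the weighted \<open>L\<^sup>p\<close> norm of the step function with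
  values \<open>\<alpha> i\<close> (\<open>sum_bound_at_Lebesgue_points\<close>). With \<open>\<alpha> i = \<plusminus>1\<close> this says that \<open>g\<close>, off a null set, is
  absolutely continuous with respect to the weight, hence has an absolutely continuous version
  \<open>\<gamma>\<close> (\<open>dual_bound_version\<close>). With the coefficients that are extremal in Hoelder's inequality it
  bounds a Riemann sum for \<open>\<parallel>D \<gamma> / w\<parallel>\<close>, and Fatou's lemma gives the norm estimate
  (\<open>deriv_norm_le\<close>). Since the representative is unique, this is also the lower bound for the
  functional.

  It remains to see that \<open>\<gamma>\<close> is bounded and vanishes near the far end. Here finiteness of the
  functional enters only through integrability of \<open>h g\<close>: rapidly oscillating \<open>h\<close> has
  prescribed \<open>L\<^sup>1\<close> mass on small intervals while \<open>F\<^sub>h\<close> is as small as desired, so its norm is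
  finite whatever the weight (\<open>oscillating_function_not_integrable\<close>).

  Two facts of real analysis are developed on the way: indefinite integrals are differentiable
  almost everywhere (\<open>indefinite_integral_has_real_derivative_ae\<close>), and absolutely continuous
  functions are indefinite integrals (\<open>abs_continuous_on_Icc_imp_indefinite_integral\<close>).
\<close>

section \<open>Differentiation of indefinite integrals\<close>

text \<open>
  At a point where differentiability with the right derivative fails, arbitrarily short intervals
  starting at the point have a Riemann-sum term that misses the integral by a fixed proportion of
  the length. Henstock's lemma makes the sum of such errors small over disjoint intervals, so
  these have small total length, and by Vitali's covering lemma their fivefold enlargements cover
  the bad points.
\<close>

lemma indefinite_integral_has_real_derivative_ae:
  fixes f :: "real \<Rightarrow> real"
  assumes f: "f integrable_on {a..b}"
  shows "negligible {x \<in> {a<..<b}. \<not> ((\<lambda>t. integral {a..t} f) has_real_derivative f x) (at x)}"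
proof -
  define F where "F = (\<lambda>t. integral {a..t} f)"
  define bad where "bad n x t \<longleftrightarrow> t \<in> {a..b} \<and> t \<noteq> x \<and> \<bar>F t - F x - f x * (t - x)\<bar> > \<bar>t - x\<bar> / real (Suc n)"
    for n x t
  define B where "B n = {x \<in> {a<..<b}. \<forall>r>0. \<exists>t. \<bar>t - x\<bar> < r \<and> bad n x t}" for n
  have neg: "negligible (B n)" for n
    unfolding negligible_outer_le
  proof (intro allI impI)
    fix e :: real assume "e > 0"
    \<comment> \<open>\<open>5\<close> is the enlargement in Vitali's lemma, \<open>Suc n\<close> turns errors into lengths\<close>
    define e' where "e' = e / (5 * real (Suc n))"
    have "e' > 0" using \<open>e > 0\<close> by (simp add: e'_def)
    obtain \<gamma> where \<gamma>: "gauge \<gamma>" and hen: "\<And>p. \<lbrakk>p tagged_partial_division_of (cbox a b); \<gamma> fine p\<rbrakk> \<Longrightarrow>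
             sum (\<lambda>(x,k). norm (measure lborel k *\<^sub>R f x - integral k f)) p < e'"
      using Henstock_lemma[of f a b e'] f \<open>e' > 0\<close> by auto
    \<comment> \<open>an index is a tagged interval: the tag \<open>x\<close> and the other endpoint \<open>t\<close>, which may lie on either side\<close>
    define K where "K = {(x,t). x \<in> B n \<and> bad n x t \<and> {min x t..max x t} \<subseteq> \<gamma> x}"
    define ce where "ce = (\<lambda>(x,t). (x + t) / 2 :: real)"
    define ra where "ra = (\<lambda>(x,t). \<bar>t - x\<bar> / 2 :: real)"
    have cb: "cball (ce (x,t)) (ra (x,t)) = {min x t..max x t}" for x t
      by (auto simp: cball_eq_atLeastAtMost ce_def ra_def min_def max_def abs_if field_simps)
    have cov: "B n \<subseteq> (\<Union>i\<in>K. cball (ce i) (ra i))"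
    proof
      fix x assume x: "x \<in> B n"
      obtain r where r: "r > 0" "ball x r \<subseteq> \<gamma> x"
        using \<gamma> unfolding gauge_def by (meson open_contains_ball)
      obtain t where t: "\<bar>t - x\<bar> < r" "bad n x t" using x r unfolding B_def by blast
      have "{min x t..max x t} \<subseteq> ball x r"
        using t(1) by (auto simp: dist_real_def min_def max_def split: if_splits)
      then have "(x,t) \<in> K" using x t r by (auto simp: K_def)
      moreover have "x \<in> cball (ce (x,t)) (ra (x,t))" unfolding cb by auto
      ultimately show "x \<in> (\<Union>i\<in>K. cball (ce i) (ra i))" by blast
    qed
    have rad: "0 < ra i \<and> ra i \<le> b - a" if "i \<in> K" for i
      using that by (auto simp: K_def B_def bad_def ra_def)
    obtain C where C: "countable C" "C \<subseteq> K"
      and pw: "pairwise (\<lambda>i j. disjnt (cball (ce i) (ra i)) (cball (ce j) (ra j))) C"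
      and BC: "B n \<subseteq> (\<Union>i\<in>C. cball (ce i) (5 * ra i))"
      by (rule Vitali_covering_lemma_cballs[OF cov rad]) blast
    have bnd: "measure lebesgue (\<Union>i\<in>C'. cball (ce i) (5 * ra i)) \<le> e"
      if C': "C' \<subseteq> C" "finite C'" for C'
    proof -
      define tg where "tg = (\<lambda>(x::real,t). (x, {min x t..max x t}))"
      define p where "p = tg ` C'"
      have inK: "i \<in> K" if "i \<in> C'" for i using that C C' by blast
      have inj: "inj_on tg C'"
      proof (rule inj_onI, rule ccontr)
        fix i j assume ij: "i \<in> C'" "j \<in> C'" "tg i = tg j" "i \<noteq> j"
        then have "cball (ce i) (ra i) = cball (ce j) (ra j)"
          by (cases i; cases j) (auto simp: cb tg_def)
        moreover have "disjnt (cball (ce i) (ra i)) (cball (ce j) (ra j))"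
          using ij pw C' by (auto simp: pairwise_def)
        ultimately show False using rad[OF inK[OF ij(1)]] by (auto simp: disjnt_def)
      qed
      have part: "p tagged_partial_division_of (cbox a b)"
      unfolding tagged_partial_division_of_def
      proof (intro conjI allI impI)
        show "finite p" using C' by (simp add: p_def)
        show "x \<in> k" if "(x,k) \<in> p" for x k using that by (auto simp: p_def tg_def)
        show "k \<subseteq> cbox a b" if "(x,k) \<in> p" for x k
          using that inK by (fastforce simp: p_def tg_def K_def B_def bad_def)
        show "\<exists>a b. k = cbox a b" if "(x,k) \<in> p" for x k
          using that by (auto simp: p_def tg_def)
        fix x1 k1 x2 k2 assume h: "(x1, k1) \<in> p \<and> (x2, k2) \<in> p \<and> (x1, k1) \<noteq> (x2, k2)"
        obtain i where i: "i \<in> C'" "(x1,k1) = tg i" using h by (auto simp: p_def)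
        obtain j where j: "j \<in> C'" "(x2,k2) = tg j" using h by (auto simp: p_def)
        have "i \<noteq> j" using i j h by auto
        then have "disjnt (cball (ce i) (ra i)) (cball (ce j) (ra j))"
          using i j pw C' by (auto simp: pairwise_def)
        then have "k1 \<inter> k2 = {}" using i j by (cases i; cases j) (auto simp: cb tg_def disjnt_def)
        then show "interior k1 \<inter> interior k2 = {}"
          using interior_subset[of k1] interior_subset[of k2] by blast
      qed
      have fine: "\<gamma> fine p"
        using inK by (force simp: fine_def p_def tg_def K_def)
      have err: "2 * ra i / real (Suc n) \<le> (\<lambda>(x,k). norm (measure lborel k *\<^sub>R f x - integral k f)) (tg i)"
        if "i \<in> C'" for i
      proof -
        obtain x t where i: "i = (x,t)" by (cases i)
        have xt: "bad n x t" "x \<in> {a<..<b}" using inK[OF that] by (auto simp: i K_def B_def)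
        have "integral {min x t..max x t} f = (if x \<le> t then F t - F x else F x - F t)"
        proof -
          have *: "integral {u..v} f = F v - F u" if "a \<le> u" "u \<le> v" "v \<le> b" for u v
          proof -
            have "f integrable_on {a..v}" using f that by (auto intro: integrable_on_subinterval)
            then show ?thesis using Henstock_Kurzweil_Integration.integral_combine[of a u v f] that by (simp add: F_def)
          qed
          show ?thesis using xt *[of x t] *[of t x] by (auto simp: bad_def min_def max_def)
        qed
        then have "norm (measure lborel {min x t..max x t} *\<^sub>R f x - integral {min x t..max x t} f)
            = \<bar>F t - F x - f x * (t - x)\<bar>"
          by (auto simp: min_def max_def algebra_simps abs_minus_commute)
        then show ?thesis using xt by (auto simp: i tg_def ra_def bad_def)
      qed
      have "measure lebesgue (\<Union>i\<in>C'. cball (ce i) (5 * ra i)) \<le> (\<Sum>i\<in>C'. measure lebesgue (cball (ce i) (5 * ra i)))"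
        using C' by (intro measure_UNION_le) auto
      also have "\<dots> = (\<Sum>i\<in>C'. 10 * ra i)"
        using rad[OF inK] by (intro sum.cong refl) (force simp: cball_eq_atLeastAtMost)
      also have "\<dots> \<le> (\<Sum>i\<in>C'. 5 * real (Suc n) * (\<lambda>(x,k). norm (measure lborel k *\<^sub>R f x - integral k f)) (tg i))"
        proof (rule sum_mono)
        fix i assume "i \<in> C'"
        have scale: "10 * r \<le> 5 * real (Suc n) * G" if "2 * r / real (Suc n) \<le> G" for r G
          using that by (simp add: pos_divide_le_eq field_simps del: of_nat_Suc)
        show "10 * ra i \<le> 5 * real (Suc n) * (\<lambda>(x,k). norm (measure lborel k *\<^sub>R f x - integral k f)) (tg i)"
          by (rule scale[OF err[OF \<open>i \<in> C'\<close>]])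
      qed
      also have "\<dots> = 5 * real (Suc n) * sum (\<lambda>(x,k). norm (measure lborel k *\<^sub>R f x - integral k f)) p"
        unfolding p_def sum.reindex[OF inj] by (simp add: sum_distrib_left)
      also have "\<dots> \<le> 5 * real (Suc n) * e'"
        using hen[OF part fine] by (intro mult_left_mono) auto
      also have "\<dots> = e" by (simp add: e'_def)
      finally show ?thesis .
    qed
    have meas: "cball (ce i) (5 * ra i) \<in> lmeasurable" for i by simp
    show "\<exists>T. B n \<subseteq> T \<and> T \<in> lmeasurable \<and> measure lebesgue T \<le> e"
      using BC fmeasurable_UN_bound[OF C(1) meas bnd] measure_UN_bound[OF C(1) meas bnd] by blast
  qed
  have sub: "{x \<in> {a<..<b}. \<not> (F has_real_derivative f x) (at x)} \<subseteq> (\<Union>n. B n)"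
  proof (rule subsetI, rule ccontr)
    fix x assume x: "x \<in> {x \<in> {a<..<b}. \<not> (F has_real_derivative f x) (at x)}" "x \<notin> (\<Union>n. B n)"
    have "((\<lambda>t. (F t - F x) / (t - x)) \<longlongrightarrow> f x) (at x)"
    proof (rule tendstoI)
      fix e :: real assume "e > 0"
      then obtain n where n: "1 / real (Suc n) < e" using reals_Archimedean by (metis inverse_eq_divide)
      obtain r where r: "r > 0" "\<And>t. \<bar>t - x\<bar> < r \<Longrightarrow> \<not> bad n x t" using x by (auto simp: B_def)
      define r' where "r' = min r (min (x - a) (b - x))"
      have "r' > 0" using r x by (auto simp: r'_def)
      have "dist ((F t - F x) / (t - x)) (f x) < e" if t: "t \<noteq> x" "dist t x < r'" for t
      proof -
        have "\<bar>F t - F x - f x * (t - x)\<bar> \<le> \<bar>t - x\<bar> / real (Suc n)"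
          using r(2)[of t] t by (auto simp: bad_def r'_def dist_real_def)
        moreover have "(F t - F x) / (t - x) - f x = (F t - F x - f x * (t - x)) / (t - x)"
          using t by (simp add: field_simps)
        ultimately have "\<bar>(F t - F x) / (t - x) - f x\<bar> \<le> 1 / real (Suc n)"
          using t by (simp add: abs_divide pos_divide_le_eq)
        then show ?thesis using n by (simp add: dist_real_def)
      qed
      then show "\<forall>\<^sub>F t in at x. dist ((F t - F x) / (t - x)) (f x) < e"
        unfolding eventually_at using \<open>r' > 0\<close> by blast
    qed
    then show False using x by (simp add: has_field_derivative_iff)
  qed
  have "negligible (\<Union>n. B n)" using neg by (intro negligible_Union_nat) auto
  then show ?thesis using sub negligible_subset unfolding F_def by blast
qed

section \<open>Absolutely continuous functions as indefinite integrals\<close>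

text \<open>
  Completeness of \<open>L\<^sup>1\<close>: a rapidly Cauchy subsequence is a telescoping series that converges
  absolutely, and the series may be integrated termwise over every measurable set.
\<close>

lemma L1_Cauchy_subsequence_limit:
  fixes u :: "nat \<Rightarrow> 'a \<Rightarrow> real"
  assumes u: "\<And>n. integrable M (u n)"
    and C: "\<And>e. 0 < e \<Longrightarrow> \<exists>N. \<forall>m\<ge>N. \<forall>n\<ge>N. (\<integral>x. \<bar>u m x - u n x\<bar> \<partial>M) < e"
  obtains v r where "strict_mono (r :: nat \<Rightarrow> nat)" "integrable M v"
    "\<And>A. A \<in> sets M \<Longrightarrow> (\<lambda>k. \<integral>x. indicator A x * u (r k) x \<partial>M) \<longlonglongrightarrow> (\<integral>x. indicator A x * v x \<partial>M)"
proof -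
  define N where "N k = (SOME N. \<forall>m\<ge>N. \<forall>n\<ge>N. (\<integral>x. \<bar>u m x - u n x\<bar> \<partial>M) < (1/2)^k)" for k
  have N: "(\<integral>x. \<bar>u m x - u n x\<bar> \<partial>M) < (1/2)^k" if "m \<ge> N k" "n \<ge> N k" for k m n
    using someI_ex[OF C[of "(1/2)^k"]] that unfolding N_def by auto
  define r where "r = rec_nat (N 0) (\<lambda>k p. max (Suc p) (N (Suc k)))"
  have rS: "r (Suc k) = max (Suc (r k)) (N (Suc k))" for k by (simp add: r_def)
  have "strict_mono r" by (rule strict_monoI_Suc) (simp add: rS)
  have rN: "r k \<ge> N k" for k by (cases k) (simp_all add: r_def)
  define g where "g k = (\<lambda>x. u (r (Suc k)) x - u (r k) x)" for k
  have gi: "integrable M (g k)" for k unfolding g_def by (intro Bochner_Integration.integrable_diff u)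
  have gb: "(\<integral>x. norm (g k x) \<partial>M) \<le> (1/2)^k" for k
    using N[of k "r (Suc k)" "r k"] rN[of k] strict_monoD[OF \<open>strict_mono r\<close>, of k "Suc k"]
    by (simp add: g_def less_imp_le)
  have sm: "summable (\<lambda>k. \<integral>x. norm (g k x) \<partial>M)"
    by (rule summable_comparison_test[OF _ summable_geometric[of "1/2::real"]]) (use gb in auto)
  have "AE x in M. summable (\<lambda>k. norm (g k x))"
  proof -
    have "(\<integral>\<^sup>+x. (\<Sum>k. ennreal (norm (g k x))) \<partial>M) = (\<Sum>k. \<integral>\<^sup>+x. ennreal (norm (g k x)) \<partial>M)"
      using gi by (intro nn_integral_suminf) auto
    also have "\<dots> = (\<Sum>k. ennreal (\<integral>x. norm (g k x) \<partial>M))"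
      using gi by (intro suminf_cong nn_integral_eq_integral) auto
    also have "\<dots> \<noteq> \<infinity>"
      unfolding infinity_ennreal_def by (rule ennreal_suminf_neq_top[OF sm]) simp
    finally have "AE x in M. (\<Sum>k. ennreal (norm (g k x))) \<noteq> \<infinity>"
      using gi by (intro nn_integral_noteq_infinite) auto
    then show ?thesis
      unfolding infinity_ennreal_def by eventually_elim (rule summable_suminf_not_top, simp)
  qed
  note ae = this
  define v where "v = (\<lambda>x. u (r 0) x + (\<Sum>k. g k x))"
  have vi: "integrable M v"
    unfolding v_def by (intro Bochner_Integration.integrable_add u integrable_suminf gi ae sm)
  have "(\<lambda>k. \<integral>x. indicator A x * u (r k) x \<partial>M) \<longlonglongrightarrow> (\<integral>x. indicator A x * v x \<partial>M)" if A: "A \<in> sets M" for A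
  proof -
    have ui: "integrable M (\<lambda>x. indicator A x * u k x)" for k
      using integrable_mult_indicator[OF A u] by simp
    have Ai: "integrable M (\<lambda>x. indicator A x * g k x)" for k
      using integrable_mult_indicator[OF A gi] by simp
    have ae': "AE x in M. summable (\<lambda>k. norm (indicator A x * g k x))"
      using ae by eventually_elim (auto simp: indicator_def abs_mult)
    have "summable (\<lambda>k. \<integral>x. norm (indicator A x * g k x) \<partial>M)"
    proof (rule summable_comparison_test[OF _ sm], intro exI allI impI)
      fix k
      have "(\<integral>x. norm (indicator A x * g k x) \<partial>M) \<le> (\<integral>x. norm (g k x) \<partial>M)"
        using Ai gi by (intro integral_mono) (auto simp: indicator_def)
      then show "norm (\<integral>x. norm (indicator A x * g k x) \<partial>M) \<le> (\<integral>x. norm (g k x) \<partial>M)" by simp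
    qed
    from sums_integral[OF Ai ae' this]
    have "(\<lambda>k. \<integral>x. indicator A x * g k x \<partial>M) sums (\<integral>x. (\<Sum>k. indicator A x * g k x) \<partial>M)" .
    moreover have "(\<integral>x. (\<Sum>k. indicator A x * g k x) \<partial>M) = (\<integral>x. indicator A x * v x - indicator A x * u (r 0) x \<partial>M)"
      by (intro Bochner_Integration.integral_cong) (auto simp: v_def indicator_def)
    moreover have "\<dots> = (\<integral>x. indicator A x * v x \<partial>M) - (\<integral>x. indicator A x * u (r 0) x \<partial>M)"
      using integrable_mult_indicator[OF A vi] ui by (intro Bochner_Integration.integral_diff) auto
    moreover have "(\<Sum>j<k. \<integral>x. indicator A x * g j x \<partial>M)
        = (\<integral>x. indicator A x * u (r k) x \<partial>M) - (\<integral>x. indicator A x * u (r 0) x \<partial>M)" for k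
    proof -
      have "(\<integral>x. indicator A x * g j x \<partial>M) = (\<integral>x. indicator A x * u (r (Suc j)) x \<partial>M) - (\<integral>x. indicator A x * u (r j) x \<partial>M)" for j
        unfolding g_def right_diff_distrib using ui by (intro Bochner_Integration.integral_diff) auto
      then show ?thesis using sum_lessThan_telescope[of "\<lambda>k. \<integral>x. indicator A x * u (r k) x \<partial>M" k] by simp
    qed
    ultimately have "(\<lambda>k. (\<integral>x. indicator A x * u (r k) x \<partial>M) - (\<integral>x. indicator A x * u (r 0) x \<partial>M))
       \<longlonglongrightarrow> (\<integral>x. indicator A x * v x \<partial>M) - (\<integral>x. indicator A x * u (r 0) x \<partial>M)"
      by (simp add: sums_def)
    from tendsto_add[OF this tendsto_const[of "\<integral>x. indicator A x * u (r 0) x \<partial>M"]] show ?thesis by simp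
  qed
  with \<open>strict_mono r\<close> vi show thesis using that by blast
qed

text \<open>
  The Bregman divergence of the strictly convex function \<open>\<lambda>x. sqrt (1 + x\<^sup>2)\<close>. This function grows
  only linearly, so its integrals along an \<open>L\<^sup>1\<close>-bounded sequence stay bounded.
\<close>

definition bregman_sqrt :: "real \<Rightarrow> real \<Rightarrow> real" where
  "bregman_sqrt u w = sqrt (1 + w\<^sup>2) - sqrt (1 + u\<^sup>2) - u / sqrt (1 + u\<^sup>2) * (w - u)"

text \<open>
  With \<open>A = sqrt (1 + u\<^sup>2)\<close> and \<open>B = sqrt (1 + w\<^sup>2)\<close> the divergence is \<open>(A B - (1 + u w)) / A\<close>, and
  \<open>A\<^sup>2 B\<^sup>2 - (1 + u w)\<^sup>2 = (u - w)\<^sup>2\<close>.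
\<close>

lemma bregman_sqrt_lower:
  assumes "\<bar>u\<bar> \<le> K" "\<bar>w\<bar> \<le> K"
  shows "(u - w)\<^sup>2 \<le> 2 * (1 + K\<^sup>2)\<^sup>2 * bregman_sqrt u w"
proof -
  define A B where "A = sqrt (1 + u\<^sup>2)" and "B = sqrt (1 + w\<^sup>2)"
  have A2: "A\<^sup>2 = 1 + u\<^sup>2" and B2: "B\<^sup>2 = 1 + w\<^sup>2" by (simp_all add: A_def B_def)
  have A1: "A \<ge> 1" and B1: "B \<ge> 1" by (simp_all add: A_def B_def)
  have u2: "u\<^sup>2 \<le> K\<^sup>2" and w2: "w\<^sup>2 \<le> K\<^sup>2" using assms by (simp_all add: abs_le_square_iff[symmetric])
  have AK: "A \<le> 1 + K\<^sup>2"
    using A1 u2 A2 by (smt (verit) power2_eq_square mult_left_mono mult_cancel_left1 self_le_power)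
  have "bregman_sqrt u w = B - A - u * (w - u) / A" by (simp add: bregman_sqrt_def A_def B_def)
  then have *: "bregman_sqrt u w * A = A * B - (1 + u * w)"
    using A1 A2 by (simp add: field_simps power2_eq_square)
  have AB: "A * B \<le> 1 + K\<^sup>2"
  proof -
    have "2 * (A * B) \<le> A\<^sup>2 + B\<^sup>2" using sum_squares_bound[of A B] by simp
    then show ?thesis using A2 B2 u2 w2 by linarith
  qed
  have uw: "1 + u * w \<le> 1 + K\<^sup>2"
    using sum_squares_bound[of u w] u2 w2 by (simp add: algebra_simps)
  have sq: "(A * B - (1 + u * w)) * (A * B + (1 + u * w)) = (u - w)\<^sup>2"
  proof -
    have "(A * B - (1 + u * w)) * (A * B + (1 + u * w)) = A\<^sup>2 * B\<^sup>2 - (1 + u * w)\<^sup>2"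
      by (simp add: power2_eq_square algebra_simps)
    also have "\<dots> = (u - w)\<^sup>2" unfolding A2 B2 by (simp add: power2_eq_square algebra_simps)
    finally show ?thesis .
  qed
  have "\<bar>1 + u * w\<bar> \<le> A * B"
  proof -
    have "(1 + u * w)\<^sup>2 \<le> (A * B)\<^sup>2"
      unfolding power_mult_distrib A2 B2 using zero_le_power2[of "u - w"]
      by (simp add: power2_eq_square algebra_simps)
    then show ?thesis using A1 B1 by (simp add: abs_le_square_iff[symmetric] abs_mult)
  qed
  then have nn: "0 \<le> A * B - (1 + u * w)" by linarith
  have "(u - w)\<^sup>2 \<le> (A * B - (1 + u * w)) * (2 * (1 + K\<^sup>2))"
    unfolding sq[symmetric] using AB uw nn by (intro mult_left_mono) auto
  also have "\<dots> = bregman_sqrt u w * A * (2 * (1 + K\<^sup>2))" using * by simp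
  also have "\<dots> \<le> bregman_sqrt u w * (1 + K\<^sup>2) * (2 * (1 + K\<^sup>2))"
  proof -
    have "0 \<le> bregman_sqrt u w * A" using nn * by simp
    then have "0 \<le> bregman_sqrt u w" using A1 by (simp add: zero_le_mult_iff)
    then show ?thesis using AK by (intro mult_right_mono mult_left_mono) auto
  qed
  finally show ?thesis by (simp add: power2_eq_square algebra_simps)
qed

lemma bregman_sqrt_nonneg: "0 \<le> bregman_sqrt u w"
proof -
  define K where "K = max \<bar>u\<bar> \<bar>w\<bar>"
  have "0 \<le> 2 * (1 + K\<^sup>2)\<^sup>2 * bregman_sqrt u w"
    using bregman_sqrt_lower[of u K w] zero_le_power2[of "u - w"] unfolding K_def by linarith
  moreover have "0 < 2 * (1 + K\<^sup>2)\<^sup>2" using zero_le_power2[of K] by (intro mult_pos_pos zero_less_power) linarith+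
  ultimately show ?thesis by (simp add: zero_le_mult_iff)
qed

text \<open>
  Integrated, this bounds an \<open>L\<^sup>1\<close> distance by an arbitrarily small constant, a divergence, and the
  tails that uniform integrability controls.
\<close>

lemma abs_diff_le_bregman_sqrt:
  assumes "0 < \<eta>" "0 \<le> K"
  shows "\<bar>w - u\<bar> \<le> \<eta> + 2 * (1 + K\<^sup>2)\<^sup>2 / \<eta> * bregman_sqrt u w
     + 2 * (if \<bar>u\<bar> > K then \<bar>u\<bar> else 0) + 2 * (if \<bar>w\<bar> > K then \<bar>w\<bar> else 0)"
proof (cases "\<bar>u\<bar> > K \<or> \<bar>w\<bar> > K")
  case True
  have "0 \<le> 2 * (1 + K\<^sup>2)\<^sup>2 / \<eta> * bregman_sqrt u w"
    using bregman_sqrt_nonneg assms by auto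
  moreover define T where "T = 2 * (1 + K\<^sup>2)\<^sup>2 / \<eta> * bregman_sqrt u w"
  ultimately have "0 \<le> T" by simp
  then show ?thesis unfolding T_def[symmetric]
    using True assms abs_triangle_ineq4[of w u] by (cases "\<bar>u\<bar> > K"; cases "\<bar>w\<bar> > K") simp_all
next
  case False
  have "\<eta> * \<bar>w - u\<bar> \<le> \<eta>\<^sup>2 + (u - w)\<^sup>2"
  proof -
    have "0 \<le> \<eta> * \<bar>w - u\<bar>" using assms by simp
    moreover have "2 * (\<eta> * \<bar>w - u\<bar>) \<le> \<eta>\<^sup>2 + \<bar>w - u\<bar>\<^sup>2" using sum_squares_bound[of \<eta> "\<bar>w - u\<bar>"] by simp
    moreover have "\<bar>w - u\<bar>\<^sup>2 = (u - w)\<^sup>2" by (simp add: power2_commute)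
    ultimately show ?thesis by linarith
  qed
  also have "\<dots> \<le> \<eta>\<^sup>2 + 2 * (1 + K\<^sup>2)\<^sup>2 * bregman_sqrt u w"
    using bregman_sqrt_lower[of u K w] False by simp
  finally have "\<bar>w - u\<bar> \<le> (\<eta>\<^sup>2 + 2 * (1 + K\<^sup>2)\<^sup>2 * bregman_sqrt u w) / \<eta>"
    using assms by (simp add: pos_le_divide_eq mult.commute)
  also have "\<dots> = \<eta> + 2 * (1 + K\<^sup>2)\<^sup>2 / \<eta> * bregman_sqrt u w"
    using assms by (simp add: field_simps power2_eq_square)
  finally show ?thesis using False by auto
qed

lemma abs_continuous_on_Icc_finite_family:
  assumes "abs_continuous_on_Icc a b f" "0 < \<epsilon>"
  shows "\<exists>\<delta>>0. \<forall>(S :: 'i set) s t. finite S \<and> (\<forall>i\<in>S. a \<le> s i \<and> s i \<le> t i \<and> t i \<le> b) \<and>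
     (\<forall>i\<in>S. \<forall>j\<in>S. i \<noteq> j \<longrightarrow> {s i<..<t i} \<inter> {s j<..<t j} = {}) \<and>
     (\<Sum>i\<in>S. t i - s i) < \<delta> \<longrightarrow> (\<Sum>i\<in>S. \<bar>f (t i) - f (s i)\<bar>) < \<epsilon>"
proof -
  have "\<exists>\<delta>>0. \<forall>(n::nat) s t.
        (\<forall>i<n. a \<le> s i \<and> s i \<le> t i \<and> t i \<le> b) \<and>
        (\<forall>i<n. \<forall>j<n. i \<noteq> j \<longrightarrow> {s i<..<t i} \<inter> {s j<..<t j} = {}) \<and>
        (\<Sum>i<n. t i - s i) < \<delta> \<longrightarrow> (\<Sum>i<n. \<bar>f (t i) - f (s i)\<bar>) < \<epsilon>"
    using assms unfolding abs_continuous_on_Icc_def by simp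
  then obtain \<delta> where "\<delta> > 0" and \<delta>: "\<forall>(n::nat) s t.
        (\<forall>i<n. a \<le> s i \<and> s i \<le> t i \<and> t i \<le> b) \<and>
        (\<forall>i<n. \<forall>j<n. i \<noteq> j \<longrightarrow> {s i<..<t i} \<inter> {s j<..<t j} = {}) \<and>
        (\<Sum>i<n. t i - s i) < \<delta> \<longrightarrow> (\<Sum>i<n. \<bar>f (t i) - f (s i)\<bar>) < \<epsilon>"
    by (elim exE conjE)
  show ?thesis
  proof (intro exI[of _ \<delta>] conjI allI impI \<open>\<delta> > 0\<close>, elim conjE)
    fix S :: "'i set" and s t
    assume S: "finite S" "\<forall>i\<in>S. a \<le> s i \<and> s i \<le> t i \<and> t i \<le> b"
      and d: "\<forall>i\<in>S. \<forall>j\<in>S. i \<noteq> j \<longrightarrow> {s i<..<t i} \<inter> {s j<..<t j} = {}"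
      and l: "(\<Sum>i\<in>S. t i - s i) < \<delta>"
    obtain h where h: "bij_betw h {0..<card S} S" using ex_bij_betw_nat_finite[OF S(1)] by blast
    have h': "bij_betw h {..<card S} S" using h by (simp add: atLeast0LessThan)
    have hS: "h i \<in> S" if "i < card S" for i using h' that by (auto simp: bij_betw_def)
    have hi: "h i \<noteq> h j" if "i < card S" "j < card S" "i \<noteq> j" for i j
      using h' that by (auto simp: bij_betw_def inj_on_def)
    have "(\<Sum>i<card S. \<bar>f (t (h i)) - f (s (h i))\<bar>) < \<epsilon>"
    proof (rule \<delta>[rule_format], intro conjI)
      show "\<forall>i<card S. a \<le> s (h i) \<and> s (h i) \<le> t (h i) \<and> t (h i) \<le> b" using S(2) hS by blast
      show "\<forall>i<card S. \<forall>j<card S. i \<noteq> j \<longrightarrow> {s (h i)<..<t (h i)} \<inter> {s (h j)<..<t (h j)} = {}"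
        using d hS hi by blast
      show "(\<Sum>i<card S. t (h i) - s (h i)) < \<delta>"
        using l sum.reindex_bij_betw[OF h', of "\<lambda>i. t i - s i"] by simp
    qed
    then show "(\<Sum>i\<in>S. \<bar>f (t i) - f (s i)\<bar>) < \<epsilon>"
      using sum.reindex_bij_betw[OF h', of "\<lambda>i. \<bar>f (t i) - f (s i)\<bar>"] by simp
  qed
qed

lemma abs_continuous_on_Icc_imp_continuous_on:
  assumes "abs_continuous_on_Icc a b f"
  shows "continuous_on {a..b} f"
proof (rule continuous_onI)
  fix x e :: real assume x: "x \<in> {a..b}" and "0 < e"
  obtain \<delta> where "0 < \<delta>" and d: "\<forall>(S :: unit set) s t. finite S \<and> (\<forall>i\<in>S. a \<le> s i \<and> s i \<le> t i \<and> t i \<le> b) \<and>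
     (\<forall>i\<in>S. \<forall>j\<in>S. i \<noteq> j \<longrightarrow> {s i<..<t i} \<inter> {s j<..<t j} = {}) \<and>
     (\<Sum>i\<in>S. t i - s i) < \<delta> \<longrightarrow> (\<Sum>i\<in>S. \<bar>f (t i) - f (s i)\<bar>) < e"
    using abs_continuous_on_Icc_finite_family[OF assms \<open>0 < e\<close>] by (elim exE conjE)
  show "\<exists>d>0. \<forall>x'\<in>{a..b}. dist x' x < d \<longrightarrow> dist (f x') (f x) \<le> e"
  proof (intro exI[of _ \<delta>] conjI ballI impI \<open>0 < \<delta>\<close>)
    fix y assume y: "y \<in> {a..b}" "dist y x < \<delta>"
    have "(\<Sum>i\<in>{()}. \<bar>f (max x y) - f (min x y)\<bar>) < e"
      by (rule d[rule_format]) (use x y in \<open>auto simp: dist_real_def\<close>)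
    then show "dist (f y) (f x) \<le> e" by (auto simp: dist_real_def max_def min_def split: if_splits)
  qed
qed

text \<open>
  The density is the \<open>L\<^sup>1\<close> limit of the difference quotients \<open>v n\<close> of \<open>f\<close> along the grid of
  mesh \<open>(b - a) / 2\<^sup>n\<close>. They form a martingale: over a cell of an earlier grid, \<open>v m\<close> has the same
  integral as \<open>v n\<close>. Hence the divergence of \<open>v m\<close> from \<open>v n\<close> integrates to the difference of
  the integrals \<open>\<I> m\<close> and \<open>\<I> n\<close> of a convex function, which increase and are bounded, and so form a
  Cauchy sequence. Absolute continuity makes the sequence uniformly integrable, and the two together
  give convergence.
\<close>

lemma abs_continuous_on_Icc_imp_indefinite_integral:
  assumes AC: "abs_continuous_on_Icc a b f" and ab: "a \<le> b"
  obtains v where "v absolutely_integrable_on {a..b}"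
    "\<And>x. x \<in> {a..b} \<Longrightarrow> (v has_integral (f x - f a)) {a..x}"
proof (cases "a = b")
  case True
  then show ?thesis using that[of "\<lambda>_. 0"] by (auto intro!: has_integral_refl)
next
  case False
  with ab have "a < b" by simp
  define \<delta> where "\<delta> n = (b - a) / 2 ^ n" for n :: nat
  define x where "x n k = a + real k * \<delta> n" for n k
  define D where "D n k = f (x n (Suc k)) - f (x n k)" for n k
  define c where "c n k = D n k / \<delta> n" for n k
  define v where "v n y = c n (nat \<lfloor>(y - a) / \<delta> n\<rfloor>)" for n y
  define M where "M = lebesgue_on {a..b}"
  have \<delta>pos: "\<delta> n > 0" for n using \<open>a < b\<close> by (simp add: \<delta>_def)
  have cD: "c n k * \<delta> n = D n k" for n k using \<delta>pos[of n] by (simp add: c_def)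
  have cDabs: "\<bar>D n k\<bar> = \<bar>c n k\<bar> * \<delta> n" for n k using \<delta>pos[of n] by (simp add: cD[symmetric] abs_mult)
  have x0: "x n 0 = a" for n by (simp add: x_def)
  have xS: "x n (Suc k) = x n k + \<delta> n" for n k by (simp add: x_def algebra_simps)
  have xend: "x n (2 ^ n) = b" for n by (simp add: x_def \<delta>_def)
  have xle: "x n k \<le> x n j" if "k \<le> j" for n k j
    using that \<delta>pos[of n] by (simp add: x_def mult_right_mono)
  have x2: "x (Suc n) (2 * k) = x n k" for n k by (simp add: x_def \<delta>_def)
  have vcell: "v n y = c n k" if "x n k \<le> y" "y < x n (Suc k)" for n k y
  proof -
    have "real k \<le> (y - a) / \<delta> n" "(y - a) / \<delta> n < real k + 1"
      using that \<delta>pos[of n] by (simp_all add: x_def pos_le_divide_eq pos_divide_less_eq algebra_simps)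
    then have "\<lfloor>(y - a) / \<delta> n\<rfloor> = int k" by linarith
    then show ?thesis by (simp add: v_def)
  qed
  have cellmult: "((\<lambda>y. \<Phi> (v n y) * u y) has_integral \<Phi> (c n k) * J) {x n k..x n (Suc k)}"
    if "(u has_integral (J::real)) {x n k..x n (Suc k)}" for \<Phi> :: "real \<Rightarrow> real" and n u J k
  proof -
    \<comment> \<open>the right endpoint belongs to the next cell, which integrals do not see\<close>
    have "((\<lambda>y. \<Phi> (c n k) * u y) has_integral \<Phi> (c n k) * J) (cbox (x n k) (x n (Suc k)))"
      using has_integral_mult_right[OF that, of "\<Phi> (c n k)"] by simp
    then have "((\<lambda>y. \<Phi> (v n y) * u y) has_integral \<Phi> (c n k) * J) (cbox (x n k) (x n (Suc k)))"
      by (rule has_integral_spike_interior) (simp add: vcell[of n k])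
    then show ?thesis by simp
  qed
  have cellconst: "((\<lambda>y. \<Phi> (v n y)) has_integral \<Phi> (c n k) * \<delta> n) {x n k..x n (Suc k)}" for \<Phi> :: "real \<Rightarrow> real" and n k
    using cellmult[of "\<lambda>_. 1" "\<delta> n" n k \<Phi>] has_integral_const_real[of "1::real" "x n k" "x n (Suc k)"] \<delta>pos[of n]
    by (simp add: xS)
  have cellsj: "(u has_integral (\<Sum>k<j. J k)) {a..x n j}"
    if "\<And>k. k < j \<Longrightarrow> (u has_integral J k) {x n k..x n (Suc k)}" for u :: "real \<Rightarrow> real" and J n j
    using that
  proof (induction j)
    case 0
    then show ?case by (simp add: x0 has_integral_refl)
  next
    case (Suc j)
    show ?case
      unfolding sum.lessThan_Suc
      by (rule has_integral_combine[where c = "x n j"])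
         (use Suc.IH Suc.prems xle[of 0 j n] xle[of j "Suc j" n] in \<open>auto simp: x0\<close>)
  qed
  have cells: "(u has_integral (\<Sum>k<2^n. J k)) {a..b}"
    if "\<And>k. k < 2 ^ n \<Longrightarrow> (u has_integral J k) {x n k..x n (Suc k)}" for u :: "real \<Rightarrow> real" and J n
    using cellsj[of "2 ^ n" u J n] that by (simp add: xend)
  have tower: "(v (n + d) has_integral D n k) {x n k..x n (Suc k)}" for n d k
  proof (induction d arbitrary: n k)
    case 0
    then show ?case using cellconst[of "\<lambda>z. z" n k] cD by simp
  next
    case (Suc d)
    have "D n k = D (Suc n) (2 * k) + D (Suc n) (Suc (2 * k))"
      using x2[of n k] x2[of n "Suc k"] by (simp add: D_def)
    moreover have "(v (n + Suc d) has_integral (D (Suc n) (2 * k) + D (Suc n) (Suc (2 * k)))) {x n k..x n (Suc k)}"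
    proof (rule has_integral_combine[where c = "x (Suc n) (Suc (2 * k))"])
      show "x n k \<le> x (Suc n) (Suc (2 * k))" using xle[of "2 * k" "Suc (2 * k)" "Suc n"] x2 by simp
      show "x (Suc n) (Suc (2 * k)) \<le> x n (Suc k)" using xle[of "Suc (2 * k)" "2 * Suc k" "Suc n"] x2[of n "Suc k"] by simp
      show "(v (n + Suc d) has_integral D (Suc n) (2 * k)) {x n k..x (Suc n) (Suc (2 * k))}"
        using Suc.IH[of "Suc n" "2 * k"] x2 by simp
      show "(v (n + Suc d) has_integral D (Suc n) (Suc (2 * k))) {x (Suc n) (Suc (2 * k))..x n (Suc k)}"
        using Suc.IH[of "Suc n" "Suc (2 * k)"] x2[of n "Suc k"] by simp
    qed
    ultimately show ?case by simp
  qed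
  have tower': "(v m has_integral D n k) {x n k..x n (Suc k)}" if "n \<le> m" for n m k
    using tower[of n "m - n" k] that by simp
  \<comment> \<open>uniform integrability of the difference quotients, which is absolute continuity read off the grid\<close>
  have UI: "\<exists>K\<ge>0. \<exists>N. \<forall>n\<ge>N. (\<Sum>k<2^n. if \<bar>c n k\<bar> > K then \<bar>D n k\<bar> else 0) < \<epsilon>" if e0: "0 < \<epsilon>" for \<epsilon>
  proof -
    obtain \<rho> where "\<rho> > 0" and \<rho>: "\<forall>(S :: nat set) s t. finite S \<and> (\<forall>i\<in>S. a \<le> s i \<and> s i \<le> t i \<and> t i \<le> b) \<and>
     (\<forall>i\<in>S. \<forall>j\<in>S. i \<noteq> j \<longrightarrow> {s i<..<t i} \<inter> {s j<..<t j} = {}) \<and>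
     (\<Sum>i\<in>S. t i - s i) < \<rho> \<longrightarrow> (\<Sum>i\<in>S. \<bar>f (t i) - f (s i)\<bar>) < \<epsilon>"
      using abs_continuous_on_Icc_finite_family[OF AC e0] by (elim exE conjE)
    define K where "K = 2 * \<epsilon> / \<rho>"
    have "K > 0" using e0 \<open>\<rho> > 0\<close> by (simp add: K_def)
    obtain N where N: "2 * (b - a) / \<rho> < 2 ^ N" using real_arch_pow[of 2 "2 * (b - a) / \<rho>"] by auto
    have small: "(\<Sum>k\<in>S. \<bar>D n k\<bar>) < \<epsilon>" if S: "S \<subseteq> {..<2^n}" "real (card S) * \<delta> n < \<rho>" for S n
    proof -
      have "finite S" using S finite_subset by blast
      have "(\<Sum>i\<in>S. \<bar>f (x n (Suc i)) - f (x n i)\<bar>) < \<epsilon>"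
      proof (rule \<rho>[rule_format], intro conjI ballI impI)
        show "finite S" by fact
        fix i assume "i \<in> S"
        then have "i < 2 ^ n" using S by auto
        then show "a \<le> x n i" "x n i \<le> x n (Suc i)" "x n (Suc i) \<le> b"
          using xle[of 0 i n] xle[of i "Suc i" n] xle[of "Suc i" "2 ^ n" n] by (auto simp: x0 xend)
        fix j assume "i \<noteq> j"
        then have "i < j \<or> j < i" by auto
        then show "{x n i<..<x n (Suc i)} \<inter> {x n j<..<x n (Suc j)} = {}"
          using xle[of "Suc i" j n] xle[of "Suc j" i n] by auto
      next
        show "(\<Sum>i\<in>S. x n (Suc i) - x n i) < \<rho>" using S by (simp add: xS)
      qed
      then show ?thesis by (simp add: D_def)
    qed
    have "(\<Sum>k<2^n. if \<bar>c n k\<bar> > K then \<bar>D n k\<bar> else 0) < \<epsilon>" if "n \<ge> N" for n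
    proof -
      have \<delta>\<rho>: "\<delta> n < \<rho> / 2"
      proof -
        have "(2::real) ^ N \<le> 2 ^ n" using that by (simp add: power_increasing)
        then have "2 * (b - a) / \<rho> < 2 ^ n" using N by linarith
        then show ?thesis using \<open>\<rho> > 0\<close> by (simp add: \<delta>_def field_simps)
      qed
      define S where "S = {k. k < 2 ^ n \<and> \<bar>c n k\<bar> > K}"
      have "finite S" by (rule finite_subset[of _ "{..<2^n}"]) (auto simp: S_def)
      \<comment> \<open>otherwise select cells of total length between \<open>\<rho> / 2\<close> and \<open>\<rho>\<close>; the steep slopes make \<open>f\<close> vary by \<open>\<epsilon>\<close> on them\<close>
      have "real (card S) * \<delta> n < \<rho>"
      proof (rule ccontr)
        assume large: "\<not> real (card S) * \<delta> n < \<rho>"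
        define j where "j = nat \<lceil>\<rho> / (2 * \<delta> n)\<rceil>"
        have jlo: "\<rho> / (2 * \<delta> n) \<le> real j" unfolding j_def by linarith
        have "\<rho> / (2 * \<delta> n) > 0" using \<open>\<rho> > 0\<close> \<delta>pos by simp
        then have "real j < \<rho> / (2 * \<delta> n) + 1" unfolding j_def by linarith
        then have "real j * \<delta> n < (\<rho> / (2 * \<delta> n) + 1) * \<delta> n" using \<delta>pos[of n] by simp
        also have "\<dots> = \<rho> / 2 + \<delta> n" using \<delta>pos[of n] by (simp add: field_simps)
        finally have jhi: "real j * \<delta> n < \<rho>" using \<delta>\<rho> by linarith
        have "real j * \<delta> n < real (card S) * \<delta> n" using jhi large by linarith
        then have "j \<le> card S" using \<delta>pos[of n] by simp
        then obtain T where T: "T \<subseteq> S" "card T = j" by (rule obtain_subset_with_card_n)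
        have "\<epsilon> = K * (\<rho> / 2)" using \<open>\<rho> > 0\<close> by (simp add: K_def)
        also have "\<dots> \<le> K * (real j * \<delta> n)"
          using jlo \<open>K > 0\<close> \<delta>pos[of n] by (intro mult_left_mono) (simp_all add: pos_divide_le_eq mult.commute mult.left_commute)
        also have "\<dots> = (\<Sum>k\<in>T. K * \<delta> n)" using T by simp
        also have "\<dots> \<le> (\<Sum>k\<in>T. \<bar>D n k\<bar>)"
        proof (rule sum_mono)
          fix k assume "k \<in> T"
          then have "\<bar>c n k\<bar> > K" using T by (auto simp: S_def)
          with cDabs show "K * \<delta> n \<le> \<bar>D n k\<bar>" using \<delta>pos[of n] by simp
        qed
        also have "\<dots> < \<epsilon>" by (rule small) (use T jhi in \<open>auto simp: S_def\<close>)
        finally show False by simp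
      qed
      then have "(\<Sum>k\<in>S. \<bar>D n k\<bar>) < \<epsilon>" by (intro small) (auto simp: S_def)
      moreover have "(\<Sum>k<2^n. if \<bar>c n k\<bar> > K then \<bar>D n k\<bar> else 0) = (\<Sum>k\<in>S. \<bar>D n k\<bar>)"
        by (simp add: sum.inter_filter[symmetric] S_def lessThan_def)
      ultimately show ?thesis by simp
    qed
    then show ?thesis using \<open>K > 0\<close> by (intro exI[of _ K]) auto
  qed
  define \<I> where "\<I> n = (\<Sum>k<2^n. sqrt (1 + (c n k)\<^sup>2) * \<delta> n)" for n
  have sqrt_int: "((\<lambda>y. sqrt (1 + (v n y)\<^sup>2)) has_integral \<I> n) {a..b}" for n
    unfolding \<I>_def by (rule cells) (rule cellconst[of "\<lambda>z. sqrt (1 + z\<^sup>2)"])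
  have breg: "((\<lambda>y. bregman_sqrt (v n y) (v m y)) has_integral (\<I> m - \<I> n)) {a..b}" if "n \<le> m" for n m
  proof -
    define \<phi> where "\<phi> z = z / sqrt (1 + z\<^sup>2)" for z :: real
    have 1: "((\<lambda>y. \<phi> (v n y) * v m y) has_integral (\<Sum>k<2^n. \<phi> (c n k) * D n k)) {a..b}"
      by (intro cells cellmult tower' that)
    have 2: "((\<lambda>y. \<phi> (v n y) * v n y) has_integral (\<Sum>k<2^n. \<phi> (c n k) * D n k)) {a..b}"
      by (intro cells cellmult tower') simp
    from has_integral_add[OF has_integral_diff[OF has_integral_diff[OF sqrt_int[of m] sqrt_int[of n]] 1] 2]
    moreover have "(\<lambda>y. bregman_sqrt (v n y) (v m y)) = (\<lambda>y. sqrt (1 + (v m y)\<^sup>2) - sqrt (1 + (v n y)\<^sup>2)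
        - \<phi> (v n y) * v m y + \<phi> (v n y) * v n y)"
      by (simp add: fun_eq_iff bregman_sqrt_def \<phi>_def right_diff_distrib)
    ultimately show ?thesis by simp
  qed
  have \<I>mono: "\<I> n \<le> \<I> m" if "n \<le> m" for n m
    using has_integral_nonneg[OF breg[OF that]] bregman_sqrt_nonneg by simp
  have "\<exists>B N. \<forall>n\<ge>N. \<I> n \<le> B"
  proof -
    have "\<exists>K\<ge>0. \<exists>N. \<forall>n\<ge>N. (\<Sum>k<2^n. if \<bar>c n k\<bar> > K then \<bar>D n k\<bar> else 0) < 1"
      by (rule UI) simp
    then obtain K N where K: "K \<ge> 0" "\<forall>n\<ge>N. (\<Sum>k<2^n. if \<bar>c n k\<bar> > K then \<bar>D n k\<bar> else 0) < 1"
      by (elim exE conjE)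
    have "\<I> n \<le> (1 + K) * (b - a) + 1" if "n \<ge> N" for n
    proof -
      have "sqrt (1 + (c n k)\<^sup>2) * \<delta> n \<le> (1 + K) * \<delta> n + (if \<bar>c n k\<bar> > K then \<bar>D n k\<bar> else 0)" for k
      proof -
        have "sqrt (1 + (c n k)\<^sup>2) \<le> 1 + \<bar>c n k\<bar>"
          using sqrt_add_le_add_sqrt[of 1 "(c n k)\<^sup>2"] by simp
        then have "sqrt (1 + (c n k)\<^sup>2) * \<delta> n \<le> (1 + \<bar>c n k\<bar>) * \<delta> n" using \<delta>pos[of n] by simp
        moreover have "\<bar>D n k\<bar> = \<bar>c n k\<bar> * \<delta> n" by (rule cDabs)
        moreover have "\<bar>c n k\<bar> * \<delta> n \<le> K * \<delta> n" if "\<not> \<bar>c n k\<bar> > K" using that \<delta>pos[of n] by simp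
        moreover have "0 \<le> K * \<delta> n" using K \<delta>pos[of n] by simp
        ultimately show ?thesis by (auto simp: distrib_right)
      qed
      then have "\<I> n \<le> (\<Sum>k<2^n. (1 + K) * \<delta> n + (if \<bar>c n k\<bar> > K then \<bar>D n k\<bar> else 0))"
        unfolding \<I>_def by (intro sum_mono) 
      also have "\<dots> = (\<Sum>k<(2::nat)^n. (1 + K) * \<delta> n) + (\<Sum>k<2^n. if \<bar>c n k\<bar> > K then \<bar>D n k\<bar> else 0)"
        by (rule sum.distrib)
      also have "(\<Sum>k<(2::nat)^n. (1 + K) * \<delta> n) = (1 + K) * (b - a)" by (simp add: \<delta>_def)
      finally have "\<I> n \<le> (1 + K) * (b - a) + (\<Sum>k<2^n. if \<bar>c n k\<bar> > K then \<bar>D n k\<bar> else 0)" .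
      moreover have "(\<Sum>k<2^n. if \<bar>c n k\<bar> > K then \<bar>D n k\<bar> else 0) < 1" using K that by blast
      ultimately show ?thesis by linarith
    qed
    then show ?thesis by blast
  qed
  then obtain B N0 where B: "\<And>n. n \<ge> N0 \<Longrightarrow> \<I> n \<le> B" by blast
  have "\<I> n \<le> B" for n using B[of "max n N0"] \<I>mono[of n "max n N0"] by simp
  moreover have "incseq \<I>" using \<I>mono by (simp add: incseq_def)
  ultimately obtain L where "\<I> \<longlonglongrightarrow> L"
    using incseq_convergent[of \<I> B] by blast
  then have "convergent \<I>" by (rule convergentI)
  then have \<I>C: "Cauchy \<I>" by (rule convergent_Cauchy)
  have fin: "finite_measure M" unfolding M_def by (rule finite_measure_lebesgue_on) simp
  have vm: "v n \<in> borel_measurable M" for n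
  proof -
    have "(\<lambda>y::real. nat \<lfloor>(y - a) / \<delta> n\<rfloor>) \<in> measurable lborel (count_space UNIV)" by measurable
    then have "v n \<in> borel_measurable lborel"
      unfolding v_def by (rule measurable_compose) simp
    then show ?thesis unfolding M_def by (intro measurable_restrict_space1 measurable_completion)
  qed
  define BB where "BB n = (\<Sum>k\<le>2^n. \<bar>c n k\<bar>)" for n
  have vb: "\<bar>v n y\<bar> \<le> BB n" if "y \<in> {a..b}" for n y
  proof -
    have "(y - a) / \<delta> n \<le> 2 ^ n" using that \<open>a < b\<close> by (simp add: \<delta>_def field_simps)
    then have "nat \<lfloor>(y - a) / \<delta> n\<rfloor> \<le> 2 ^ n"
      by (simp add: nat_le_iff floor_le_iff)
    then show ?thesis unfolding BB_def v_def by (intro member_le_sum) auto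
  qed
  have bint: "integrable M h" if "h \<in> borel_measurable M" "\<And>y. y \<in> {a..b} \<Longrightarrow> \<bar>h y\<bar> \<le> C" for h and C :: real
    using that by (intro finite_measure.integrable_const_bound[OF fin, of h C]) (auto simp: M_def AE_restrict_space_iff)
  have vi: "integrable M (v n)" for n by (rule bint[OF vm vb])
  have Meq: "integral\<^sup>L M h = J" if "integrable M h" "(h has_integral J) {a..b}" for h :: "real \<Rightarrow> real" and J
  proof -
    have "integral\<^sup>L M h = integral {a..b} h"
      using that(1) unfolding M_def by (intro lebesgue_integral_eq_integral) simp_all
    then show ?thesis using integral_unique[OF that(2)] by simp
  qed
  have Cau: "\<exists>N. \<forall>m\<ge>N. \<forall>n\<ge>N. (\<integral>y. \<bar>v m y - v n y\<bar> \<partial>M) < e" if e0: "0 < e" for e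
  proof -
    define \<eta> where "\<eta> = e / (4 * (b - a))"
    have "\<eta> > 0" using e0 \<open>a < b\<close> by (simp add: \<eta>_def)
    have "\<exists>K\<ge>0. \<exists>N. \<forall>n\<ge>N. (\<Sum>k<2^n. if \<bar>c n k\<bar> > K then \<bar>D n k\<bar> else 0) < e / 8"
      by (rule UI) (use e0 in simp)
    then obtain K N1 where K: "K \<ge> 0" and N1: "\<forall>n\<ge>N1. (\<Sum>k<2^n. if \<bar>c n k\<bar> > K then \<bar>D n k\<bar> else 0) < e / 8"
      by (elim exE conjE)
    define Q where "Q = 2 * (1 + K\<^sup>2)\<^sup>2 / \<eta>"
    have "Q > 0" using \<open>\<eta> > 0\<close> zero_le_power2[of K] unfolding Q_def by (intro divide_pos_pos mult_pos_pos zero_less_power) linarith+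
    have "\<exists>N2. \<forall>m\<ge>N2. \<forall>n\<ge>N2. norm (\<I> m - \<I> n) < e / (4 * Q)"
      using e0 \<open>Q > 0\<close> by (intro CauchyD[OF \<I>C]) simp
    then obtain N2 where N2: "\<forall>m\<ge>N2. \<forall>n\<ge>N2. norm (\<I> m - \<I> n) < e / (4 * Q)"
      by (elim exE)
    have le: "(\<integral>y. \<bar>v m y - v n y\<bar> \<partial>M) < e" if nm: "n \<le> m" "n \<ge> N1" "n \<ge> N2" for m n
    proof -
      define t where "t n y = (if \<bar>v n y\<bar> > K then \<bar>v n y\<bar> else 0)" for n y
      define s where "s n = (\<Sum>k<2^n. if \<bar>c n k\<bar> > K then \<bar>D n k\<bar> else 0)" for n
      have tI: "(t n has_integral s n) {a..b}" for n
      proof -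
        have "((\<lambda>y. (\<lambda>z. if \<bar>z\<bar> > K then \<bar>z\<bar> else 0) (v n y)) has_integral
            (\<Sum>k<2^n. (\<lambda>z. if \<bar>z\<bar> > K then \<bar>z\<bar> else 0) (c n k) * \<delta> n)) {a..b}"
          by (intro cells cellconst)
        moreover have "(\<lambda>z. if \<bar>z\<bar> > K then \<bar>z\<bar> else 0) (c n k) * \<delta> n = (if \<bar>c n k\<bar> > K then \<bar>D n k\<bar> else 0)" for k
          by (simp add: cDabs)
        ultimately show ?thesis by (simp add: t_def[abs_def] s_def)
      qed
      define R where "R y = \<eta> + Q * bregman_sqrt (v n y) (v m y) + 2 * t n y + 2 * t m y" for y
      have RI: "(R has_integral (\<eta> * (b - a) + Q * (\<I> m - \<I> n) + 2 * s n + 2 * s m)) {a..b}"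
        unfolding R_def
        by (intro has_integral_add has_integral_mult_right tI breg nm)
           (use has_integral_const_real[of \<eta> a b] \<open>a < b\<close> in \<open>simp add: mult.commute\<close>)
      have di: "integrable M (\<lambda>y. \<bar>v m y - v n y\<bar>)" using vi by auto
      then have "(\<lambda>y. \<bar>v m y - v n y\<bar>) integrable_on {a..b}"
        unfolding M_def by (rule integrable_on_lebesgue_on) simp
      then have hi: "((\<lambda>y. \<bar>v m y - v n y\<bar>) has_integral (\<integral>y. \<bar>v m y - v n y\<bar> \<partial>M)) {a..b}"
        using Meq[OF di integrable_integral] integrable_integral by simp
      have "(\<integral>y. \<bar>v m y - v n y\<bar> \<partial>M) \<le> \<eta> * (b - a) + Q * (\<I> m - \<I> n) + 2 * s n + 2 * s m"
      proof (rule has_integral_le[OF hi RI])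
        fix y
        show "\<bar>v m y - v n y\<bar> \<le> R y"
          using abs_diff_le_bregman_sqrt[OF \<open>\<eta> > 0\<close> K, of "v m y" "v n y"] by (simp add: R_def t_def Q_def)
      qed
      moreover have "b - a \<noteq> 0" using \<open>a < b\<close> by simp
      then have "\<eta> * (b - a) = e / 4" unfolding \<eta>_def by (simp add: divide_simps)
      moreover have "Q * (\<I> m - \<I> n) < e / 4"
      proof -
        have "\<bar>\<I> m - \<I> n\<bar> < e / (4 * Q)" using N2 nm by (simp add: real_norm_def)
        then have "Q * (\<I> m - \<I> n) < Q * (e / (4 * Q))" using \<open>Q > 0\<close> by (intro mult_strict_left_mono) auto
        then show ?thesis using \<open>Q > 0\<close> by simp
      qed
      moreover have "s n < e / 8" "s m < e / 8" using N1 nm by (auto simp: s_def)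
      ultimately show ?thesis by linarith
    qed
    show ?thesis
    proof (intro exI[of _ "max N1 N2"] allI impI)
      fix m n assume "max N1 N2 \<le> m" "max N1 N2 \<le> n"
      then show "(\<integral>y. \<bar>v m y - v n y\<bar> \<partial>M) < e"
        using le[of n m] le[of m n] by (cases "n \<le> m") (auto simp: abs_minus_commute)
    qed
  qed
  obtain vl r where r: "strict_mono (r :: nat \<Rightarrow> nat)" and vl: "integrable M vl"
    and lim: "\<And>A. A \<in> sets M \<Longrightarrow> (\<lambda>k. \<integral>y. indicator A y * v (r k) y \<partial>M) \<longlonglongrightarrow> (\<integral>y. indicator A y * vl y \<partial>M)"
    by (rule L1_Cauchy_subsequence_limit[OF vi Cau]) (assumption+, blast)
  have Icc_sets: "{a..z} \<in> sets M" if "z \<in> {a..b}" for z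
    using that by (simp add: M_def sets_restrict_space_iff)
  have ind: "integrable M (\<lambda>y. indicator {a..z} y * u y)" if "integrable M u" "z \<in> {a..b}" for u :: "real \<Rightarrow> real" and z
    using integrable_mult_indicator[OF Icc_sets that(1)] that(2) by simp
  have indI: "(\<integral>y. indicator {a..z} y * u y \<partial>M) = integral {a..z} u"
    if "integrable M u" "z \<in> {a..b}" for u :: "real \<Rightarrow> real" and z
  proof -
    have "(\<integral>y. indicator {a..z} y * u y \<partial>M) = integral {a..b} (\<lambda>y. indicator {a..z} y * u y)"
      unfolding M_def by (rule lebesgue_integral_eq_integral[OF ind[OF that, unfolded M_def]]) simp
    also have "\<dots> = integral {a..b} (\<lambda>y. if y \<in> {a..z} then u y else 0)"
      by (rule Henstock_Kurzweil_Integration.integral_cong) (simp add: indicator_def)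
    also have "\<dots> = integral ({a..z} \<inter> {a..b}) u" by (rule integral_restrict_Int)
    also have "{a..z} \<inter> {a..b} = {a..z}" using that(2) by auto
    finally show ?thesis .
  qed
  have vlI: "vl integrable_on {a..b}" using vl unfolding M_def by (rule integrable_on_lebesgue_on) simp
  have grid: "integral {a..x n k} vl = f (x n k) - f a" if "k \<le> 2 ^ n" for n k
  proof -
    have xk: "x n k \<in> {a..b}" using xle[of 0 k n] xle[of k "2^n" n] that by (auto simp: x0 xend)
    have A: "{a..x n k} \<in> sets M" using xk by (rule Icc_sets)
    have "eventually (\<lambda>j. (\<integral>y. indicator {a..x n k} y * v (r j) y \<partial>M) = f (x n k) - f a) sequentially"
    proof (rule eventually_sequentiallyI[of n])
      fix j assume "n \<le> j"
      then have "n \<le> r j" using seq_suble[OF r, of j] by linarith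
      then have "(v (r j) has_integral (\<Sum>i<k. D n i)) {a..x n k}"
        by (intro cellsj tower')
      then have "integral {a..x n k} (v (r j)) = (\<Sum>i<k. D n i)" by (rule integral_unique)
      moreover have "(\<Sum>i<k. D n i) = f (x n k) - f a"
        unfolding D_def using sum_lessThan_telescope[of "\<lambda>i. f (x n i)" k] by (simp add: x0)
      ultimately show "(\<integral>y. indicator {a..x n k} y * v (r j) y \<partial>M) = f (x n k) - f a"
        using indI[OF vi xk, of "r j"] by linarith
    qed
    then have "(\<lambda>j. \<integral>y. indicator {a..x n k} y * v (r j) y \<partial>M) \<longlonglongrightarrow> f (x n k) - f a"
      by (rule tendsto_eventually)
    from LIMSEQ_unique[OF lim[OF A] this] show ?thesis using indI[OF vl xk] by simp
  qed
  have all: "integral {a..y} vl = f y - f a" if y: "y \<in> {a..b}" for y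
  proof -
    define k where "k n = nat \<lfloor>(y - a) / \<delta> n\<rfloor>" for n
    have kb: "k n \<le> 2 ^ n" for n
    proof -
      have "(y - a) / \<delta> n \<le> 2 ^ n" using y \<open>a < b\<close> by (simp add: \<delta>_def field_simps)
      then show ?thesis by (simp add: k_def nat_le_iff floor_le_iff)
    qed
    have xin: "x n (k n) \<in> {a..b}" for n using xle[of 0 "k n" n] xle[of "k n" "2^n" n] kb by (auto simp: x0 xend)
    have near: "\<bar>x n (k n) - y\<bar> \<le> \<delta> n" for n
    proof -
      have "0 \<le> (y - a) / \<delta> n" using y \<delta>pos[of n] by simp
      then have "\<bar>real (k n) - (y - a) / \<delta> n\<bar> \<le> 1" unfolding k_def by linarith
      then have "\<bar>real (k n) - (y - a) / \<delta> n\<bar> * \<delta> n \<le> 1 * \<delta> n" using \<delta>pos[of n] by (intro mult_right_mono) auto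
      moreover have "\<bar>real (k n) - (y - a) / \<delta> n\<bar> * \<delta> n = \<bar>x n (k n) - y\<bar>"
      proof -
        have "\<bar>real (k n) - (y - a) / \<delta> n\<bar> * \<delta> n = \<bar>(real (k n) - (y - a) / \<delta> n) * \<delta> n\<bar>"
          using \<delta>pos[of n] by (simp add: abs_mult)
        also have "(real (k n) - (y - a) / \<delta> n) * \<delta> n = x n (k n) - y"
          using \<delta>pos[of n] by (simp add: x_def field_simps)
        finally show ?thesis .
      qed
      ultimately show ?thesis by simp
    qed
    have "(\<lambda>n. (b - a) * (1/2) ^ n) \<longlonglongrightarrow> (b - a) * 0" by (intro tendsto_intros LIMSEQ_realpow_zero) auto
    moreover have "\<delta> = (\<lambda>n. (b - a) * (1/2) ^ n)" by (simp add: fun_eq_iff \<delta>_def power_divide)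
    ultimately have \<delta>0: "\<delta> \<longlonglongrightarrow> 0" by simp
    have conv: "(\<lambda>n. x n (k n)) \<longlonglongrightarrow> y"
      by (rule LIM_zero_cancel, rule Lim_null_comparison[OF _ \<delta>0]) (simp add: near)
    have cf: "continuous_on {a..b} f" by (rule abs_continuous_on_Icc_imp_continuous_on[OF AC])
    have ci: "continuous_on {a..b} (\<lambda>z. integral {a..z} vl)" by (rule indefinite_integral_continuous_1[OF vlI])
    have 1: "(\<lambda>n. f (x n (k n)) - f a) \<longlonglongrightarrow> f y - f a"
      by (intro tendsto_intros continuous_on_tendsto_compose[OF cf conv y] always_eventually allI xin)
    have 2: "(\<lambda>n. integral {a..x n (k n)} vl) \<longlonglongrightarrow> integral {a..y} vl"
      by (intro continuous_on_tendsto_compose[OF ci conv y] always_eventually allI xin)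
    show ?thesis using LIMSEQ_unique[OF 2] 1 grid[OF kb] by simp
  qed
  show thesis
  proof (rule that[of vl])
    show "vl absolutely_integrable_on {a..b}"
      using vl unfolding M_def by (simp add: integrable_restrict_space set_integrable_def)
    fix y assume y: "y \<in> {a..b}"
    have "vl integrable_on {a..y}" using integrable_on_subinterval[OF vlI, of a y] y by auto
    from integrable_integral[OF this] show "(vl has_integral (f y - f a)) {a..y}" by (simp add: all[OF y])
  qed
qed

section \<open>Calculus of absolutely continuous functions\<close>

text \<open>
  The fundamental theorem of calculus for absolutely continuous functions: the density found above
  is the derivative almost everywhere, so \<open>deriv\<close>, with its unspecified values on a null set,
  serves as density.
\<close>

lemma abs_continuous_on_Icc_deriv:
  assumes AC: "abs_continuous_on_Icc a b f"
  shows "negligible {x \<in> {a<..<b}. \<not> (f has_real_derivative deriv f x) (at x)}"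
    and "deriv f absolutely_integrable_on {a..b}"
    and "\<And>s t. a \<le> s \<Longrightarrow> s \<le> t \<Longrightarrow> t \<le> b \<Longrightarrow> (deriv f has_integral (f t - f s)) {s..t}"
proof -
  have *: "negligible {x \<in> {a<..<b}. \<not> (f has_real_derivative deriv f x) (at x)}
    \<and> deriv f absolutely_integrable_on {a..b} \<and> (\<forall>x\<in>{a..b}. (deriv f has_integral (f x - f a)) {a..x})"
  proof (cases "a \<le> b")
    case True
    obtain v where v: "v absolutely_integrable_on {a..b}"
      and fv: "\<And>x. x \<in> {a..b} \<Longrightarrow> (v has_integral (f x - f a)) {a..x}"
      by (rule abs_continuous_on_Icc_imp_indefinite_integral[OF AC True]) blast
    define F where "F = (\<lambda>t. integral {a..t} v)"
    define N where "N = {x \<in> {a<..<b}. \<not> (F has_real_derivative v x) (at x)}"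
    have "v integrable_on {a..b}" using v by (rule absolutely_integrable_on_def[THEN iffD1, THEN conjunct1])
    then have N: "negligible N" unfolding N_def F_def by (rule indefinite_integral_has_real_derivative_ae)
    have d: "(f has_real_derivative v x) (at x)" if "x \<in> {a<..<b} - N" for x
    proof -
      have "(F has_real_derivative v x) (at x)" using that by (simp add: N_def)
      then have "((\<lambda>y. f a + F y) has_real_derivative v x) (at x)"
        using DERIV_add[OF DERIV_const[of "f a"]] by fastforce
      moreover have "f a + F y = f y" if "y \<in> {a<..<b}" for y
        using integral_unique[OF fv[of y]] that by (simp add: F_def)
      ultimately show ?thesis
        using DERIV_cong_ev[OF refl _ refl, of "\<lambda>y. f a + F y" f x "v x"] that
          eventually_nhds_in_open[of "{a<..<b}" x]
        by (metis (mono_tags, lifting) DiffD1 eventually_mono open_greaterThanLessThan)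
    qed
    then have dv: "deriv f x = v x" if "x \<in> {a<..<b} - N" for x using that DERIV_imp_deriv by blast
    have neg1: "negligible {x \<in> {a<..<b}. \<not> (f has_real_derivative deriv f x) (at x)}"
      by (rule negligible_subset[OF N]) (use d dv in force)
    have N': "negligible (N \<union> {a,b})" using N by auto
    have "deriv f absolutely_integrable_on {a..b}"
      by (rule absolutely_integrable_spike[OF v N']) (use dv in force)
    moreover have "(deriv f has_integral (f x - f a)) {a..x}" if "x \<in> {a..b}" for x
      by (rule has_integral_spike[OF N' _ fv[OF that]]) (use dv that in force)
    ultimately show ?thesis using neg1 by blast
  qed auto
  then show "negligible {x \<in> {a<..<b}. \<not> (f has_real_derivative deriv f x) (at x)}"
    and "deriv f absolutely_integrable_on {a..b}" by auto
  fix s t assume st: "a \<le> s" "s \<le> t" "t \<le> b"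
  have s: "(deriv f has_integral (f s - f a)) {a..s}" and t: "(deriv f has_integral (f t - f a)) {a..t}"
    using * st by auto
  have int: "deriv f integrable_on {a..t}" using t by blast
  then have "integral {a..s} (deriv f) + integral {s..t} (deriv f) = integral {a..t} (deriv f)"
    using st by (intro Henstock_Kurzweil_Integration.integral_combine) auto
  then have "integral {s..t} (deriv f) = f t - f s"
    using integral_unique[OF s] integral_unique[OF t] by simp
  moreover have "deriv f integrable_on {s..t}" using int st by (intro integrable_on_subinterval[OF int]) auto
  ultimately show "(deriv f has_integral (f t - f s)) {s..t}" using integrable_integral by metis
qed

text \<open>
  Absolute continuity of the integral: the part of \<open>f\<close> above a high level has small integral, and
  the part below contributes at most the level times the measure.
\<close>

lemma nn_integral_absolutely_continuous:
  fixes f :: "'a \<Rightarrow> real"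
  assumes f: "integrable M f" and "0 < \<epsilon>"
  obtains \<delta> where "0 < \<delta>"
    "\<And>A. A \<in> sets M \<Longrightarrow> emeasure M A < ennreal \<delta> \<Longrightarrow> (\<integral>\<^sup>+x. ennreal \<bar>f x\<bar> * indicator A x \<partial>M) < ennreal \<epsilon>"
proof -
  have "(\<lambda>n. \<integral>x. max 0 (\<bar>f x\<bar> - real n) \<partial>M) \<longlonglongrightarrow> (\<integral>x. 0 \<partial>M)"
  proof (rule integral_dominated_convergence[where w = "\<lambda>x. \<bar>f x\<bar>"])
    show "AE x in M. (\<lambda>n. max 0 (\<bar>f x\<bar> - real n)) \<longlonglongrightarrow> 0"
    proof (rule AE_I2)
      fix x
      obtain N where "\<bar>f x\<bar> < real N" using reals_Archimedean2 by blast
      then have "eventually (\<lambda>n. max 0 (\<bar>f x\<bar> - real n) = 0) sequentially"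
        by (intro eventually_sequentiallyI[of N]) auto
      then show "(\<lambda>n. max 0 (\<bar>f x\<bar> - real n)) \<longlonglongrightarrow> 0" by (rule tendsto_eventually)
    qed
  qed (use f in auto)
  then have "eventually (\<lambda>n. (\<integral>x. max 0 (\<bar>f x\<bar> - real n) \<partial>M) < \<epsilon> / 2) sequentially"
    using \<open>0 < \<epsilon>\<close> by (intro order_tendstoD) auto
  then obtain n where n: "(\<integral>x. max 0 (\<bar>f x\<bar> - real n) \<partial>M) < \<epsilon> / 2"
    using eventually_happens by force
  have mi: "integrable M (\<lambda>x. max 0 (\<bar>f x\<bar> - real n))"
    by (rule Bochner_Integration.integrable_bound[OF f]) (use f in auto)
  show thesis
  proof (rule that[of "\<epsilon> / (2 * (real n + 1))"])
    show "0 < \<epsilon> / (2 * (real n + 1))" using \<open>0 < \<epsilon>\<close> by simp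
    fix A assume A: "A \<in> sets M" "emeasure M A < ennreal (\<epsilon> / (2 * (real n + 1)))"
    have "(\<integral>\<^sup>+x. ennreal \<bar>f x\<bar> * indicator A x \<partial>M)
       \<le> (\<integral>\<^sup>+x. ennreal (max 0 (\<bar>f x\<bar> - real n)) + ennreal (real n) * indicator A x \<partial>M)"
    proof (rule nn_integral_mono)
      fix x
      have "ennreal \<bar>f x\<bar> \<le> ennreal (max 0 (\<bar>f x\<bar> - real n)) + ennreal (real n)"
        by (simp add: ennreal_plus[symmetric] del: ennreal_plus)
      then show "ennreal \<bar>f x\<bar> * indicator A x \<le> ennreal (max 0 (\<bar>f x\<bar> - real n)) + ennreal (real n) * indicator A x"
        by (auto simp: indicator_def)
    qed
    also have "\<dots> = ennreal (\<integral>x. max 0 (\<bar>f x\<bar> - real n) \<partial>M) + ennreal (real n) * emeasure M A"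
      using A mi by (subst nn_integral_add) (auto simp: nn_integral_eq_integral nn_integral_cmult_indicator)
    also have "\<dots> \<le> ennreal (\<integral>x. max 0 (\<bar>f x\<bar> - real n) \<partial>M) + ennreal (real n) * ennreal (\<epsilon> / (2 * (real n + 1)))"
      using A by (intro add_left_mono mult_left_mono) auto
    also have "\<dots> = ennreal ((\<integral>x. max 0 (\<bar>f x\<bar> - real n) \<partial>M) + real n * (\<epsilon> / (2 * (real n + 1))))"
      using \<open>0 < \<epsilon>\<close> by (simp add: ennreal_mult[symmetric] ennreal_plus[symmetric] integral_nonneg_AE del: ennreal_plus)
    also have "\<dots> < ennreal \<epsilon>"
    proof (rule ennreal_lessI[OF \<open>0 < \<epsilon>\<close>])
      have "real n * (\<epsilon> / (2 * (real n + 1))) \<le> \<epsilon> / 2" using \<open>0 < \<epsilon>\<close> by (simp add: field_simps)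
      then show "(\<integral>x. max 0 (\<bar>f x\<bar> - real n) \<partial>M) + real n * (\<epsilon> / (2 * (real n + 1))) < \<epsilon>" using n by linarith
    qed
    finally show "(\<integral>\<^sup>+x. ennreal \<bar>f x\<bar> * indicator A x \<partial>M) < ennreal \<epsilon>" .
  qed
qed

text \<open>
  Stated on families of intervals, this serves twice: for indefinite integrals, and for
  functions whose increments are controlled by the weight.
\<close>

lemma sum_integral_disjoint_intervals_small:
  fixes u :: "real \<Rightarrow> real"
  assumes u: "u absolutely_integrable_on {a..b}" and "0 < \<epsilon>"
  shows "\<exists>\<delta>>0. \<forall>(n::nat) s t. (\<forall>i<n. a \<le> s i \<and> s i \<le> t i \<and> t i \<le> b) \<and>
        (\<forall>i<n. \<forall>j<n. i \<noteq> j \<longrightarrow> {s i<..<t i} \<inter> {s j<..<t j} = {}) \<and>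
        (\<Sum>i<n. t i - s i) < \<delta> \<longrightarrow> (\<Sum>i<n. integral {s i..t i} (\<lambda>x. \<bar>u x\<bar>)) < \<epsilon>"
proof -
  have int: "integrable (lebesgue_on {a..b}) u"
    using u by (simp add: integrable_restrict_space set_integrable_def)
  obtain \<delta> where "0 < \<delta>" and \<delta>: "\<And>A. A \<in> sets (lebesgue_on {a..b}) \<Longrightarrow> emeasure (lebesgue_on {a..b}) A < ennreal \<delta>
      \<Longrightarrow> (\<integral>\<^sup>+x. ennreal \<bar>u x\<bar> * indicator A x \<partial>lebesgue_on {a..b}) < ennreal \<epsilon>"
    by (rule nn_integral_absolutely_continuous[OF int \<open>0 < \<epsilon>\<close>]) blast
  have ui: "(\<lambda>x. \<bar>u x\<bar>) integrable_on {a..b}"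
    using set_integrable_abs[OF u] by (rule absolutely_integrable_on_def[THEN iffD1, THEN conjunct1])
  show ?thesis
  proof (intro exI[of _ \<delta>] conjI allI impI \<open>0 < \<delta>\<close>, elim conjE)
    fix n :: nat and s t
    assume st: "\<forall>i<n. a \<le> s i \<and> s i \<le> t i \<and> t i \<le> b"
      and dj: "\<forall>i<n. \<forall>j<n. i \<noteq> j \<longrightarrow> {s i<..<t i} \<inter> {s j<..<t j} = {}"
      and len: "(\<Sum>i<n. t i - s i) < \<delta>"
    define A where "A = (\<Union>i<n. {s i<..<t i})"
    have sub: "{s i<..<t i} \<subseteq> {a..b}" if "i < n" for i using st that by force
    then have Asub: "A \<subseteq> {a..b}" by (auto simp: A_def)
    have Am: "A \<in> sets lebesgue" by (auto simp: A_def)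
    have AM: "A \<in> sets (lebesgue_on {a..b})" using Asub Am by (simp add: sets_restrict_space_iff)
    have df: "disjoint_family_on (\<lambda>i. {s i<..<t i}) {..<n}" using dj by (auto simp: disjoint_family_on_def)
    have "emeasure (lebesgue_on {a..b}) A = emeasure lebesgue A"
      using Asub by (simp add: emeasure_restrict_space)
    also have "\<dots> = (\<Sum>i<n. emeasure lebesgue {s i<..<t i})"
      unfolding A_def using df by (intro sum_emeasure[symmetric]) auto
    also have "\<dots> = (\<Sum>i<n. ennreal (t i - s i))" using st by (intro sum.cong) auto
    also have "\<dots> = ennreal (\<Sum>i<n. t i - s i)" using st by (intro sum_ennreal) auto
    also have "\<dots> < ennreal \<delta>" using len \<open>0 < \<delta>\<close> by (rule ennreal_lessI[rotated])
    finally have small: "(\<integral>\<^sup>+x. ennreal \<bar>u x\<bar> * indicator A x \<partial>lebesgue_on {a..b}) < ennreal \<epsilon>"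
      by (rule \<delta>[OF AM])
    have nonneg: "0 \<le> integral {s i..t i} (\<lambda>x. \<bar>u x\<bar>)" if "i < n" for i
      by (rule Henstock_Kurzweil_Integration.integral_nonneg, rule integrable_on_subinterval[OF ui])
         (use st that in auto)
    have "ennreal (\<Sum>i<n. integral {s i..t i} (\<lambda>x. \<bar>u x\<bar>)) = (\<Sum>i<n. ennreal (integral {s i..t i} (\<lambda>x. \<bar>u x\<bar>)))"
      by (intro sum_ennreal[symmetric] nonneg) simp
    also have "\<dots> = (\<Sum>i<n. \<integral>\<^sup>+x. ennreal \<bar>u x\<bar> * indicator {s i<..<t i} x \<partial>lebesgue_on {a..b})"
    proof (rule sum.cong[OF refl])
      fix i assume "i \<in> {..<n}"
      then have i: "i < n" by simp
      have ui': "(\<lambda>x. \<bar>u x\<bar>) absolutely_integrable_on {s i<..<t i}"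
        by (rule set_integrable_subset[OF set_integrable_abs[OF u]]) (use sub[OF i] in auto)
      have "integral {s i..t i} (\<lambda>x. \<bar>u x\<bar>) = integral {s i<..<t i} (\<lambda>x. \<bar>u x\<bar>)"
        using integral_open_interval_real by metis
      also have "\<dots> = (\<integral>x. indicator {s i<..<t i} x *\<^sub>R \<bar>u x\<bar> \<partial>lebesgue)"
        using set_lebesgue_integral_eq_integral(2)[OF ui'] by (simp add: set_lebesgue_integral_def)
      finally have "ennreal (integral {s i..t i} (\<lambda>x. \<bar>u x\<bar>)) = (\<integral>\<^sup>+x. ennreal (indicator {s i<..<t i} x * \<bar>u x\<bar>) \<partial>lebesgue)"
        using ui' by (simp add: nn_integral_eq_integral set_integrable_def)
      also have "\<dots> = (\<integral>\<^sup>+x. ennreal \<bar>u x\<bar> * indicator {s i<..<t i} x * indicator {a..b} x \<partial>lebesgue)"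
        using sub[OF i] by (intro nn_integral_cong) (auto simp: indicator_def)
      finally show "ennreal (integral {s i..t i} (\<lambda>x. \<bar>u x\<bar>)) = (\<integral>\<^sup>+x. ennreal \<bar>u x\<bar> * indicator {s i<..<t i} x \<partial>lebesgue_on {a..b})"
        by (simp add: nn_integral_restrict_space)
    qed
    also have "\<dots> = (\<integral>\<^sup>+x. (\<Sum>i<n. ennreal \<bar>u x\<bar> * indicator {s i<..<t i} x) \<partial>lebesgue_on {a..b})"
      using int sub by (intro nn_integral_sum[symmetric]) (auto intro!: borel_measurable_times_ennreal borel_measurable_indicator simp: sets_restrict_space_iff)
    also have "\<dots> = (\<integral>\<^sup>+x. ennreal \<bar>u x\<bar> * indicator A x \<partial>lebesgue_on {a..b})"
    proof (rule nn_integral_cong)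
      fix x
      have "(\<Sum>i<n. indicator {s i<..<t i} x) = (indicator A x :: ennreal)"
        unfolding A_def by (rule indicator_UN_disjoint[OF finite_lessThan df, symmetric])
      then show "(\<Sum>i<n. ennreal \<bar>u x\<bar> * indicator {s i<..<t i} x) = ennreal \<bar>u x\<bar> * indicator A x"
        by (simp add: sum_distrib_left[symmetric])
    qed
    also have "\<dots> < ennreal \<epsilon>" by (rule small)
    finally show "(\<Sum>i<n. integral {s i..t i} (\<lambda>x. \<bar>u x\<bar>)) < \<epsilon>"
      by (meson ennreal_leI not_le)
  qed
qed

lemma abs_continuous_on_Icc_indefinite_integral:
  fixes u :: "real \<Rightarrow> real"
  assumes u: "u absolutely_integrable_on {a..b}"
    and f: "\<And>s t. a \<le> s \<Longrightarrow> s \<le> t \<Longrightarrow> t \<le> b \<Longrightarrow> f t - f s = integral {s..t} u"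
  shows "abs_continuous_on_Icc a b f"
  unfolding abs_continuous_on_Icc_def
proof (intro allI impI)
  fix \<epsilon> :: real assume "0 < \<epsilon>"
  obtain \<delta> where "0 < \<delta>" and \<delta>: "\<forall>(n::nat) s t. (\<forall>i<n. a \<le> s i \<and> s i \<le> t i \<and> t i \<le> b) \<and>
        (\<forall>i<n. \<forall>j<n. i \<noteq> j \<longrightarrow> {s i<..<t i} \<inter> {s j<..<t j} = {}) \<and>
        (\<Sum>i<n. t i - s i) < \<delta> \<longrightarrow> (\<Sum>i<n. integral {s i..t i} (\<lambda>x. \<bar>u x\<bar>)) < \<epsilon>"
    using sum_integral_disjoint_intervals_small[OF u \<open>0 < \<epsilon>\<close>] by (elim exE conjE)
  show "\<exists>\<delta>>0. \<forall>(n::nat) s t. (\<forall>i<n. a \<le> s i \<and> s i \<le> t i \<and> t i \<le> b) \<and>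
        (\<forall>i<n. \<forall>j<n. i \<noteq> j \<longrightarrow> {s i<..<t i} \<inter> {s j<..<t j} = {}) \<and>
        (\<Sum>i<n. t i - s i) < \<delta> \<longrightarrow> (\<Sum>i<n. \<bar>f (t i) - f (s i)\<bar>) < \<epsilon>"
  proof (intro exI[of _ \<delta>] conjI allI impI \<open>0 < \<delta>\<close>)
    fix n :: nat and s t
    assume st: "(\<forall>i<n. a \<le> s i \<and> s i \<le> t i \<and> t i \<le> b) \<and>
        (\<forall>i<n. \<forall>j<n. i \<noteq> j \<longrightarrow> {s i<..<t i} \<inter> {s j<..<t j} = {}) \<and> (\<Sum>i<n. t i - s i) < \<delta>"
    have "(\<Sum>i<n. \<bar>f (t i) - f (s i)\<bar>) \<le> (\<Sum>i<n. integral {s i..t i} (\<lambda>x. \<bar>u x\<bar>))"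
    proof (rule sum_mono)
      fix i assume "i \<in> {..<n}"
      then have i: "a \<le> s i" "s i \<le> t i" "t i \<le> b" using st by auto
      have ui: "u absolutely_integrable_on {s i..t i}"
        by (rule set_integrable_subset[OF u]) (use i in auto)
      have "norm (integral {s i..t i} u) \<le> integral {s i..t i} (\<lambda>x. \<bar>u x\<bar>)"
        using ui set_integrable_abs[OF ui]
        by (intro integral_norm_bound_integral) (auto simp: absolutely_integrable_on_def)
      then show "\<bar>f (t i) - f (s i)\<bar> \<le> integral {s i..t i} (\<lambda>x. \<bar>u x\<bar>)" using f[OF i] by simp
    qed
    also have "\<dots> < \<epsilon>" using \<delta> st by blast
    finally show "(\<Sum>i<n. \<bar>f (t i) - f (s i)\<bar>) < \<epsilon>" .
  qed
qed

lemma abs_continuous_on_Icc_mult: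
  assumes f: "abs_continuous_on_Icc a b f" and g: "abs_continuous_on_Icc a b g"
  shows "abs_continuous_on_Icc a b (\<lambda>x. f x * g x)"
proof -
  obtain B where B: "B > 0" "\<And>x. x \<in> {a..b} \<Longrightarrow> \<bar>f x\<bar> \<le> B" "\<And>x. x \<in> {a..b} \<Longrightarrow> \<bar>g x\<bar> \<le> B"
  proof -
    have "bounded (f ` {a..b})" "bounded (g ` {a..b})"
      using abs_continuous_on_Icc_imp_continuous_on[OF f] abs_continuous_on_Icc_imp_continuous_on[OF g]
      by (auto intro!: compact_imp_bounded compact_continuous_image)
    then obtain B1 B2 where "\<forall>x\<in>{a..b}. \<bar>f x\<bar> \<le> B1" "\<forall>x\<in>{a..b}. \<bar>g x\<bar> \<le> B2"
      by (auto simp: bounded_iff)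
    then show thesis by (intro that[of "max 1 (max B1 B2)"]) (auto simp: le_max_iff_disj)
  qed
  show ?thesis
    unfolding abs_continuous_on_Icc_def
  proof (intro allI impI)
    fix \<epsilon> :: real assume "0 < \<epsilon>"
    then have e: "0 < \<epsilon> / (2 * B)" using B by simp
    obtain \<delta>1 where "0 < \<delta>1" and \<delta>1: "\<forall>(n::nat) s t. (\<forall>i<n. a \<le> s i \<and> s i \<le> t i \<and> t i \<le> b) \<and>
        (\<forall>i<n. \<forall>j<n. i \<noteq> j \<longrightarrow> {s i<..<t i} \<inter> {s j<..<t j} = {}) \<and>
        (\<Sum>i<n. t i - s i) < \<delta>1 \<longrightarrow> (\<Sum>i<n. \<bar>f (t i) - f (s i)\<bar>) < \<epsilon> / (2 * B)"
      using f[unfolded abs_continuous_on_Icc_def, rule_format, OF e] by (elim exE conjE)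
    obtain \<delta>2 where "0 < \<delta>2" and \<delta>2: "\<forall>(n::nat) s t. (\<forall>i<n. a \<le> s i \<and> s i \<le> t i \<and> t i \<le> b) \<and>
        (\<forall>i<n. \<forall>j<n. i \<noteq> j \<longrightarrow> {s i<..<t i} \<inter> {s j<..<t j} = {}) \<and>
        (\<Sum>i<n. t i - s i) < \<delta>2 \<longrightarrow> (\<Sum>i<n. \<bar>g (t i) - g (s i)\<bar>) < \<epsilon> / (2 * B)"
      using g[unfolded abs_continuous_on_Icc_def, rule_format, OF e] by (elim exE conjE)
    show "\<exists>\<delta>>0. \<forall>(n::nat) s t. (\<forall>i<n. a \<le> s i \<and> s i \<le> t i \<and> t i \<le> b) \<and>
        (\<forall>i<n. \<forall>j<n. i \<noteq> j \<longrightarrow> {s i<..<t i} \<inter> {s j<..<t j} = {}) \<and>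
        (\<Sum>i<n. t i - s i) < \<delta> \<longrightarrow> (\<Sum>i<n. \<bar>f (t i) * g (t i) - f (s i) * g (s i)\<bar>) < \<epsilon>"
    proof (intro exI[of _ "min \<delta>1 \<delta>2"] conjI allI impI)
      show "0 < min \<delta>1 \<delta>2" using \<open>0 < \<delta>1\<close> \<open>0 < \<delta>2\<close> by simp
      fix n :: nat and s t
      assume st: "(\<forall>i<n. a \<le> s i \<and> s i \<le> t i \<and> t i \<le> b) \<and>
        (\<forall>i<n. \<forall>j<n. i \<noteq> j \<longrightarrow> {s i<..<t i} \<inter> {s j<..<t j} = {}) \<and> (\<Sum>i<n. t i - s i) < min \<delta>1 \<delta>2"
      have 1: "(\<Sum>i<n. \<bar>f (t i) - f (s i)\<bar>) < \<epsilon> / (2 * B)" by (rule \<delta>1[rule_format]) (use st in auto)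
      have 2: "(\<Sum>i<n. \<bar>g (t i) - g (s i)\<bar>) < \<epsilon> / (2 * B)" by (rule \<delta>2[rule_format]) (use st in auto)
      have "(\<Sum>i<n. \<bar>f (t i) * g (t i) - f (s i) * g (s i)\<bar>)
          \<le> (\<Sum>i<n. B * \<bar>f (t i) - f (s i)\<bar> + B * \<bar>g (t i) - g (s i)\<bar>)"
      proof (rule sum_mono)
        fix i assume "i \<in> {..<n}"
        then have i: "s i \<in> {a..b}" "t i \<in> {a..b}" using st by force+
        have "f (t i) * g (t i) - f (s i) * g (s i) = g (t i) * (f (t i) - f (s i)) + f (s i) * (g (t i) - g (s i))"
          by (simp add: algebra_simps)
        then have "\<bar>f (t i) * g (t i) - f (s i) * g (s i)\<bar> \<le> \<bar>g (t i)\<bar> * \<bar>f (t i) - f (s i)\<bar> + \<bar>f (s i)\<bar> * \<bar>g (t i) - g (s i)\<bar>"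
          by (metis abs_mult abs_triangle_ineq)
        also have "\<dots> \<le> B * \<bar>f (t i) - f (s i)\<bar> + B * \<bar>g (t i) - g (s i)\<bar>"
          using B i by (intro add_mono mult_right_mono) auto
        finally show "\<bar>f (t i) * g (t i) - f (s i) * g (s i)\<bar> \<le> B * \<bar>f (t i) - f (s i)\<bar> + B * \<bar>g (t i) - g (s i)\<bar>" .
      qed
      also have "\<dots> = B * (\<Sum>i<n. \<bar>f (t i) - f (s i)\<bar>) + B * (\<Sum>i<n. \<bar>g (t i) - g (s i)\<bar>)"
        by (simp add: sum.distrib sum_distrib_left)
      also have "\<dots> < B * (\<epsilon> / (2 * B)) + B * (\<epsilon> / (2 * B))"
        using 1 2 B(1) by (intro add_strict_mono mult_strict_left_mono)
      also have "\<dots> = \<epsilon>" using B(1) by simp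
      finally show "(\<Sum>i<n. \<bar>f (t i) * g (t i) - f (s i) * g (s i)\<bar>) < \<epsilon>" .
    qed
  qed
qed

section \<open>Hoelder's inequality and local absolute continuity\<close>

lemma ennpowr_ennreal: "0 \<le> x \<Longrightarrow> ennpowr (ennreal x) p = ennreal (x powr p)"
  by (simp add: ennpowr_def)

lemma ennpowr_pos: "0 < x \<Longrightarrow> 0 < ennpowr x p"
  by (cases x) (simp_all add: ennpowr_def infinity_ennreal_def)

lemma nn_integral_Hoelder:
  fixes f g :: "'a \<Rightarrow> real"
  assumes "1 < p" and q: "q = p / (p - 1)"
    and [measurable]: "f \<in> borel_measurable M" "g \<in> borel_measurable M"
    and f0: "\<And>x. 0 \<le> f x" and g0: "\<And>x. 0 \<le> g x"
  shows "(\<integral>\<^sup>+x. ennreal (f x * g x) \<partial>M) \<le> ennpowr (\<integral>\<^sup>+x. ennreal (f x powr p) \<partial>M) (1/p)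
       * ennpowr (\<integral>\<^sup>+x. ennreal (g x powr q) \<partial>M) (1/q)"
proof -
  define A where "A = (\<integral>\<^sup>+x. ennreal (f x powr p) \<partial>M)"
  define B where "B = (\<integral>\<^sup>+x. ennreal (g x powr q) \<partial>M)"
  have "1 < q" "1/p + 1/q = 1" using \<open>1 < p\<close> by (auto simp: q field_simps)
  have zero: "(\<integral>\<^sup>+x. ennreal (f x * g x) \<partial>M) = 0" if "A = 0 \<or> B = 0"
  proof -
    have "AE x in M. f x * g x = 0"
      using that
    proof
      assume "A = 0"
      then have "AE x in M. ennreal (f x powr p) = 0"
        unfolding A_def by (subst (asm) nn_integral_0_iff_AE) auto
      then show ?thesis by eventually_elim auto
    next
      assume "B = 0"
      then have "AE x in M. ennreal (g x powr q) = 0"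
        unfolding B_def by (subst (asm) nn_integral_0_iff_AE) auto
      then show ?thesis by eventually_elim auto
    qed
    then show ?thesis by (subst nn_integral_0_iff_AE) auto
  qed
  show ?thesis
    unfolding A_def[symmetric] B_def[symmetric]
  proof (cases "A = 0 \<or> B = 0")
    case True
    then show "(\<integral>\<^sup>+x. ennreal (f x * g x) \<partial>M) \<le> ennpowr A (1/p) * ennpowr B (1/q)" using zero by simp
  next
    case False
    then have pos: "0 < A" "0 < B" by (auto simp: zero_less_iff_neq_zero)
    show "(\<integral>\<^sup>+x. ennreal (f x * g x) \<partial>M) \<le> ennpowr A (1/p) * ennpowr B (1/q)"
    proof (cases "A = \<infinity> \<or> B = \<infinity>")
      case True
      then have "ennpowr A (1/p) * ennpowr B (1/q) = \<infinity>"
        using ennpowr_pos[OF pos(1), of "1/p"] ennpowr_pos[OF pos(2), of "1/q"]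
        by (auto simp: ennpowr_def ennreal_mult_eq_top_iff ennreal_top_mult ennreal_mult_top split: if_splits)
      then show ?thesis by simp
    next
      case False
      then obtain a b where ab: "A = ennreal a" "B = ennreal b" "0 < a" "0 < b"
        using pos by (cases A; cases B) (auto simp: less_le)
      define k where "k = a powr (1/p) * b powr (1/q)"
      have "k > 0" using ab by (simp add: k_def)
      have pt: "f x * g x \<le> k / (p * a) * f x powr p + k / (q * b) * g x powr q" for x
      proof -
        have "(f x / a powr (1/p)) * (g x / b powr (1/q)) \<le> (f x / a powr (1/p)) powr p / p + (g x / b powr (1/q)) powr q / q"
          by (rule Youngs_inequality) (use \<open>1 < p\<close> \<open>1 < q\<close> \<open>1/p + 1/q = 1\<close> f0 g0 in auto)
        also have "\<dots> = f x powr p / (p * a) + g x powr q / (q * b)"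
          using ab f0 g0 \<open>1 < p\<close> \<open>1 < q\<close> by (simp add: powr_divide powr_powr mult.commute)
        finally have "k * ((f x / a powr (1/p)) * (g x / b powr (1/q))) \<le> k * (f x powr p / (p * a) + g x powr q / (q * b))"
          using \<open>k > 0\<close> by (intro mult_left_mono) auto
        then show ?thesis using ab by (simp add: k_def distrib_left)
      qed
      have "(\<integral>\<^sup>+x. ennreal (f x * g x) \<partial>M) \<le> (\<integral>\<^sup>+x. ennreal (k / (p * a)) * ennreal (f x powr p) + ennreal (k / (q * b)) * ennreal (g x powr q) \<partial>M)"
        using pt \<open>k > 0\<close> ab \<open>1 < p\<close> \<open>1 < q\<close>
        by (intro nn_integral_mono) (simp add: ennreal_mult[symmetric] ennreal_plus[symmetric] ennreal_leI del: ennreal_plus)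
      also have "\<dots> = ennreal (k / (p * a)) * A + ennreal (k / (q * b)) * B"
        unfolding A_def B_def by (subst nn_integral_add) (auto simp: nn_integral_cmult)
      also have "\<dots> = ennreal (k / (p * a) * a + k / (q * b) * b)"
        using \<open>k > 0\<close> ab \<open>1 < p\<close> \<open>1 < q\<close> by (simp add: ennreal_mult[symmetric] ennreal_plus[symmetric] del: ennreal_plus)
      also have "k / (p * a) * a + k / (q * b) * b = k * (1/p + 1/q)" using ab by (simp add: field_simps)
      also have "\<dots> = k" by (simp only: \<open>1/p + 1/q = 1\<close> mult_1_right)
      also have "ennreal k = ennpowr A (1/p) * ennpowr B (1/q)"
        using ab by (simp add: k_def ennpowr_ennreal ennreal_mult)
      finally show ?thesis .
    qed
  qed
qed

text \<open>
  A nonempty open set is not negligible. The lemma upgrades essential bounds to bounds and makes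
  continuous representatives unique.
\<close>

lemma continuous_on_AE_le_imp_le:
  fixes f :: "real \<Rightarrow> real"
  assumes "open S" "continuous_on S f" and ae: "AE x in lebesgue_on S. f x \<le> B" and "x \<in> S"
  shows "f x \<le> B"
proof (rule ccontr)
  assume "\<not> f x \<le> B"
  define U where "U = {y \<in> S. B < f y}"
  have "open U"
  proof -
    have "\<forall>T. open T \<longrightarrow> open (f -` T \<inter> S)"
      using continuous_on_open_vimage[OF assms(1), of f] assms(2) by blast
    then have "open (f -` {B<..} \<inter> S)" using open_greaterThan by blast
    moreover have "f -` {B<..} \<inter> S = U" by (auto simp: U_def)
    ultimately show ?thesis by simp
  qed
  moreover have "x \<in> U" using \<open>\<not> f x \<le> B\<close> \<open>x \<in> S\<close> by (simp add: U_def)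
  ultimately have "\<not> negligible U" using open_not_negligible by blast
  moreover have "negligible U"
  proof -
    have "S \<in> sets lebesgue" using \<open>open S\<close> by auto
    then have "AE y in lebesgue. y \<in> S \<longrightarrow> f y \<le> B" using ae by (simp add: AE_restrict_space_iff)
    then obtain N where "{y \<in> space lebesgue. \<not> (y \<in> S \<longrightarrow> f y \<le> B)} \<subseteq> N" "N \<in> null_sets lebesgue"
      unfolding eventually_ae_filter by blast
    then have "negligible N" "U \<subseteq> N" by (auto simp: negligible_iff_null_sets U_def)
    then show ?thesis by (rule negligible_subset)
  qed
  ultimately show False by blast
qed

lemma einterval_Icc_subset:
  "s \<in> einterval c d \<Longrightarrow> t \<in> einterval c d \<Longrightarrow> {s..t} \<subseteq> einterval c d"
  by (auto simp: einterval_def) (meson ereal_less_eq(3) less_le_trans le_less_trans)+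

lemma AE_lebesgue_on_einterval:
  assumes "c < d"
    and neg: "\<And>s t. s < t \<Longrightarrow> {s..t} \<subseteq> einterval c d \<Longrightarrow> negligible {x \<in> {s<..<t}. \<not> P x}"
  shows "AE x in lebesgue_on (einterval c d). P x"
proof -
  obtain u l :: "nat \<Rightarrow> real" where ul: "einterval c d = (\<Union>i. {l i .. u i})" "\<And>i. l i < u i"
    by (rule einterval_Icc_approximation[OF \<open>c < d\<close>]) blast
  have "negligible ({x \<in> {l i<..<u i}. \<not> P x} \<union> {l i, u i})" for i
    using neg[of "l i" "u i"] ul by auto
  then have N: "negligible (\<Union>i. {x \<in> {l i<..<u i}. \<not> P x} \<union> {l i, u i})"
    by (intro negligible_Union_nat)
  have "AE x in lebesgue. x \<in> einterval c d \<longrightarrow> P x"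
    by (rule AE_I'[of "\<Union>i. {x \<in> {l i<..<u i}. \<not> P x} \<union> {l i, u i}"])
       (use N in \<open>auto simp: negligible_iff_null_sets ul(1) less_le\<close>)
  then show ?thesis by (simp add: AE_restrict_space_iff)
qed

lemma borel_measurable_lebesgue_on_einterval:
  fixes f :: "real \<Rightarrow> real"
  assumes "c < d"
    and m: "\<And>s t. s < t \<Longrightarrow> {s..t} \<subseteq> einterval c d \<Longrightarrow> f \<in> borel_measurable (lebesgue_on {s..t})"
  shows "f \<in> borel_measurable (lebesgue_on (einterval c d))"
proof -
  obtain u l :: "nat \<Rightarrow> real" where ul: "einterval c d = (\<Union>i. {l i .. u i})" "\<And>i. l i < u i" "incseq u" "decseq l"
    by (rule einterval_Icc_approximation[OF \<open>c < d\<close>]) blast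
  have "(\<lambda>x. indicator {l i..u i} x * f x) \<in> borel_measurable lebesgue" for i
    using m[of "l i" "u i"] ul by (auto simp: borel_measurable_restrict_space_iff mult.commute)
  then have "(\<lambda>x. indicator {l i..u i} x * f x) \<in> borel_measurable (lebesgue_on (einterval c d))" for i
    by (rule measurable_restrict_space1)
  then show ?thesis
  proof (rule borel_measurable_LIMSEQ_real[rotated])
    fix x assume "x \<in> space (lebesgue_on (einterval c d))"
    then obtain i where i: "x \<in> {l i..u i}" using ul(1) by (auto simp: space_restrict_space)
    have "eventually (\<lambda>j. indicator {l j..u j} x * f x = f x) sequentially"
    proof (rule eventually_sequentiallyI[of i])
      fix j assume "i \<le> j"
      then have "u i \<le> u j" "l j \<le> l i" using ul by (auto simp: incseq_def decseq_def)
      then show "indicator {l j..u j} x * f x = f x" using i by auto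
    qed
    then show "(\<lambda>j. indicator {l j..u j} x * f x) \<longlonglongrightarrow> f x" by (rule tendsto_eventually)
  qed
qed

lemma AC_locD: "f \<in> AC_loc I \<Longrightarrow> a \<le> b \<Longrightarrow> {a..b} \<subseteq> I \<Longrightarrow> abs_continuous_on_Icc a b f"
  by (simp add: AC_loc_def)

lemma AC_loc_mult: "f \<in> AC_loc I \<Longrightarrow> g \<in> AC_loc I \<Longrightarrow> (\<lambda>x. f x * g x) \<in> AC_loc I"
  by (simp add: AC_loc_def abs_continuous_on_Icc_mult)

lemma AC_loc_einterval_continuous_on:
  assumes "f \<in> AC_loc (einterval c d)"
  shows "continuous_on (einterval c d) f"
proof (rule continuous_at_imp_continuous_on, rule ballI)
  fix x assume x: "x \<in> einterval c d"
  then obtain e where "0 < e" "cball x e \<subseteq> einterval c d"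
    using open_contains_cball open_einterval by metis
  then have "continuous_on {x - e..x + e} f" 
    by (intro abs_continuous_on_Icc_imp_continuous_on AC_locD[OF assms]) (auto simp: cball_eq_atLeastAtMost)
  then show "isCont f x" using \<open>0 < e\<close> by (intro continuous_on_interior) auto
qed

lemma AC_loc_deriv:
  assumes "c < d" "f \<in> AC_loc (einterval c d)"
  shows "AE x in lebesgue_on (einterval c d). (f has_real_derivative deriv f x) (at x)"
    and "deriv f \<in> borel_measurable (lebesgue_on (einterval c d))"
    and "s \<le> t \<Longrightarrow> {s..t} \<subseteq> einterval c d \<Longrightarrow> deriv f absolutely_integrable_on {s..t}"
    and "s \<le> t \<Longrightarrow> {s..t} \<subseteq> einterval c d \<Longrightarrow> integral {s..t} (deriv f) = f t - f s"
proof -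
  note ac = abs_continuous_on_Icc_deriv[OF AC_locD[OF assms(2)]]
  show "AE x in lebesgue_on (einterval c d). (f has_real_derivative deriv f x) (at x)"
    by (rule AE_lebesgue_on_einterval[OF assms(1)], rule ac(1)) auto
  show ai: "deriv f absolutely_integrable_on {s..t}" if "s \<le> t" "{s..t} \<subseteq> einterval c d" for s t
    by (rule ac(2)[OF that])
  then show "deriv f \<in> borel_measurable (lebesgue_on (einterval c d))"
    by (intro borel_measurable_lebesgue_on_einterval[OF assms(1)] absolutely_integrable_imp_borel_measurable) auto
  show "integral {s..t} (deriv f) = f t - f s" if "s \<le> t" "{s..t} \<subseteq> einterval c d"
    by (rule integral_unique, rule ac(3)[OF that]) (use that in auto)
qed

lemma indefinite_integral_AC_loc:
  fixes f :: "real \<Rightarrow> real"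
  assumes "c < d"
    and int: "\<And>s t. s \<le> t \<Longrightarrow> {s..t} \<subseteq> einterval c d \<Longrightarrow> f absolutely_integrable_on {s..t}"
    and F: "\<And>s t. s \<le> t \<Longrightarrow> {s..t} \<subseteq> einterval c d \<Longrightarrow> F t - F s = integral {s..t} f"
  shows "F \<in> AC_loc (einterval c d)"
    and "AE x in lebesgue_on (einterval c d). (F has_real_derivative f x) (at x)"
proof -
  show "F \<in> AC_loc (einterval c d)"
    unfolding AC_loc_def
  proof (safe)
    fix a b :: real assume ab: "a \<le> b" "{a..b} \<subseteq> einterval c d"
    show "abs_continuous_on_Icc a b F"
      by (rule abs_continuous_on_Icc_indefinite_integral[OF int[OF ab]], rule F) (use ab in auto)
  qed
  show "AE x in lebesgue_on (einterval c d). (F has_real_derivative f x) (at x)"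
  proof (rule AE_lebesgue_on_einterval[OF assms(1)])
    fix s t :: real assume st: "s < t" "{s..t} \<subseteq> einterval c d"
    have "f integrable_on {s..t}" using int[of s t] st by (auto simp: absolutely_integrable_on_def)
    then have N: "negligible {x \<in> {s<..<t}. \<not> ((\<lambda>y. integral {s..y} f) has_real_derivative f x) (at x)}"
      by (rule indefinite_integral_has_real_derivative_ae)
    have "(F has_real_derivative f x) (at x)"
      if x: "x \<in> {s<..<t}" and d: "((\<lambda>y. integral {s..y} f) has_real_derivative f x) (at x)" for x
    proof -
      have d': "((\<lambda>y. F s + integral {s..y} f) has_real_derivative 0 + f x) (at x)"
        by (rule DERIV_add[OF DERIV_const d])
      have eq: "F s + integral {s..y} f = F y" if "y \<in> {s<..<t}" for y
      proof -
        have "{s..y} \<subseteq> einterval c d" using st that by auto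
        then show ?thesis using F[of s y] that by simp
      qed
      have "(F has_real_derivative 0 + f x) (at x)"
        by (rule has_field_derivative_transform_within_open[OF d' open_greaterThanLessThan x eq])
      then show ?thesis by simp
    qed
    then show "negligible {x \<in> {s<..<t}. \<not> (F has_real_derivative f x) (at x)}"
      by (intro negligible_subset[OF N]) blast
  qed
qed

text \<open>
  The product \<open>F G\<close> is locally absolutely continuous, so the two integrals over compact intervals add
  up to its boundary values, which tend to \<open>0\<close> along every exhaustion.
\<close>

lemma AC_loc_integral_by_parts:
  assumes "c < d" and I: "I = einterval c d"
    and F: "F \<in> AC_loc I" and G: "G \<in> AC_loc I"
    and i1: "set_integrable lebesgue I (\<lambda>x. deriv F x * G x)"
    and i2: "set_integrable lebesgue I (\<lambda>x. F x * deriv G x)"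
    and lc: "\<And>l. (\<And>n. l n \<in> I) \<Longrightarrow> decseq l \<Longrightarrow> (\<lambda>n. ereal (l n)) \<longlonglongrightarrow> c \<Longrightarrow> (\<lambda>n. F (l n) * G (l n)) \<longlonglongrightarrow> 0"
    and ud: "\<And>u. (\<And>n. u n \<in> I) \<Longrightarrow> incseq u \<Longrightarrow> (\<lambda>n. ereal (u n)) \<longlonglongrightarrow> d \<Longrightarrow> (\<lambda>n. F (u n) * G (u n)) \<longlonglongrightarrow> 0"
  shows "(LINT x:I|lebesgue. deriv F x * G x) = - (LINT x:I|lebesgue. F x * deriv G x)"
proof -
  obtain u l :: "nat \<Rightarrow> real" where ul: "einterval c d = (\<Union>i. {l i .. u i})" "\<And>i. l i < u i" "incseq u" "decseq l"
      "(\<lambda>n. ereal (l n)) \<longlonglongrightarrow> c" "(\<lambda>n. ereal (u n)) \<longlonglongrightarrow> d"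
    by (rule einterval_Icc_approximation[OF \<open>c < d\<close>]) blast
  define \<phi> where "\<phi> x = deriv F x * G x + F x * deriv G x" for x
  have \<phi>i: "set_integrable lebesgue I \<phi>" unfolding \<phi>_def by (rule set_integral_add(1)[OF i1 i2])
  have sub: "{l n..u n} \<subseteq> I" for n using ul(1) I by auto
  have inc: "incseq (\<lambda>n. {l n..u n})" using ul(3,4) by (auto simp: incseq_def decseq_def intro: order_trans)
  have "(\<lambda>n. LINT x:{l n..u n}|lebesgue. \<phi> x) \<longlonglongrightarrow> (LINT x:(\<Union>n. {l n..u n})|lebesgue. \<phi> x)"
    by (rule set_integral_cont_up[OF _ inc]) (use \<phi>i ul(1) I in auto)
  then have lim1: "(\<lambda>n. LINT x:{l n..u n}|lebesgue. \<phi> x) \<longlonglongrightarrow> (LINT x:I|lebesgue. \<phi> x)" using ul(1) I by simp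
  have FG: "(\<lambda>x. F x * G x) \<in> AC_loc (einterval c d)" using F G I AC_loc_mult by blast
  have aeFG: "AE x in lebesgue_on I. deriv (\<lambda>x. F x * G x) x = \<phi> x"
  proof -
    have "AE x in lebesgue_on I. (F has_real_derivative deriv F x) (at x)" "AE x in lebesgue_on I. (G has_real_derivative deriv G x) (at x)"
      using AC_loc_deriv(1)[OF \<open>c < d\<close>] F G I by auto
    then show ?thesis
    proof eventually_elim
      fix x assume "(F has_real_derivative deriv F x) (at x)" "(G has_real_derivative deriv G x) (at x)"
      then have "((\<lambda>x. F x * G x) has_real_derivative deriv F x * G x + deriv G x * F x) (at x)" by (rule DERIV_mult)
      then show "deriv (\<lambda>x. F x * G x) x = \<phi> x" using DERIV_imp_deriv by (fastforce simp: \<phi>_def)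
    qed
  qed
  have ftc: "(LINT x:{l n..u n}|lebesgue. \<phi> x) = F (u n) * G (u n) - F (l n) * G (l n)" for n
  proof -
    have i: "l n \<le> u n" "{l n..u n} \<subseteq> einterval c d" using ul(2)[of n] sub[of n] I by auto
    have "AE x in lebesgue. x \<in> I \<longrightarrow> deriv (\<lambda>x. F x * G x) x = \<phi> x"
      using aeFG I by (simp add: AE_restrict_space_iff)
    then have ae: "AE x in lebesgue. indicator {l n..u n} x *\<^sub>R \<phi> x = indicator {l n..u n} x *\<^sub>R deriv (\<lambda>x. F x * G x) x"
      by eventually_elim (use sub[of n] in \<open>auto simp: indicator_def\<close>)
    have ai: "set_integrable lebesgue {l n..u n} (deriv (\<lambda>x. F x * G x))"
      by (rule AC_loc_deriv(3)[OF \<open>c < d\<close> FG i])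
    have ai2: "set_integrable lebesgue {l n..u n} \<phi>"
      by (rule set_integrable_subset[OF \<phi>i _ sub]) simp
    have "(LINT x:{l n..u n}|lebesgue. \<phi> x) = (LINT x:{l n..u n}|lebesgue. deriv (\<lambda>x. F x * G x) x)"
      unfolding set_lebesgue_integral_def using ai ai2
      by (intro integral_cong_AE ae) (auto simp: set_integrable_def)
    also have "\<dots> = integral {l n..u n} (deriv (\<lambda>x. F x * G x))"
      by (rule set_lebesgue_integral_eq_integral(2)[OF ai])
    also have "\<dots> = F (u n) * G (u n) - F (l n) * G (l n)"
      by (rule AC_loc_deriv(4)[OF \<open>c < d\<close> FG i])
    finally show ?thesis .
  qed
  have "(\<lambda>n. F (u n) * G (u n) - F (l n) * G (l n)) \<longlonglongrightarrow> 0 - 0"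
  proof (rule tendsto_diff)
    have I': "u n \<in> I" "l n \<in> I" for n using sub[of n] ul(2)[of n] by auto
    show "(\<lambda>n. F (u n) * G (u n)) \<longlonglongrightarrow> 0" by (rule ud[OF I'(1) ul(3,6)])
    show "(\<lambda>n. F (l n) * G (l n)) \<longlonglongrightarrow> 0" by (rule lc[OF I'(2) ul(4,5)])
  qed
  then have "(LINT x:I|lebesgue. \<phi> x) = 0" using LIMSEQ_unique[OF lim1] unfolding ftc by simp
  then show ?thesis unfolding \<phi>_def by (simp add: set_integral_add(2)[OF i1 i2])
qed

section \<open>The weight and the space\<close>

text \<open>
  All statements are uniform in \<open>\<nu>\<close>: the sets \<open>I_sub I \<nu> x\<close> grow as \<open>x\<close> moves towards the far end, and
  the orientation enters only through the sign \<open>sgn_nu\<close> of the derivative of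
  \<open>\<lambda>x. ext_integral (I_sub I \<nu> x) h\<close>.
\<close>

locale cesaro_copson =
  fixes c d :: ereal and I :: "real set" and p :: real and \<nu> :: nat and w :: "real \<Rightarrow> ereal"
  assumes cd: "c < d" and I: "I = einterval c d" and p1: "1 < p" and nu: "\<nu> \<in> {1, 2}"
    and w_meas: "w \<in> measurable_funs I" and w_pos: "AE x in lebesgue_on I. 0 < w x"
    and w_int: "(\<lambda>x. enn2ereal (ennpowr (e2ennreal (w x)) p)) \<in> L1_loc_2 I \<nu>"
begin

definition omega :: "real \<Rightarrow> real" where "omega x = real_of_ereal (w x)"

definition q :: real where "q = p / (p - 1)"

definition sgn_nu :: real where "sgn_nu = (if \<nu> = 1 then 1 else -1)"

lemma pq: "1 / p + 1 / q = 1" and q_conj: "(q - 1) * p = q" and q_pos: "0 < q"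
  using p1 by (auto simp: q_def field_simps)

lemma I_open: "open I" and I_sets [measurable, simp]: "I \<in> sets lebesgue"
  by (auto simp: I)

lemma AE_on_I_iff: "(AE x in lebesgue_on I. P x) \<longleftrightarrow> (AE x in lebesgue. x \<in> I \<longrightarrow> P x)"
  by (simp add: AE_restrict_space_iff)

lemma I_Icc: "s \<in> I \<Longrightarrow> t \<in> I \<Longrightarrow> {s..t} \<subseteq> I"
  unfolding I by (rule einterval_Icc_subset)

lemma I_sub_eq: "I_sub I \<nu> x = (if \<nu> = 1 then I \<inter> {..x} else I \<inter> {x..})"
  and I_sub_star_eq: "I_sub_star I \<nu> x = (if \<nu> = 1 then I \<inter> {x..} else I \<inter> {..x})"
  by (auto simp: I_sub_def I_sub_star_def)

lemma I_sub_sets [simp]: "I_sub I \<nu> x \<in> sets lebesgue" "I_sub_star I \<nu> x \<in> sets lebesgue"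
  by (auto simp: I_sub_eq I_sub_star_eq)

lemma I_sub_subset: "I_sub I \<nu> x \<subseteq> I" "I_sub_star I \<nu> x \<subseteq> I"
  by (auto simp: I_sub_def I_sub_star_def)

lemma exhausting_points:
  obtains a :: "nat \<Rightarrow> real" where "\<And>n. a n \<in> I" "\<And>y. y \<in> I \<Longrightarrow> \<exists>n. y \<in> I_sub_star I \<nu> (a n)"
proof -
  obtain u l :: "nat \<Rightarrow> real" where ul: "einterval c d = (\<Union>i. {l i .. u i})" "\<And>i. l i < u i"
    by (rule einterval_Icc_approximation[OF cd]) blast
  have sub: "{l n..u n} \<subseteq> I" for n using ul(1) I by blast
  have in_I: "l n \<in> I" "u n \<in> I" for n
    using subsetD[OF sub[of n], of "l n"] subsetD[OF sub[of n], of "u n"] ul(2)[of n] by simp_all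
  show thesis
  proof (rule that[of "if \<nu> = 1 then l else u"])
    show "(if \<nu> = 1 then l else u) n \<in> I" for n using in_I by simp
    fix y assume "y \<in> I"
    then obtain n where "y \<in> {l n..u n}" using ul(1) I by auto
    then show "\<exists>n. y \<in> I_sub_star I \<nu> ((if \<nu> = 1 then l else u) n)"
      using \<open>y \<in> I\<close> by (intro exI[of _ n]) (auto simp: I_sub_star_eq)
  qed
qed

lemma weight_tail:
  assumes "x \<in> I"
  shows "(\<integral>\<^sup>+y. ennpowr (e2ennreal (w y)) p \<partial>lebesgue_on (I_sub_star I \<nu> x)) < \<infinity>"
  using w_int assms by (auto simp: L1_loc_2_def)

lemma omega_meas [measurable]: "omega \<in> borel_measurable (lebesgue_on I)"
  unfolding omega_def[abs_def] by (rule borel_measurable_real_of_ereal) (use w_meas in \<open>simp add: measurable_funs_def\<close>)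

text \<open>
  The weight may take the value \<open>\<infinity>\<close>, but only on a null set, since its \<open>p\<close>-th power is integrable
  towards the far end.
\<close>

lemma omega_ae: "AE x in lebesgue_on I. 0 < omega x \<and> w x = ereal (omega x)"
proof -
  obtain a :: "nat \<Rightarrow> real" where a: "\<And>n. a n \<in> I" "\<And>y. y \<in> I \<Longrightarrow> \<exists>n. y \<in> I_sub_star I \<nu> (a n)"
    by (rule exhausting_points) blast
  have meas: "(\<lambda>y. ennpowr (e2ennreal (w y)) p) \<in> borel_measurable (lebesgue_on I)"
  proof -
    have "(\<lambda>y. enn2ereal (ennpowr (e2ennreal (w y)) p)) \<in> borel_measurable (lebesgue_on I)"
      using w_int by (simp add: L1_loc_2_def measurable_funs_def)
    from measurable_compose[OF this measurable_e2ennreal] show ?thesis by simp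
  qed
  have "AE y in lebesgue. y \<in> I_sub_star I \<nu> (a n) \<longrightarrow> w y \<noteq> \<infinity>" for n
  proof -
    have "(\<lambda>y. ennpowr (e2ennreal (w y)) p) \<in> borel_measurable (lebesgue_on (I_sub_star I \<nu> (a n)))"
      by (rule measurable_restrict_mono[OF meas I_sub_subset(2)])
    then have "AE y in lebesgue_on (I_sub_star I \<nu> (a n)). ennpowr (e2ennreal (w y)) p \<noteq> \<infinity>"
      using weight_tail[OF a(1)[of n]] by (intro nn_integral_noteq_infinite) auto
    then have "AE y in lebesgue_on (I_sub_star I \<nu> (a n)). w y \<noteq> \<infinity>"
    proof eventually_elim
      fix y assume fin: "ennpowr (e2ennreal (w y)) p \<noteq> \<infinity>"
      show "w y \<noteq> \<infinity>"
      proof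
        assume "w y = \<infinity>"
        then have "e2ennreal (w y) = \<infinity>" by (simp add: e2ennreal_infty)
        then show False using fin by (simp add: ennpowr_def)
      qed
    qed
    then show ?thesis by (simp add: AE_restrict_space_iff)
  qed
  then have "AE y in lebesgue. \<forall>n. y \<in> I_sub_star I \<nu> (a n) \<longrightarrow> w y \<noteq> \<infinity>"
    unfolding AE_all_countable by blast
  moreover have "AE y in lebesgue. y \<in> I \<longrightarrow> 0 < w y" using w_pos by (simp add: AE_restrict_space_iff)
  ultimately have "AE y in lebesgue. y \<in> I \<longrightarrow> 0 < omega y \<and> w y = ereal (omega y)"
  proof eventually_elim
    fix y assume 1: "\<forall>n. y \<in> I_sub_star I \<nu> (a n) \<longrightarrow> w y \<noteq> \<infinity>" and 2: "y \<in> I \<longrightarrow> 0 < w y"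
    show "y \<in> I \<longrightarrow> 0 < omega y \<and> w y = ereal (omega y)"
    proof
      assume "y \<in> I"
      then have "w y \<noteq> \<infinity>" "0 < w y" using 1 2 a(2) by blast+
      then show "0 < omega y \<and> w y = ereal (omega y)" by (cases "w y") (auto simp: omega_def)
    qed
  qed
  then show ?thesis by (rule AE_on_I_iff[THEN iffD2])
qed

lemma omega_tail:
  assumes "x \<in> I"
  shows "(\<integral>\<^sup>+y. ennreal (omega y powr p) * indicator (I_sub_star I \<nu> x) y \<partial>lebesgue) < \<infinity>"
proof -
  have "AE y in lebesgue. y \<in> I \<longrightarrow> 0 < omega y \<and> w y = ereal (omega y)"
    using omega_ae by (rule AE_on_I_iff[THEN iffD1])
  then have "(\<integral>\<^sup>+y. ennreal (omega y powr p) * indicator (I_sub_star I \<nu> x) y \<partial>lebesgue)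
    = (\<integral>\<^sup>+y. ennpowr (e2ennreal (w y)) p * indicator (I_sub_star I \<nu> x) y \<partial>lebesgue)"
  proof (intro nn_integral_cong_AE, eventually_elim)
    fix y assume "y \<in> I \<longrightarrow> 0 < omega y \<and> w y = ereal (omega y)"
    then show "ennreal (omega y powr p) * indicator (I_sub_star I \<nu> x) y
        = ennpowr (e2ennreal (w y)) p * indicator (I_sub_star I \<nu> x) y"
      using I_sub_subset(2)[of x] by (auto simp: indicator_def e2ennreal_ereal ennpowr_ennreal)
  qed
  then show ?thesis using weight_tail[OF assms] by (simp add: nn_integral_restrict_space)
qed

lemma omega_powr_loc:
  assumes "s \<in> I" "t \<in> I"
  shows "(\<lambda>x. omega x powr p) absolutely_integrable_on {s..t}"
proof -
  define x where "x = (if \<nu> = 1 then s else t)"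
  have "x \<in> I" using assms by (simp add: x_def)
  have sub: "{s..t} \<subseteq> I_sub_star I \<nu> x" using I_Icc[OF assms] by (auto simp: I_sub_star_eq x_def)
  have "(\<integral>\<^sup>+y. ennreal (omega y powr p) \<partial>lebesgue_on {s..t})
      \<le> (\<integral>\<^sup>+y. ennreal (omega y powr p) * indicator (I_sub_star I \<nu> x) y \<partial>lebesgue)"
    unfolding nn_integral_restrict_space[of "{s..t}" lebesgue, simplified]
    using sub by (intro nn_integral_mono) (auto simp: indicator_def)
  also have "\<dots> < \<infinity>" by (rule omega_tail) fact
  finally have fin: "(\<integral>\<^sup>+y. ennreal (omega y powr p) \<partial>lebesgue_on {s..t}) < \<infinity>" .
  have m: "omega \<in> borel_measurable (lebesgue_on {s..t})"
    by (rule measurable_restrict_mono[OF omega_meas I_Icc[OF assms]])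
  have "integrable (lebesgue_on {s..t}) (\<lambda>y. omega y powr p)"
    using fin m by (intro integrableI_nonneg) auto
  then show ?thesis by (simp add: integrable_restrict_space set_integrable_def)
qed

lemma Ch_norm_eq:
  "Ch_norm I \<nu> p w h = ennpowr (\<integral>\<^sup>+x. ennreal ((omega x * \<bar>ext_integral (I_sub I \<nu> x) h\<bar>) powr p) \<partial>lebesgue_on I) (1 / p)"
  unfolding Ch_norm_def Lp_norm_def
proof (intro arg_cong[where f = "\<lambda>z. ennpowr z (1 / p)"] nn_integral_cong_AE)
  show "AE x in lebesgue_on I. ennpowr (e2ennreal \<bar>w x * ereal (ext_integral (I_sub I \<nu> x) h)\<bar>) p
     = ennreal ((omega x * \<bar>ext_integral (I_sub I \<nu> x) h\<bar>) powr p)"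
    using omega_ae
  proof eventually_elim
    fix x assume "0 < omega x \<and> w x = ereal (omega x)"
    then show "ennpowr (e2ennreal \<bar>w x * ereal (ext_integral (I_sub I \<nu> x) h)\<bar>) p
     = ennreal ((omega x * \<bar>ext_integral (I_sub I \<nu> x) h\<bar>) powr p)"
      by (simp add: e2ennreal_ereal ennpowr_ennreal abs_mult)
  qed
qed

lemma Lp_inv_weight_norm_eq:
  "Lp_inv_weight_norm I r w (\<lambda>x. ereal (u x)) = ennpowr (\<integral>\<^sup>+x. ennreal ((\<bar>u x\<bar> / omega x) powr r) \<partial>lebesgue_on I) (1 / r)"
  unfolding Lp_inv_weight_norm_def Lp_norm_def
proof (intro arg_cong[where f = "\<lambda>z. ennpowr z (1 / r)"] nn_integral_cong_AE)
  show "AE x in lebesgue_on I. ennpowr (e2ennreal \<bar>ereal (u x) * (1 / w x)\<bar>) r = ennreal ((\<bar>u x\<bar> / omega x) powr r)"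
    using omega_ae
  proof eventually_elim
    fix x assume "0 < omega x \<and> w x = ereal (omega x)"
    then show "ennpowr (e2ennreal \<bar>ereal (u x) * (1 / w x)\<bar>) r = ennreal ((\<bar>u x\<bar> / omega x) powr r)"
      by (simp add: e2ennreal_ereal ennpowr_ennreal abs_mult one_ereal_def)
  qed
qed

text \<open>
  Passage to real-valued functions: elements of the space are finite almost everywhere, and
  \<open>\<lambda>x. ext_integral (I_sub I \<nu> x) h\<close> is a signed primitive of the real version of \<open>h\<close>.
\<close>

lemma L1_loc_1_real:
  assumes h: "h \<in> L1_loc_1 I \<nu>"
  defines "k \<equiv> \<lambda>x. real_of_ereal (h x)"
  shows "k \<in> borel_measurable (lebesgue_on I)"
    and "x \<in> I \<Longrightarrow> set_integrable lebesgue (I_sub I \<nu> x) k"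
    and "AE x in lebesgue_on I. h x = ereal (k x)"
    and "ext_integral (I_sub I \<nu> x) h = (LINT y:I_sub I \<nu> x|lebesgue. k y)"
    and "s \<le> t \<Longrightarrow> {s..t} \<subseteq> I \<Longrightarrow> k absolutely_integrable_on {s..t}"
    and "s \<le> t \<Longrightarrow> {s..t} \<subseteq> I \<Longrightarrow>
      ext_integral (I_sub I \<nu> t) h - ext_integral (I_sub I \<nu> s) h = integral {s..t} (\<lambda>x. sgn_nu * k x)"
proof -
  have hm: "h \<in> borel_measurable (lebesgue_on I)" using h by (simp add: L1_loc_1_def measurable_funs_def)
  then show km: "k \<in> borel_measurable (lebesgue_on I)" unfolding k_def by (rule borel_measurable_real_of_ereal)
  have fin: "(\<integral>\<^sup>+ y. e2ennreal \<bar>h y\<bar> \<partial>lebesgue_on (I_sub I \<nu> x)) < \<infinity>" if "x \<in> I" for x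
    using h that by (simp add: L1_loc_1_def)
  have le: "ennreal (norm (k y)) \<le> e2ennreal \<bar>h y\<bar>" for y
    by (cases "h y") (auto simp: k_def e2ennreal_ereal)
  show ki: "set_integrable lebesgue (I_sub I \<nu> x) k" if "x \<in> I" for x
  proof -
    have "integrable (lebesgue_on (I_sub I \<nu> x)) k"
    proof (rule integrableI_bounded)
      show "k \<in> borel_measurable (lebesgue_on (I_sub I \<nu> x))"
        by (rule measurable_restrict_mono[OF km I_sub_subset(1)])
      have "(\<integral>\<^sup>+ y. ennreal (norm (k y)) \<partial>lebesgue_on (I_sub I \<nu> x)) \<le> (\<integral>\<^sup>+ y. e2ennreal \<bar>h y\<bar> \<partial>lebesgue_on (I_sub I \<nu> x))"
        by (intro nn_integral_mono le)
      then show "(\<integral>\<^sup>+ y. ennreal (norm (k y)) \<partial>lebesgue_on (I_sub I \<nu> x)) < \<infinity>"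
        using fin[OF that] by (rule le_less_trans)
    qed
    then show ?thesis by (simp add: integrable_restrict_space set_integrable_def)
  qed
  show "AE x in lebesgue_on I. h x = ereal (k x)"
  proof -
    obtain u l :: "nat \<Rightarrow> real" where ul: "einterval c d = (\<Union>i. {l i .. u i})" "\<And>i. l i < u i"
      by (rule einterval_Icc_approximation[OF cd]) blast
    define z where "z n = (if \<nu> = 1 then u n else l n)" for n
    have sub: "{l n..u n} \<subseteq> I" for n using ul(1) I by blast
    have zI: "z n \<in> I" for n
      using subsetD[OF sub[of n], of "l n"] subsetD[OF sub[of n], of "u n"] ul(2)[of n] by (simp add: z_def)
    have "AE y in lebesgue. y \<in> I_sub I \<nu> (z n) \<longrightarrow> h y = ereal (k y)" for n
    proof -
      have "(\<lambda>y. e2ennreal \<bar>h y\<bar>) \<in> borel_measurable (lebesgue_on (I_sub I \<nu> (z n)))"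
        using measurable_restrict_mono[OF hm I_sub_subset(1)[of "z n"]] by measurable
      then have "AE y in lebesgue_on (I_sub I \<nu> (z n)). e2ennreal \<bar>h y\<bar> \<noteq> \<infinity>"
        using fin[OF zI[of n]] by (intro nn_integral_noteq_infinite) auto
      then have "AE y in lebesgue_on (I_sub I \<nu> (z n)). h y = ereal (k y)"
      proof eventually_elim
        fix y assume "e2ennreal \<bar>h y\<bar> \<noteq> \<infinity>"
        then show "h y = ereal (k y)" by (cases "h y") (auto simp: k_def e2ennreal_infty)
      qed
      then show ?thesis by (simp add: AE_restrict_space_iff)
    qed
    then have "AE y in lebesgue. \<forall>n. y \<in> I_sub I \<nu> (z n) \<longrightarrow> h y = ereal (k y)"
      unfolding AE_all_countable by blast
    then have "AE y in lebesgue. y \<in> I \<longrightarrow> h y = ereal (k y)"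
    proof eventually_elim
      fix y assume *: "\<forall>n. y \<in> I_sub I \<nu> (z n) \<longrightarrow> h y = ereal (k y)"
      show "y \<in> I \<longrightarrow> h y = ereal (k y)"
      proof
        assume "y \<in> I"
        then obtain n where "y \<in> {l n..u n}" using ul(1) I by auto
        then have "y \<in> I_sub I \<nu> (z n)" using \<open>y \<in> I\<close> by (auto simp: I_sub_eq z_def)
        then show "h y = ereal (k y)" using * by blast
      qed
    qed
    then show ?thesis by (simp add: AE_restrict_space_iff)
  qed
  show eq: "ext_integral (I_sub I \<nu> x) h = (LINT y:I_sub I \<nu> x|lebesgue. k y)" for x
    by (simp add: ext_integral_def k_def integral_restrict_space set_lebesgue_integral_def)
  show kst: "k absolutely_integrable_on {s..t}" if "s \<le> t" "{s..t} \<subseteq> I" for s t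
  proof -
    have "s \<in> I" "t \<in> I" using that by auto
    have "{s..t} \<subseteq> I_sub I \<nu> (if \<nu> = 1 then t else s)" using that by (auto simp: I_sub_eq)
    moreover have "(if \<nu> = 1 then t else s) \<in> I" using \<open>s \<in> I\<close> \<open>t \<in> I\<close> by simp
    ultimately show ?thesis by (intro set_integrable_subset[OF ki]) auto
  qed
  show "ext_integral (I_sub I \<nu> t) h - ext_integral (I_sub I \<nu> s) h = integral {s..t} (\<lambda>x. sgn_nu * k x)"
    if st: "s \<le> t" "{s..t} \<subseteq> I"
  proof -
    have stI: "s \<in> I" "t \<in> I" using st by auto
    \<comment> \<open>half-open, so that it is disjoint from the smaller of the two sets\<close>
    define T where "T = (if \<nu> = 1 then {s<..t} else {s..<t})"
    have Tsub: "T \<subseteq> {s..t}" by (auto simp: T_def)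
    have "set_integrable lebesgue T k"
      by (rule set_integrable_subset[OF kst[OF st] _ Tsub]) (simp add: T_def)
    have ITk: "integral T k = integral {s..t} k"
    proof (rule integral_spike_set)
      show "negligible {x \<in> T - {s..t}. k x \<noteq> 0}" "negligible {x \<in> {s..t} - T. k x \<noteq> 0}"
        by (rule negligible_subset[of "{s,t}"]; auto simp: T_def split: if_splits)+
    qed
    have Tk: "(LINT y:T|lebesgue. k y) = integral {s..t} k"
      using set_lebesgue_integral_eq_integral(2)[OF \<open>set_integrable lebesgue T k\<close>] ITk by simp
    have split: "(LINT y:A \<union> T|lebesgue. k y) = (LINT y:A|lebesgue. k y) + (LINT y:T|lebesgue. k y)"
      if "A \<inter> T = {}" "set_integrable lebesgue A k" for A
      using that \<open>set_integrable lebesgue T k\<close> by (intro set_integral_Un)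
    show ?thesis
    proof (cases "\<nu> = 1")
      case True
      then have e: "I_sub I \<nu> t = I_sub I \<nu> s \<union> T" and dj: "I_sub I \<nu> s \<inter> T = {}"
        using st stI Tsub by (auto simp: I_sub_def T_def)
      have "sgn_nu = 1" unfolding sgn_nu_def using True by simp
      then show ?thesis using eq[of s] eq[of t] e split[OF dj ki[OF stI(1)]] Tk by simp
    next
      case False
      then have e: "I_sub I \<nu> s = I_sub I \<nu> t \<union> T" and dj: "I_sub I \<nu> t \<inter> T = {}"
        using st stI Tsub by (auto simp: I_sub_def T_def)
      have "sgn_nu = -1" unfolding sgn_nu_def using False by simp
      then show ?thesis using eq[of s] eq[of t] e split[OF dj ki[OF stI(2)]] Tk by simp
    qed
  qed
qed

lemma I_sub_integral_tendsto_0: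
  assumes k: "\<And>x. x \<in> I \<Longrightarrow> set_integrable lebesgue (I_sub I \<nu> x) k"
    and z: "\<And>n. z n \<in> I" "if \<nu> = 1 then decseq z else incseq z"
      "(\<lambda>n. ereal (z n)) \<longlonglongrightarrow> (if \<nu> = 1 then c else d)"
  shows "(\<lambda>n. LINT y:I_sub I \<nu> (z n)|lebesgue. (k y :: real)) \<longlonglongrightarrow> 0"
proof -
  have "(\<lambda>n. LINT y:I_sub I \<nu> (z n)|lebesgue. k y) \<longlonglongrightarrow> (LINT y:(\<Inter>n. I_sub I \<nu> (z n))|lebesgue. k y)"
  proof (rule set_integral_cont_down)
    show "decseq (\<lambda>n. I_sub I \<nu> (z n))"
      unfolding decseq_def
    proof (intro allI impI)
      fix m n :: nat assume "m \<le> n"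
      then have "if \<nu> = 1 then z n \<le> z m else z m \<le> z n"
        using z(2) by (simp add: decseq_def incseq_def split: if_splits)
      then show "I_sub I \<nu> (z n) \<subseteq> I_sub I \<nu> (z m)"
        by (auto simp: I_sub_eq split: if_splits)
    qed
    show "set_integrable lebesgue (I_sub I \<nu> (z i)) k" for i by (rule k[OF z(1)])
  qed simp
  moreover have "(\<Inter>n. I_sub I \<nu> (z n)) = {}"
  proof (rule ccontr)
    assume "\<not> ?thesis"
    then obtain y where y: "\<And>n. y \<in> I_sub I \<nu> (z n)" by blast
    then have "y \<in> I" using I_sub_subset(1) by blast
    show False
    proof (cases "\<nu> = 1")
      case True
      then have "ereal y \<le> c" using y z(3) by (intro Lim_bounded2[of _ c 0]) (auto simp: I_sub_def)
      then show False using \<open>y \<in> I\<close> by (auto simp: I einterval_def)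
    next
      case False
      then have "d \<le> ereal y" using y z(3) by (intro Lim_bounded[of _ d 0]) (auto simp: I_sub_def)
      then show False using \<open>y \<in> I\<close> by (auto simp: I einterval_def)
    qed
  qed
  ultimately show ?thesis by (simp add: set_lebesgue_integral_def)
qed

end

section \<open>A representative bounds the functional\<close>

context cesaro_copson begin

lemma integrable_on_I_iff: "integrable (lebesgue_on I) f \<longleftrightarrow> set_integrable lebesgue I f"
  for f :: "real \<Rightarrow> real"
  by (simp add: integrable_restrict_space set_integrable_def)

lemma integral_on_I: "integral\<^sup>L (lebesgue_on I) f = (LINT x:I|lebesgue. f x)"
  for f :: "real \<Rightarrow> real"
  by (simp add: integral_restrict_space set_lebesgue_integral_def)

lemma representative_facts:
  assumes rep: "Ch_representative I \<nu> p w g \<gamma>"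
  obtains b B where "b \<in> I" "\<And>x. x \<in> I \<Longrightarrow> x \<notin> I_sub I \<nu> b \<Longrightarrow> \<gamma> x = 0" "0 \<le> B" "\<And>x. x \<in> I \<Longrightarrow> \<bar>\<gamma> x\<bar> \<le> B"
    "continuous_on I \<gamma>" "\<gamma> \<in> AC_loc I" "AE x in lebesgue_on I. g x = ereal (\<gamma> x)"
    "Lp_inv_weight_norm I q w (\<lambda>x. ereal (deriv \<gamma> x)) < \<infinity>"
proof -
  obtain b where b: "b \<in> I" and form: "\<forall>x\<in>I. \<gamma> x =
        (-1) ^ \<nu> * indicator (I_sub I \<nu> b) x * (\<integral>y. deriv \<gamma> y \<partial>lebesgue_on (I_sub_star I \<nu> x))"
    using rep unfolding Ch_representative_def by blast
  have AC: "\<gamma> \<in> AC_loc I" using rep unfolding Ch_representative_def by blast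
  then have cont: "continuous_on I \<gamma>" unfolding I by (rule AC_loc_einterval_continuous_on)
  define M where "M = max 0 (esssup (lebesgue_on I) (\<lambda>x. \<bar>ereal (\<gamma> x)\<bar>))"
  have "(\<lambda>x. ereal (\<gamma> x)) \<in> L_infinity I" using rep unfolding Ch_representative_def by blast
  then have fin: "esssup (lebesgue_on I) (\<lambda>x. \<bar>ereal (\<gamma> x)\<bar>) < \<infinity>"
    by (simp add: L_infinity_def)
  then have "0 \<le> M" "M < \<infinity>" by (auto simp: M_def max_def)
  then obtain B where B: "M = ereal B" "0 \<le> B" by (cases M) auto
  have "AE x in lebesgue_on I. \<bar>ereal (\<gamma> x)\<bar> \<le> esssup (lebesgue_on I) (\<lambda>x. \<bar>ereal (\<gamma> x)\<bar>)"
    by (rule esssup_AE)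
  then have "AE x in lebesgue_on I. \<bar>\<gamma> x\<bar> \<le> B"
  proof eventually_elim
    fix x assume "\<bar>ereal (\<gamma> x)\<bar> \<le> esssup (lebesgue_on I) (\<lambda>x. \<bar>ereal (\<gamma> x)\<bar>)"
    also have "\<dots> \<le> M" by (simp add: M_def)
    finally show "\<bar>\<gamma> x\<bar> \<le> B" by (simp add: B)
  qed
  then have "\<bar>\<gamma> x\<bar> \<le> B" if "x \<in> I" for x
    by (rule continuous_on_AE_le_imp_le[OF I_open continuous_on_rabs[OF cont] _ that])
  moreover have "\<gamma> x = 0" if "x \<in> I" "x \<notin> I_sub I \<nu> b" for x using form that by simp
  moreover have "AE x in lebesgue_on I. g x = ereal (\<gamma> x)" using rep unfolding Ch_representative_def by blast
  moreover have "Lp_inv_weight_norm I q w (\<lambda>x. ereal (deriv \<gamma> x)) < \<infinity>"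
    using rep unfolding Ch_representative_def Lp_inv_weight_def q_def by blast
  ultimately show thesis using b cont AC B(2) that by blast
qed

text \<open>
  Hoelder's inequality for the factors \<open>omega * F\<close> and \<open>u / omega\<close>.
\<close>

lemma pairing_Hoelder:
  assumes h: "h \<in> L1_loc_1 I \<nu>" and um: "u \<in> borel_measurable (lebesgue_on I)"
    and Fm: "(\<lambda>x. ext_integral (I_sub I \<nu> x) h) \<in> borel_measurable (lebesgue_on I)"
  shows "(\<integral>\<^sup>+x. ennreal \<bar>ext_integral (I_sub I \<nu> x) h * u x\<bar> \<partial>lebesgue_on I)
     \<le> Lp_inv_weight_norm I q w (\<lambda>x. ereal (u x)) * Ch_norm I \<nu> p w h"
proof -
  define F where "F x = ext_integral (I_sub I \<nu> x) h" for x
  define M where "M = lebesgue_on I"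
  have [measurable]: "F \<in> borel_measurable M" "u \<in> borel_measurable M" "omega \<in> borel_measurable M"
    using um Fm by (auto simp: F_def[abs_def] M_def)
  have ae: "AE x in M. ennreal \<bar>F x * u x\<bar> = ennreal ((\<bar>omega x\<bar> * \<bar>F x\<bar>) * (\<bar>u x\<bar> / \<bar>omega x\<bar>))"
    using omega_ae unfolding M_def by eventually_elim (simp add: abs_mult)
  have "(\<integral>\<^sup>+x. ennreal \<bar>F x * u x\<bar> \<partial>M) = (\<integral>\<^sup>+x. ennreal ((\<bar>omega x\<bar> * \<bar>F x\<bar>) * (\<bar>u x\<bar> / \<bar>omega x\<bar>)) \<partial>M)"
    by (rule nn_integral_cong_AE[OF ae])
  also have "\<dots> \<le> ennpowr (\<integral>\<^sup>+x. ennreal ((\<bar>omega x\<bar> * \<bar>F x\<bar>) powr p) \<partial>M) (1/p)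
       * ennpowr (\<integral>\<^sup>+x. ennreal ((\<bar>u x\<bar> / \<bar>omega x\<bar>) powr q) \<partial>M) (1/q)"
    by (rule nn_integral_Hoelder[OF p1 q_def]) auto
  also have "(\<integral>\<^sup>+x. ennreal ((\<bar>omega x\<bar> * \<bar>F x\<bar>) powr p) \<partial>M) = (\<integral>\<^sup>+x. ennreal ((omega x * \<bar>F x\<bar>) powr p) \<partial>M)"
    by (rule nn_integral_cong_AE, use omega_ae[folded M_def] in eventually_elim) simp
  also have "(\<integral>\<^sup>+x. ennreal ((\<bar>u x\<bar> / \<bar>omega x\<bar>) powr q) \<partial>M) = (\<integral>\<^sup>+x. ennreal ((\<bar>u x\<bar> / omega x) powr q) \<partial>M)"
    by (rule nn_integral_cong_AE, use omega_ae[folded M_def] in eventually_elim) simp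
  finally show ?thesis
    unfolding Ch_norm_eq Lp_inv_weight_norm_eq F_def M_def by (simp add: mult.commute)
qed

text \<open>
  Integration by parts. Integrability of \<open>h g\<close> holds because \<open>\<gamma>\<close> is bounded and supported in a
  set \<open>I_sub I \<nu> b\<close>, where \<open>h\<close> is integrable; integrability of \<open>F * deriv \<gamma>\<close> is part of Hoelder's
  inequality.
\<close>

lemma representative_bound:
  assumes rep: "Ch_representative I \<nu> p w g \<gamma>" and gm: "g \<in> measurable_funs I"
    and h: "h \<in> Ch_space I \<nu> p w"
  shows "ext_integrable_on (\<lambda>x. h x * g x) I"
    and "ennreal \<bar>ext_integral I (\<lambda>x. h x * g x)\<bar> \<le> Lp_inv_weight_norm I q w (\<lambda>x. ereal (deriv \<gamma> x)) * Ch_norm I \<nu> p w h"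
proof -
  obtain b B where b: "b \<in> I" "\<And>x. x \<in> I \<Longrightarrow> x \<notin> I_sub I \<nu> b \<Longrightarrow> \<gamma> x = 0" and B: "0 \<le> B" "\<And>x. x \<in> I \<Longrightarrow> \<bar>\<gamma> x\<bar> \<le> B"
    and cont: "continuous_on I \<gamma>" and AC: "\<gamma> \<in> AC_loc I" and ae: "AE x in lebesgue_on I. g x = ereal (\<gamma> x)"
    and fin: "Lp_inv_weight_norm I q w (\<lambda>x. ereal (deriv \<gamma> x)) < \<infinity>"
    by (rule representative_facts[OF rep]) blast
  have hL: "h \<in> L1_loc_1 I \<nu>" and hfin: "Ch_norm I \<nu> p w h < \<infinity>" using h by (auto simp: Ch_space_def)
  define k where "k x = real_of_ereal (h x)" for x
  note k = L1_loc_1_real[OF hL, folded k_def]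
  define M where "M = lebesgue_on I"
  define F where "F = (\<lambda>x. ext_integral (I_sub I \<nu> x) h)"
  have incr: "F t - F s = integral {s..t} (\<lambda>x. sgn_nu * k x)" if "s \<le> t" "{s..t} \<subseteq> einterval c d" for s t
    using k(6)[of s t] that by (simp add: F_def I)
  have sk: "(\<lambda>x. sgn_nu * k x) absolutely_integrable_on {s..t}" if "s \<le> t" "{s..t} \<subseteq> einterval c d" for s t
    using k(5)[of s t] that I by (simp add: set_integrable_mult_right)
  have FAC: "F \<in> AC_loc I" and Fd: "AE x in lebesgue_on I. (F has_real_derivative sgn_nu * k x) (at x)"
    using indefinite_integral_AC_loc[OF cd sk incr, folded I] by blast+
  have Fm: "F \<in> borel_measurable M"
    unfolding M_def using AC_loc_einterval_continuous_on[of F c d] FAC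
    by (intro continuous_imp_measurable_on_sets_lebesgue) (auto simp: I)
  have \<gamma>m: "\<gamma> \<in> borel_measurable M"
    unfolding M_def by (rule continuous_imp_measurable_on_sets_lebesgue[OF cont I_sets])
  have dm: "deriv \<gamma> \<in> borel_measurable M"
    using AC_loc_deriv(2)[OF cd] AC unfolding M_def I by blast
  have km: "k \<in> borel_measurable M" unfolding M_def by (rule k(1))
  have kg: "integrable M (\<lambda>x. k x * \<gamma> x)"
  proof -
    have "integrable M (\<lambda>x. indicator (I_sub I \<nu> b) x * k x)"
    proof -
      have "set_integrable lebesgue I (\<lambda>x. indicator (I_sub I \<nu> b) x * k x)"
      proof -
        have "(\<lambda>x. indicat_real I x *\<^sub>R (indicator (I_sub I \<nu> b) x * k x)) = (\<lambda>x. indicat_real (I_sub I \<nu> b) x *\<^sub>R k x)"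
          using I_sub_subset(1)[of b] by (auto simp: fun_eq_iff indicator_def)
        then show ?thesis using k(2)[OF b(1)] by (simp add: set_integrable_def)
      qed
      then show ?thesis unfolding M_def integrable_on_I_iff .
    qed
    then have "integrable M (\<lambda>x. B * (indicator (I_sub I \<nu> b) x * k x))" by (rule integrable_mult_right)
    then show ?thesis
    proof (rule Bochner_Integration.integrable_bound)
      show "(\<lambda>x. k x * \<gamma> x) \<in> borel_measurable M" using km \<gamma>m by simp
      show "AE x in M. norm (k x * \<gamma> x) \<le> norm (B * (indicator (I_sub I \<nu> b) x * k x))"
      proof (rule AE_I2)
        fix x assume "x \<in> space M"
        then have "x \<in> I" by (simp add: M_def)
        show "norm (k x * \<gamma> x) \<le> norm (B * (indicator (I_sub I \<nu> b) x * k x))"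
        proof (cases "x \<in> I_sub I \<nu> b")
          case True
          have "\<bar>k x\<bar> * \<bar>\<gamma> x\<bar> \<le> \<bar>k x\<bar> * B" using B(2)[OF \<open>x \<in> I\<close>] by (intro mult_left_mono) auto
          then show ?thesis using True B(1) by (simp add: abs_mult mult.commute)
        qed (simp add: b(2)[OF \<open>x \<in> I\<close>])
      qed
    qed
  qed
  have prod_ae: "AE x in M. h x * g x = ereal (k x * \<gamma> x)"
    using k(3) ae unfolding M_def by eventually_elim simp
  have hm: "h \<in> borel_measurable M" using hL by (simp add: L1_loc_1_def measurable_funs_def M_def)
  have gm': "g \<in> borel_measurable M" using gm by (simp add: measurable_funs_def M_def)
  have hgm: "(\<lambda>x. h x * g x) \<in> borel_measurable M" using hm gm' by (rule borel_measurable_ereal_times)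
  show "ext_integrable_on (\<lambda>x. h x * g x) I"
    unfolding ext_integrable_on_def M_def[symmetric]
  proof (intro conjI hgm)
    have "(\<integral>\<^sup>+ x. e2ennreal \<bar>h x * g x\<bar> \<partial>M) = (\<integral>\<^sup>+ x. ennreal (norm (k x * \<gamma> x)) \<partial>M)"
      by (rule nn_integral_cong_AE, use prod_ae in eventually_elim) (simp add: e2ennreal_ereal)
    also have "\<dots> < \<infinity>" using kg by (simp add: integrable_iff_bounded)
    finally show "(\<integral>\<^sup>+ x. e2ennreal \<bar>h x * g x\<bar> \<partial>M) < \<infinity>" .
  qed
  have ext: "ext_integral I (\<lambda>x. h x * g x) = (\<integral>x. k x * \<gamma> x \<partial>M)"
    unfolding ext_integral_def M_def[symmetric]
  proof (rule integral_cong_AE)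
    show "(\<lambda>x. real_of_ereal (h x * g x)) \<in> borel_measurable M" by (rule borel_measurable_real_of_ereal[OF hgm])
    show "(\<lambda>x. k x * \<gamma> x) \<in> borel_measurable M" using km \<gamma>m by simp
    show "AE x in M. real_of_ereal (h x * g x) = k x * \<gamma> x"
      using prod_ae by eventually_elim (metis real_of_ereal.simps(1))
  qed
  have dF: "AE x in M. deriv F x * \<gamma> x = sgn_nu * (k x * \<gamma> x)"
    using Fd unfolding M_def by eventually_elim (simp add: DERIV_imp_deriv mult.assoc)
  have dFm: "deriv F \<in> borel_measurable M"
    using AC_loc_deriv(2)[OF cd] FAC unfolding M_def I by blast
  have i1: "integrable M (\<lambda>x. deriv F x * \<gamma> x)"
    using integrable_mult_right[OF kg, of sgn_nu] dFm \<gamma>m km dF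
    by (subst integrable_cong_AE[OF _ _ dF]) auto
  have "(\<integral>\<^sup>+x. ennreal (norm (F x * deriv \<gamma> x)) \<partial>M)
     \<le> Lp_inv_weight_norm I q w (\<lambda>x. ereal (deriv \<gamma> x)) * Ch_norm I \<nu> p w h"
    using pairing_Hoelder[OF hL dm[unfolded M_def]] Fm by (simp add: M_def F_def)
  note hoelder = this
  have i2: "integrable M (\<lambda>x. F x * deriv \<gamma> x)"
  proof (rule integrableI_bounded)
    show "(\<lambda>x. F x * deriv \<gamma> x) \<in> borel_measurable M" using Fm dm by simp
    show "(\<integral>\<^sup>+x. ennreal (norm (F x * deriv \<gamma> x)) \<partial>M) < \<infinity>"
      using hoelder fin hfin by (auto simp: ennreal_mult_less_top intro: le_less_trans)
  qed
  have F_LINT: "F x = (LINT y:I_sub I \<nu> x|lebesgue. k y)" for x by (simp add: F_def k(4))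
  have small: "(\<lambda>n. F (z n) * \<gamma> (z n)) \<longlonglongrightarrow> 0"
    if z: "\<And>n. z n \<in> I" "if \<nu> = 1 then decseq z else incseq z"
      "(\<lambda>n. ereal (z n)) \<longlonglongrightarrow> (if \<nu> = 1 then c else d)" for z
  proof -
    have "(\<lambda>n. F (z n)) \<longlonglongrightarrow> 0"
      unfolding F_LINT by (rule I_sub_integral_tendsto_0[OF k(2) z])
    then have "(\<lambda>n. \<bar>F (z n)\<bar> * B) \<longlonglongrightarrow> 0"
      using tendsto_mult_left_zero tendsto_rabs_zero by blast
    then show ?thesis
    proof (rule Lim_null_comparison[rotated], intro always_eventually allI)
      fix n
      have "\<bar>F (z n)\<bar> * \<bar>\<gamma> (z n)\<bar> \<le> \<bar>F (z n)\<bar> * B" using B(2)[OF z(1)] by (intro mult_left_mono) auto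
      then show "norm (F (z n) * \<gamma> (z n)) \<le> \<bar>F (z n)\<bar> * B" by (simp add: abs_mult)
    qed
  qed
  have vanish: "(\<lambda>n. F (z n) * \<gamma> (z n)) \<longlonglongrightarrow> 0"
    if z: "\<And>n. z n \<in> I" "(\<lambda>n. ereal (z n)) \<longlonglongrightarrow> (if \<nu> = 1 then d else c)" for z
  proof -
    have "eventually (\<lambda>n. z n \<notin> I_sub I \<nu> b) sequentially"
    proof (cases "\<nu> = 1")
      case True
      have "ereal b < d" using b(1) by (auto simp: I einterval_def)
      then have "eventually (\<lambda>n. ereal b < ereal (z n)) sequentially" using z(2) True by (intro order_tendstoD(1)) auto
      then show ?thesis by eventually_elim (use True in \<open>auto simp: I_sub_def\<close>)
    next
      case False
      have "c < ereal b" using b(1) by (auto simp: I einterval_def)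
      then have "eventually (\<lambda>n. ereal (z n) < ereal b) sequentially" using z(2) False by (intro order_tendstoD(2)) auto
      then show ?thesis by eventually_elim (use False in \<open>auto simp: I_sub_def\<close>)
    qed
    then have "eventually (\<lambda>n. F (z n) * \<gamma> (z n) = 0) sequentially"
      by eventually_elim (simp add: b(2)[OF z(1)])
    then show ?thesis by (rule tendsto_eventually)
  qed
  have "(LINT x:I|lebesgue. deriv F x * \<gamma> x) = - (LINT x:I|lebesgue. F x * deriv \<gamma> x)"
  proof (rule AC_loc_integral_by_parts[OF cd I FAC AC])
    show "set_integrable lebesgue I (\<lambda>x. deriv F x * \<gamma> x)" using i1 by (simp add: M_def integrable_on_I_iff)
    show "set_integrable lebesgue I (\<lambda>x. F x * deriv \<gamma> x)" using i2 by (simp add: M_def integrable_on_I_iff)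
    fix l assume "\<And>n. l n \<in> I" "decseq l" "(\<lambda>n. ereal (l n)) \<longlonglongrightarrow> c"
    then show "(\<lambda>n. F (l n) * \<gamma> (l n)) \<longlonglongrightarrow> 0"
      using small[of l] vanish[of l] by (cases "\<nu> = 1") auto
  next
    fix u assume "\<And>n. u n \<in> I" "incseq u" "(\<lambda>n. ereal (u n)) \<longlonglongrightarrow> d"
    then show "(\<lambda>n. F (u n) * \<gamma> (u n)) \<longlonglongrightarrow> 0"
      using small[of u] vanish[of u] by (cases "\<nu> = 1") auto
  qed
  then have parts: "(\<integral>x. deriv F x * \<gamma> x \<partial>M) = - (\<integral>x. F x * deriv \<gamma> x \<partial>M)"
    by (simp add: M_def integral_on_I)
  have "(\<integral>x. deriv F x * \<gamma> x \<partial>M) = (\<integral>x. sgn_nu * (k x * \<gamma> x) \<partial>M)"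
    using dF dFm km \<gamma>m by (intro integral_cong_AE) auto
  then have "sgn_nu * (\<integral>x. k x * \<gamma> x \<partial>M) = - (\<integral>x. F x * deriv \<gamma> x \<partial>M)" using parts by simp
  moreover have "\<bar>sgn_nu\<bar> = 1" by (simp add: sgn_nu_def)
  ultimately have "\<bar>\<integral>x. k x * \<gamma> x \<partial>M\<bar> = \<bar>\<integral>x. F x * deriv \<gamma> x \<partial>M\<bar>"
    by (metis abs_minus_cancel abs_mult mult_1)
  then have "ennreal \<bar>ext_integral I (\<lambda>x. h x * g x)\<bar> = ennreal (norm (\<integral>x. F x * deriv \<gamma> x \<partial>M))"
    by (simp add: ext)
  also have "\<dots> \<le> (\<integral>\<^sup>+x. ennreal (norm (F x * deriv \<gamma> x)) \<partial>M)"
    by (rule integral_norm_bound_ennreal[OF i2])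
  also note hoelder
  finally show "ennreal \<bar>ext_integral I (\<lambda>x. h x * g x)\<bar> \<le> Lp_inv_weight_norm I q w (\<lambda>x. ereal (deriv \<gamma> x)) * Ch_norm I \<nu> p w h" .
qed

text \<open>
  A function \<open>h\<close> of norm \<open>0\<close> contributes \<open>0\<close> to the supremum: the numerator is then \<open>0\<close> as well, and
  \<open>0 / 0 = 0\<close> in \<^typ>\<open>ennreal\<close>.
\<close>

lemma representative_J_le:
  assumes rep: "Ch_representative I \<nu> p w g \<gamma>" and gm: "g \<in> measurable_funs I"
  shows "J_Ch I \<nu> p w g \<le> Lp_inv_weight_norm I q w (\<lambda>x. ereal (deriv \<gamma> x))"
    and "J_Ch I \<nu> p w g < \<infinity>"
proof -
  show le: "J_Ch I \<nu> p w g \<le> Lp_inv_weight_norm I q w (\<lambda>x. ereal (deriv \<gamma> x))"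
    unfolding J_Ch_def
  proof (subst if_P)
    show "\<forall>h\<in>Ch_space I \<nu> p w. ext_integrable_on (\<lambda>x. h x * g x) I"
      using representative_bound(1)[OF rep gm] by blast
    show "(SUP h \<in> {h \<in> Ch_space I \<nu> p w. \<not> (AE x in lebesgue_on I. h x = 0)}.
             ennreal \<bar>ext_integral I (\<lambda>x. h x * g x)\<bar> / Ch_norm I \<nu> p w h)
        \<le> Lp_inv_weight_norm I q w (\<lambda>x. ereal (deriv \<gamma> x))"
    proof (rule SUP_least)
      fix h assume "h \<in> {h \<in> Ch_space I \<nu> p w. \<not> (AE x in lebesgue_on I. h x = 0)}"
      then have h: "h \<in> Ch_space I \<nu> p w" by simp
      have fin: "Ch_norm I \<nu> p w h \<noteq> top" using h by (auto simp: Ch_space_def)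
      note bound = representative_bound(2)[OF rep gm h]
      show "ennreal \<bar>ext_integral I (\<lambda>x. h x * g x)\<bar> / Ch_norm I \<nu> p w h
         \<le> Lp_inv_weight_norm I q w (\<lambda>x. ereal (deriv \<gamma> x))"
      proof (cases "Ch_norm I \<nu> p w h = 0")
        case True
        then show ?thesis using bound by simp
      next
        case False
        have "ennreal \<bar>ext_integral I (\<lambda>x. h x * g x)\<bar> / Ch_norm I \<nu> p w h
          \<le> (Lp_inv_weight_norm I q w (\<lambda>x. ereal (deriv \<gamma> x)) * Ch_norm I \<nu> p w h) / Ch_norm I \<nu> p w h"
          by (rule divide_right_mono_ennreal[OF bound])
        also have "\<dots> = Lp_inv_weight_norm I q w (\<lambda>x. ereal (deriv \<gamma> x))"
          using False fin by (simp add: ennreal_mult_divide_eq)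
        finally show ?thesis .
      qed
    qed
  qed
  have "Lp_inv_weight_norm I q w (\<lambda>x. ereal (deriv \<gamma> x)) < \<infinity>"
    by (rule representative_facts[OF rep])
  with le show "J_Ch I \<nu> p w g < \<infinity>" by (rule le_less_trans)
qed

end

section \<open>Testing the functional with compactly supported functions\<close>

context cesaro_copson begin

text \<open>
  For a compactly supported density with integral \<open>0\<close> the two orientations agree up to sign: the
  integral from the left and the integral from the right cancel.
\<close>

lemma I_sub_integral_compact_support:
  fixes u H :: "real \<Rightarrow> real"
  assumes ab: "a \<in> I" "b \<in> I" "a \<le> b" and u: "u absolutely_integrable_on {a..b}"
    and H: "\<And>x. x \<in> {a..b} \<Longrightarrow> (u has_integral H x) {a..x}" and Hb: "H b = 0" and x: "x \<in> I"
  shows "\<bar>LINT y:I_sub I \<nu> x \<inter> {a..b}|lebesgue. u y\<bar> = \<bar>H x\<bar> * indicator {a..b} x"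
proof -
  have sub: "{a..b} \<subseteq> I" by (rule I_Icc[OF ab(1,2)])
  have seg: "(LINT y:{s..t}|lebesgue. u y) = H t - H s" if "a \<le> s" "s \<le> t" "t \<le> b" for s t
  proof -
    have "u absolutely_integrable_on {s..t}" by (rule set_integrable_subset[OF u]) (use that in auto)
    then have "(LINT y:{s..t}|lebesgue. u y) = integral {s..t} u" by (rule set_lebesgue_integral_eq_integral(2))
    moreover have "integral {a..s} u + integral {s..t} u = integral {a..t} u"
      using that H[of t] by (intro Henstock_Kurzweil_Integration.integral_combine) auto
    moreover have "integral {a..s} u = H s" "integral {a..t} u = H t"
      using H[of s] H[of t] that by (auto intro!: integral_unique)
    ultimately show ?thesis by simp
  qed
  have Ha: "H a = 0"
  proof -
    have "integral {a..a} u = H a" by (rule integral_unique, rule H) (use ab in simp)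
    then show ?thesis by simp
  qed
  consider "x < a" | "b < x" | "x \<in> {a..b}" by force
  then show ?thesis
  proof cases
    case 1
    then have "I_sub I \<nu> x \<inter> {a..b} = (if \<nu> = 1 then {} else {a..b})" using sub by (auto simp: I_sub_def)
    then show ?thesis using 1 seg[of a b] ab(3) by (simp add: Ha Hb set_lebesgue_integral_def split: if_splits)
  next
    case 2
    then have "I_sub I \<nu> x \<inter> {a..b} = (if \<nu> = 1 then {a..b} else {})" using sub by (auto simp: I_sub_def)
    then show ?thesis using 2 seg[of a b] ab(3) by (simp add: Ha Hb set_lebesgue_integral_def split: if_splits)
  next
    case 3
    then have "I_sub I \<nu> x \<inter> {a..b} = (if \<nu> = 1 then {a..x} else {x..b})" using sub by (auto simp: I_sub_def)
    then show ?thesis using 3 seg[of a x] seg[of x b] by (simp add: Ha Hb)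
  qed
qed

end

locale cesaro_copson_dual = cesaro_copson +
  fixes g :: "real \<Rightarrow> ereal"
  assumes g_meas: "g \<in> measurable_funs I" and J_fin: "J_Ch I \<nu> p w g < \<infinity>"
begin

definition C :: real where "C = enn2real (J_Ch I \<nu> p w g)"

definition g_real :: "real \<Rightarrow> real" where "g_real x = real_of_ereal (g x)"

lemma C_nonneg: "0 \<le> C" and J_eq_C: "J_Ch I \<nu> p w g = ennreal C"
  using J_fin by (auto simp: C_def)

text \<open>
  The form in which finiteness of the functional is used. For \<open>h\<close> of norm \<open>0\<close> it says that the
  pairing vanishes, since a nonzero numerator divided by \<open>0\<close> is infinite.
\<close>

lemma J_bound:
  assumes h: "h \<in> Ch_space I \<nu> p w"
  shows "ext_integrable_on (\<lambda>x. h x * g x) I"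
    and "ennreal \<bar>ext_integral I (\<lambda>x. h x * g x)\<bar> \<le> ennreal C * Ch_norm I \<nu> p w h"
proof -
  have all: "\<forall>h \<in> Ch_space I \<nu> p w. ext_integrable_on (\<lambda>x. h x * g x) I"
  proof (rule ccontr)
    assume "\<not> ?thesis"
    then have "J_Ch I \<nu> p w g = \<infinity>" unfolding J_Ch_def by (rule if_not_P)
    then show False using J_fin by simp
  qed
  then show "ext_integrable_on (\<lambda>x. h x * g x) I" using h by blast
  define X where "X = ennreal \<bar>ext_integral I (\<lambda>x. h x * g x)\<bar>"
  define Y where "Y = Ch_norm I \<nu> p w h"
  have Y: "Y \<noteq> top" using h by (auto simp: Ch_space_def Y_def)
  show "ennreal \<bar>ext_integral I (\<lambda>x. h x * g x)\<bar> \<le> ennreal C * Ch_norm I \<nu> p w h"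
  proof (cases "AE x in lebesgue_on I. h x = 0")
    case True
    have "ext_integral I (\<lambda>x. h x * g x) = 0"
      unfolding ext_integral_def by (rule integral_eq_zero_AE, use True in eventually_elim) simp
    then show ?thesis by simp
  next
    case False
    have "X / Y \<le> (SUP h \<in> {h \<in> Ch_space I \<nu> p w. \<not> (AE x in lebesgue_on I. h x = 0)}.
             ennreal \<bar>ext_integral I (\<lambda>x. h x * g x)\<bar> / Ch_norm I \<nu> p w h)"
      unfolding X_def Y_def by (rule SUP_upper) (use h False in simp)
    also have "\<dots> = ennreal C" using J_eq_C unfolding J_Ch_def if_P[OF all] .
    finally have le: "X / Y \<le> ennreal C" .
    have "X \<le> ennreal C * Y"
    proof (cases "Y = 0")
      case True
      have "X = 0"
      proof (rule ccontr)
        assume "X \<noteq> 0"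
        then have "X / Y = top" using True by (simp add: ennreal_divide_zero)
        then show False using le by (simp add: top_unique)
      qed
      then show ?thesis by simp
    next
      case False
      have "X = X / Y * Y" using False Y by (simp add: ennreal_divide_times ennreal_divide_self less_top)
      also have "\<dots> \<le> ennreal C * Y" using le by (rule mult_right_mono) simp
      finally show ?thesis .
    qed
    then show ?thesis by (simp add: X_def Y_def)
  qed
qed

text \<open>
  Every integrable function with compact support in \<open>I\<close> belongs to the space: its primitive is
  bounded and vanishes before the support, and the weight is integrable from there to the far end.
\<close>

lemma test_function:
  fixes u :: "real \<Rightarrow> real"
  assumes ab: "a \<in> I" "b \<in> I" and u: "u absolutely_integrable_on {a..b}"
  defines "h \<equiv> \<lambda>x. ereal (indicator {a..b} x * u x)"
  shows "h \<in> Ch_space I \<nu> p w"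
    and "ext_integral (I_sub I \<nu> x) h = (LINT y:I_sub I \<nu> x \<inter> {a..b}|lebesgue. u y)"
proof -
  define k where "k x = indicator {a..b} x * u x" for x
  have ki: "integrable lebesgue k" using u unfolding set_integrable_def k_def by simp
  define N where "N = (\<integral>x. \<bar>k x\<bar> \<partial>lebesgue)"
  have "N \<ge> 0" by (simp add: N_def)
  show F: "ext_integral (I_sub I \<nu> x) h = (LINT y:I_sub I \<nu> x \<inter> {a..b}|lebesgue. u y)" for x
    unfolding ext_integral_def h_def set_lebesgue_integral_def
    by (simp add: integral_restrict_space indicator_inter_arith mult.assoc)
  have hm: "h \<in> borel_measurable (lebesgue_on S)" for S
    unfolding h_def k_def[symmetric] using ki by (intro measurable_restrict_space1) auto
  have L: "h \<in> L1_loc_1 I \<nu>"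
    unfolding L1_loc_1_def measurable_funs_def
  proof (intro CollectI conjI hm ballI)
    fix x
    have "(\<integral>\<^sup>+ y. e2ennreal \<bar>h y\<bar> \<partial>lebesgue_on (I_sub I \<nu> x)) \<le> (\<integral>\<^sup>+ y. ennreal (norm (k y)) \<partial>lebesgue)"
      by (subst nn_integral_restrict_space)
         (auto simp: h_def k_def e2ennreal_ereal indicator_def intro!: nn_integral_mono)
    also have "\<dots> < \<infinity>" using ki by (simp add: integrable_iff_bounded)
    finally show "(\<integral>\<^sup>+ y. e2ennreal \<bar>h y\<bar> \<partial>lebesgue_on (I_sub I \<nu> x)) < \<infinity>" .
  qed
  define z where "z = (if \<nu> = 1 then a else b)"
  have zI: "z \<in> I" using ab by (simp add: z_def)
  have Fle: "\<bar>ext_integral (I_sub I \<nu> x) h\<bar> \<le> N * indicator (I_sub_star I \<nu> z) x" if "x \<in> I" for x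
  proof (cases "x \<in> I_sub_star I \<nu> z")
    case True
    have "\<bar>ext_integral (I_sub I \<nu> x) h\<bar> = \<bar>\<integral>y. indicator (I_sub I \<nu> x) y * k y \<partial>lebesgue\<bar>"
      unfolding F set_lebesgue_integral_def k_def by (simp add: indicator_inter_arith mult.assoc)
    also have "\<dots> \<le> (\<integral>y. \<bar>indicator (I_sub I \<nu> x) y * k y\<bar> \<partial>lebesgue)"
      using integral_abs_bound by blast
    also have "\<dots> \<le> N" unfolding N_def
      by (intro integral_mono integrable_abs ki integrable_mult_indicator[of _ lebesgue k, simplified real_scaleR_def])
         (auto simp: indicator_def)
    finally show ?thesis using True by simp
  next
    case False
    then have "I_sub I \<nu> x \<inter> {a..b} = {}"
      using \<open>x \<in> I\<close> by (auto simp: I_sub_def I_sub_star_def z_def split: if_splits)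
    then show ?thesis using \<open>N \<ge> 0\<close> False by (simp add: F set_lebesgue_integral_def)
  qed
  have "(\<integral>\<^sup>+x. ennreal ((omega x * \<bar>ext_integral (I_sub I \<nu> x) h\<bar>) powr p) \<partial>lebesgue_on I)
     \<le> (\<integral>\<^sup>+x. ennreal (N powr p) * (ennreal (omega x powr p) * indicator (I_sub_star I \<nu> z) x) \<partial>lebesgue_on I)"
  proof (rule nn_integral_mono_AE)
    have "AE x in lebesgue_on I. x \<in> I" by (rule AE_I2) simp
    with omega_ae show "AE x in lebesgue_on I. ennreal ((omega x * \<bar>ext_integral (I_sub I \<nu> x) h\<bar>) powr p)
       \<le> ennreal (N powr p) * (ennreal (omega x powr p) * indicator (I_sub_star I \<nu> z) x)"
    proof eventually_elim
      fix x assume x: "0 < omega x \<and> w x = ereal (omega x)" "x \<in> I"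
      have "(omega x * \<bar>ext_integral (I_sub I \<nu> x) h\<bar>) powr p \<le> (omega x * (N * indicator (I_sub_star I \<nu> z) x)) powr p"
        using x Fle[OF x(2)] p1 by (intro powr_mono2 mult_left_mono) auto
      also have "\<dots> = N powr p * (omega x powr p * indicator (I_sub_star I \<nu> z) x)"
        using x \<open>N \<ge> 0\<close> by (auto simp: indicator_def powr_mult mult.commute)
      finally show "ennreal ((omega x * \<bar>ext_integral (I_sub I \<nu> x) h\<bar>) powr p)
         \<le> ennreal (N powr p) * (ennreal (omega x powr p) * indicator (I_sub_star I \<nu> z) x)"
        by (auto simp: indicator_def ennreal_mult[symmetric] ennreal_leI)
    qed
  qed
  also have "\<dots> = ennreal (N powr p) * (\<integral>\<^sup>+x. ennreal (omega x powr p) * indicator (I_sub_star I \<nu> z) x \<partial>lebesgue_on I)"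
    using I_sub_subset(2)[of z] by (intro nn_integral_cmult borel_measurable_times_ennreal borel_measurable_indicator)
      (auto simp: sets_restrict_space_iff)
  also have "\<dots> \<le> ennreal (N powr p) * (\<integral>\<^sup>+x. ennreal (omega x powr p) * indicator (I_sub_star I \<nu> z) x \<partial>lebesgue)"
    by (intro mult_left_mono) (auto simp: nn_integral_restrict_space indicator_def intro!: nn_integral_mono)
  also have "\<dots> < \<infinity>" using omega_tail[OF zI] by (simp add: ennreal_mult_less_top)
  finally have "(\<integral>\<^sup>+x. ennreal ((omega x * \<bar>ext_integral (I_sub I \<nu> x) h\<bar>) powr p) \<partial>lebesgue_on I) < \<infinity>" .
  then have "Ch_norm I \<nu> p w h < \<infinity>"
    unfolding Ch_norm_eq ennpowr_def by (auto simp: less_top)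
  then show "h \<in> Ch_space I \<nu> p w" using L by (simp add: Ch_space_def)
qed

text \<open>
  The indicator of \<open>{a..b}\<close> is a test function.
\<close>

lemma g_real_loc_integrable:
  assumes "a \<in> I" "b \<in> I"
  shows "g_real absolutely_integrable_on {a..b}" and "AE x in lebesgue_on {a..b}. g x = ereal (g_real x)"
proof -
  define h where "h x = ereal (indicator {a..b} x * 1)" for x
  have "h \<in> Ch_space I \<nu> p w"
    unfolding h_def by (rule test_function(1)[OF assms]) auto
  then have "ext_integrable_on (\<lambda>x. h x * g x) I" by (rule J_bound(1))
  then have fin: "(\<integral>\<^sup>+ x. e2ennreal \<bar>h x * g x\<bar> \<partial>lebesgue_on I) < \<infinity>" by (simp add: ext_integrable_on_def)
  have sub: "{a..b} \<subseteq> I" by (rule I_Icc[OF assms])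
  have gm: "g \<in> borel_measurable (lebesgue_on {a..b})"
    using g_meas measurable_restrict_mono[OF _ sub] by (auto simp: measurable_funs_def)
  have "(\<integral>\<^sup>+ x. e2ennreal \<bar>g x\<bar> \<partial>lebesgue_on {a..b}) \<le> (\<integral>\<^sup>+ x. e2ennreal \<bar>h x * g x\<bar> \<partial>lebesgue_on I)"
    using sub by (auto simp: nn_integral_restrict_space h_def indicator_def one_ereal_def[symmetric] intro!: nn_integral_mono)
  with fin have fin2: "(\<integral>\<^sup>+ x. e2ennreal \<bar>g x\<bar> \<partial>lebesgue_on {a..b}) < \<infinity>" by (rule le_less_trans[rotated])
  have "AE x in lebesgue_on {a..b}. e2ennreal \<bar>g x\<bar> \<noteq> \<infinity>"
    using fin2 gm by (intro nn_integral_noteq_infinite) auto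
  then show "AE x in lebesgue_on {a..b}. g x = ereal (g_real x)"
  proof eventually_elim
    fix x assume "e2ennreal \<bar>g x\<bar> \<noteq> \<infinity>"
    then show "g x = ereal (g_real x)" by (cases "g x") (auto simp: g_real_def e2ennreal_infty)
  qed
  have "integrable (lebesgue_on {a..b}) g_real"
  proof (rule integrableI_bounded)
    show "g_real \<in> borel_measurable (lebesgue_on {a..b})"
      unfolding g_real_def[abs_def] by (rule borel_measurable_real_of_ereal[OF gm])
    have le: "ennreal (norm (g_real y)) \<le> e2ennreal \<bar>g y\<bar>" for y
      by (cases "g y") (auto simp: g_real_def e2ennreal_ereal)
    have "(\<integral>\<^sup>+ x. ennreal (norm (g_real x)) \<partial>lebesgue_on {a..b}) \<le> (\<integral>\<^sup>+ x. e2ennreal \<bar>g x\<bar> \<partial>lebesgue_on {a..b})"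
      by (intro nn_integral_mono le)
    then show "(\<integral>\<^sup>+ x. ennreal (norm (g_real x)) \<partial>lebesgue_on {a..b}) < \<infinity>" using fin2 by (rule le_less_trans)
  qed
  then show "g_real absolutely_integrable_on {a..b}" by (simp add: integrable_restrict_space set_integrable_def)
qed

lemma g_real_ae: "AE x in lebesgue_on I. g x = ereal (g_real x)"
  unfolding I
proof (rule AE_lebesgue_on_einterval[OF cd])
  fix s t :: real assume st: "s < t" "{s..t} \<subseteq> einterval c d"
  then have "s \<in> I" "t \<in> I" by (auto simp: I)
  then have "AE x in lebesgue_on {s..t}. g x = ereal (g_real x)" by (rule g_real_loc_integrable(2))
  then have "AE x in lebesgue. x \<in> {s..t} \<longrightarrow> g x = ereal (g_real x)" by (simp add: AE_restrict_space_iff)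
  then obtain N where "{x \<in> space lebesgue. \<not> (x \<in> {s..t} \<longrightarrow> g x = ereal (g_real x))} \<subseteq> N" "N \<in> null_sets lebesgue"
    unfolding eventually_ae_filter by blast
  then have "negligible N" "{x \<in> {s<..<t}. g x \<noteq> ereal (g_real x)} \<subseteq> N" by (auto simp: negligible_iff_null_sets)
  then show "negligible {x \<in> {s<..<t}. g x \<noteq> ereal (g_real x)}" by (rule negligible_subset)
qed

text \<open>
  With \<open>H b = 0\<close> the norm of the test function sees the weight on \<open>{a..b}\<close> only.
\<close>

lemma test_bound:
  fixes u H :: "real \<Rightarrow> real"
  assumes ab: "a \<in> I" "b \<in> I" "a \<le> b" and u: "u absolutely_integrable_on {a..b}"
    and H: "\<And>x. x \<in> {a..b} \<Longrightarrow> (u has_integral H x) {a..x}" and Hb: "H b = 0"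
    and ug: "(\<lambda>x. u x * g_real x) absolutely_integrable_on {a..b}"
  shows "ennreal \<bar>integral {a..b} (\<lambda>x. u x * g_real x)\<bar>
     \<le> ennreal C * ennpowr (\<integral>\<^sup>+x. ennreal ((omega x * \<bar>H x\<bar>) powr p) * indicator {a..b} x \<partial>lebesgue) (1 / p)"
proof -
  define h where "h x = ereal (indicator {a..b} x * u x)" for x
  have hC: "h \<in> Ch_space I \<nu> p w" and F: "\<And>x. ext_integral (I_sub I \<nu> x) h = (LINT y:I_sub I \<nu> x \<inter> {a..b}|lebesgue. u y)"
    unfolding h_def by (rule test_function[OF ab(1,2) u])+
  have sub: "{a..b} \<subseteq> I" by (rule I_Icc[OF ab(1,2)])
  have FH: "\<bar>ext_integral (I_sub I \<nu> x) h\<bar> = \<bar>H x\<bar> * indicator {a..b} x" if "x \<in> I" for x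
    unfolding F by (rule I_sub_integral_compact_support[OF ab u H Hb that])
  have "Ch_norm I \<nu> p w h = ennpowr (\<integral>\<^sup>+x. ennreal ((omega x * \<bar>H x\<bar>) powr p) * indicator {a..b} x \<partial>lebesgue) (1 / p)"
    unfolding Ch_norm_eq
  proof (rule arg_cong[where f = "\<lambda>z. ennpowr z (1 / p)"])
    show "(\<integral>\<^sup>+x. ennreal ((omega x * \<bar>ext_integral (I_sub I \<nu> x) h\<bar>) powr p) \<partial>lebesgue_on I)
       = (\<integral>\<^sup>+x. ennreal ((omega x * \<bar>H x\<bar>) powr p) * indicator {a..b} x \<partial>lebesgue)"
      unfolding nn_integral_restrict_space[of I lebesgue, simplified]
    proof (rule nn_integral_cong)
      fix x
      show "ennreal ((omega x * \<bar>ext_integral (I_sub I \<nu> x) h\<bar>) powr p) * indicator I x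
          = ennreal ((omega x * \<bar>H x\<bar>) powr p) * indicator {a..b} x"
      proof (cases "x \<in> I")
        case True
        then show ?thesis by (simp add: FH indicator_def)
      next
        case False
        then show ?thesis using sub by (auto simp: indicator_def)
      qed
    qed
  qed
  moreover have "ext_integral I (\<lambda>x. h x * g x) = integral {a..b} (\<lambda>x. u x * g_real x)"
  proof -
    have m: "(\<lambda>x. indicator {a..b} x * (u x * g_real x)) \<in> borel_measurable lebesgue"
      using ug by (auto simp: set_integrable_def)
    have hm: "(\<lambda>x. h x * g x) \<in> borel_measurable (lebesgue_on I)"
      using J_bound(1)[OF hC] by (simp add: ext_integrable_on_def)
    have "ext_integral I (\<lambda>x. h x * g x) = (\<integral>x. indicator {a..b} x * (u x * g_real x) \<partial>lebesgue_on I)"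
      unfolding ext_integral_def
    proof (rule integral_cong_AE)
      show "(\<lambda>x. real_of_ereal (h x * g x)) \<in> borel_measurable (lebesgue_on I)"
        by (rule borel_measurable_real_of_ereal[OF hm])
      show "(\<lambda>x. indicator {a..b} x * (u x * g_real x)) \<in> borel_measurable (lebesgue_on I)"
        by (rule measurable_restrict_space1[OF m])
      show "AE x in lebesgue_on I. real_of_ereal (h x * g x) = indicator {a..b} x * (u x * g_real x)"
        using g_real_ae by eventually_elim (auto simp: h_def g_real_def)
    qed
    also have "\<dots> = (LINT x:{a..b}|lebesgue. u x * g_real x)"
      using sub unfolding set_lebesgue_integral_def
      by (subst integral_restrict_space) (auto intro!: Bochner_Integration.integral_cong simp: indicator_def)
    also have "\<dots> = integral {a..b} (\<lambda>x. u x * g_real x)"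
      by (rule set_lebesgue_integral_eq_integral(2)[OF ug])
    finally show ?thesis .
  qed
  ultimately show ?thesis using J_bound(2)[OF hC] by simp
qed

end

lemma has_integral_indicator_Icc:
  assumes "a \<le> s"
  shows "(indicat_real {s..r} has_integral max 0 (min r x - s)) {a..x}"
proof -
  have eq: "{s..r} \<inter> {a..x} = {s..min r x}" using assms by auto
  have "((\<lambda>_. 1::real) has_integral max 0 (min r x - s)) {s..min r x}"
    using has_integral_const_real[of "1::real" s "min r x"] by (auto simp: max_def min_def)
  then have "((\<lambda>y. if y \<in> {s..r} then 1 else 0 :: real) has_integral max 0 (min r x - s)) {a..x}"
    by (subst has_integral_restrict_Int) (simp only: eq)
  moreover have "indicat_real {s..r} = (\<lambda>y. if y \<in> {s..r} then 1 else 0)" by (simp add: fun_eq_iff indicator_def)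
  ultimately show ?thesis by simp
qed

text \<open>
  The difference of two approximate point masses, at \<open>s\<close> and at \<open>t\<close>, both placed inside \<open>{s..t}\<close> so
  that the primitive, a trapezoid, stays below the indicator of the open interval.
\<close>

definition bump :: "real \<Rightarrow> real \<Rightarrow> real \<Rightarrow> real \<Rightarrow> real" where
  "bump \<delta> s t x = (indicator {s..s + \<delta>} x - indicator {t - \<delta>..t} x) / \<delta>"

definition trapezoid :: "real \<Rightarrow> real \<Rightarrow> real \<Rightarrow> real \<Rightarrow> real" where
  "trapezoid \<delta> s t x = (max 0 (min (s + \<delta>) x - s) - max 0 (min t x - (t - \<delta>))) / \<delta>"

lemma bump_has_integral:
  assumes "a \<le> s" "s \<le> t - \<delta>"
  shows "(bump \<delta> s t has_integral trapezoid \<delta> s t x) {a..x}"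
  unfolding bump_def[abs_def] trapezoid_def
  by (intro has_integral_divide has_integral_diff has_integral_indicator_Icc) (use assms in auto)

lemma trapezoid_bound:
  assumes "0 < \<delta>" "s + \<delta> \<le> t - \<delta>"
  shows "\<bar>trapezoid \<delta> s t x\<bar> \<le> indicator {s<..<t} x"
proof -
  have "\<bar>max 0 (min (s + \<delta>) x - s) - max 0 (min t x - (t - \<delta>))\<bar> \<le> \<delta> * indicator {s<..<t} x"
    using assms by (auto simp: indicator_def max_def min_def)
  then show ?thesis using assms by (simp add: trapezoid_def abs_divide pos_divide_le_eq mult.commute)
qed

lemma difference_quotients_tendsto:
  fixes G :: "real \<Rightarrow> real"
  assumes "(G has_real_derivative D) (at x)"
  shows "(\<lambda>m. (G (x + 1 / real (Suc m)) - G x) / (1 / real (Suc m))) \<longlonglongrightarrow> D"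
    and "(\<lambda>m. (G x - G (x - 1 / real (Suc m))) / (1 / real (Suc m))) \<longlonglongrightarrow> D"
proof -
  have lim: "((\<lambda>h. (G (x + h) - G x) / h) \<longlongrightarrow> D) (at 0)" using assms by (simp add: DERIV_def)
  have z: "(\<lambda>m. 1 / real (Suc m)) \<longlonglongrightarrow> 0" by (rule LIMSEQ_Suc[OF lim_1_over_n])
  have 1: "filterlim (\<lambda>m. 1 / real (Suc m)) (at 0) sequentially"
    unfolding filterlim_at using z by (auto simp del: of_nat_Suc)
  have 2: "filterlim (\<lambda>m. - (1 / real (Suc m))) (at 0) sequentially"
    unfolding filterlim_at using tendsto_minus[OF z] by (auto simp del: of_nat_Suc)
  show "(\<lambda>m. (G (x + 1 / real (Suc m)) - G x) / (1 / real (Suc m))) \<longlonglongrightarrow> D"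
    using filterlim_compose[OF lim 1] by simp
  have "(\<lambda>m. (G (x + - (1 / real (Suc m))) - G x) / - (1 / real (Suc m))) \<longlonglongrightarrow> D"
    using filterlim_compose[OF lim 2] .
  then show "(\<lambda>m. (G x - G (x - 1 / real (Suc m))) / (1 / real (Suc m))) \<longlonglongrightarrow> D"
    by (rule Lim_transform_eventually) (auto intro!: always_eventually simp: field_simps)
qed

lemma loc_integrable_antiderivative:
  fixes f :: "real \<Rightarrow> real"
  assumes x0: "x0 \<in> einterval c d"
    and int: "\<And>s t. s \<in> einterval c d \<Longrightarrow> t \<in> einterval c d \<Longrightarrow> f integrable_on {s..t}"
  obtains F where "\<And>s t. s \<le> t \<Longrightarrow> {s..t} \<subseteq> einterval c d \<Longrightarrow> F t - F s = integral {s..t} f"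
proof -
  define F where "F x = (if x0 \<le> x then integral {x0..x} f else - integral {x..x0} f)" for x
  show thesis
  proof (rule that[of F])
    fix s t :: real assume st: "s \<le> t" "{s..t} \<subseteq> einterval c d"
    have sI: "s \<in> einterval c d" "t \<in> einterval c d" using st by auto
    have comb: "integral {x..y} f + integral {y..z} f = integral {x..z} f"
      if "x \<le> y" "y \<le> z" "x \<in> einterval c d" "z \<in> einterval c d" for x y z
      using that by (intro Henstock_Kurzweil_Integration.integral_combine int)
    consider "x0 \<le> s" | "s < x0" "x0 \<le> t" | "t < x0" by linarith
    then show "F t - F s = integral {s..t} f"
    proof cases
      case 1
      then show ?thesis using comb[of x0 s t] st x0 sI by (simp add: F_def)
    next
      case 2
      then show ?thesis using comb[of s x0 t] st x0 sI by (simp add: F_def)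
    next
      case 3
      then show ?thesis using comb[of s t x0] st x0 sI by (auto simp: F_def)
    qed
  qed
qed

context cesaro_copson_dual begin

definition mu :: "real \<Rightarrow> real \<Rightarrow> real" where "mu s t = integral {s..t} (\<lambda>x. omega x powr p)"

lemma mu_nonneg: "0 \<le> mu s t"
  unfolding mu_def by (cases "(\<lambda>x. omega x powr p) integrable_on {s..t}")
    (auto intro: Henstock_Kurzweil_Integration.integral_nonneg simp: not_integrable_integral)

lemma mu_combine:
  assumes "r \<in> I" "t \<in> I" "r \<le> s" "s \<le> t"
  shows "mu r s + mu s t = mu r t"
  unfolding mu_def using assms omega_powr_loc[OF assms(1,2)]
  by (intro Henstock_Kurzweil_Integration.integral_combine) (auto simp: absolutely_integrable_on_def)

lemma mu_mono:
  assumes "r \<in> I" "t \<in> I" "r \<le> r'" "r' \<le> t'" "t' \<le> t"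
  shows "mu r' t' \<le> mu r t"
proof -
  have "r' \<in> I" using I_Icc[OF assms(1,2)] assms by auto
  have "mu r r' + mu r' t = mu r t" using mu_combine[of r t r'] assms by auto
  moreover have "mu r' t' + mu t' t = mu r' t" using mu_combine[of r' t t'] assms \<open>r' \<in> I\<close> by auto
  ultimately show ?thesis using mu_nonneg[of r r'] mu_nonneg[of t' t] by linarith
qed

lemma mu_nn_integral:
  assumes "s \<in> I" "t \<in> I"
  shows "(\<integral>\<^sup>+x. ennreal (omega x powr p) * indicator {s<..<t} x \<partial>lebesgue) = ennreal (mu s t)"
proof -
  have ai: "(\<lambda>x. omega x powr p) absolutely_integrable_on {s<..<t}"
    by (rule set_integrable_subset[OF omega_powr_loc[OF assms]]) auto
  have "mu s t = integral {s<..<t} (\<lambda>x. omega x powr p)"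
    unfolding mu_def by (rule integral_open_interval_real)
  also have "\<dots> = (\<integral>x. indicator {s<..<t} x * omega x powr p \<partial>lebesgue)"
    using set_lebesgue_integral_eq_integral(2)[OF ai] by (simp add: set_lebesgue_integral_def)
  finally have "ennreal (mu s t) = (\<integral>\<^sup>+x. ennreal (indicator {s<..<t} x * omega x powr p) \<partial>lebesgue)"
    using ai by (simp add: nn_integral_eq_integral set_integrable_def)
  also have "\<dots> = (\<integral>\<^sup>+x. ennreal (omega x powr p) * indicator {s<..<t} x \<partial>lebesgue)"
    by (intro nn_integral_cong) (auto simp: indicator_def)
  finally show ?thesis by simp
qed

text \<open>
  The test function is \<open>\<Sum> \<alpha> i\<close> times the bump on \<open>{s i..t i}\<close>. Its primitive is at most \<open>\<bar>\<alpha> i\<bar>\<close> on the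
  \<open>i\<close>-th interval and \<open>0\<close> elsewhere, and as the bumps concentrate, its integral against
  \<open>g_real\<close> tends to \<open>\<Sum> \<alpha> i (g_real (s i) - g_real (t i))\<close>, because the endpoints are points where the
  primitive \<open>G\<close> of \<open>g_real\<close> has derivative \<open>g_real\<close>.
\<close>

lemma sum_bound_at_Lebesgue_points:
  fixes \<alpha> s t :: "'i \<Rightarrow> real"
  assumes G: "\<And>s t. s \<le> t \<Longrightarrow> {s..t} \<subseteq> I \<Longrightarrow> G t - G s = integral {s..t} g_real"
    and fin: "finite S" and ab: "a \<in> I" "b \<in> I" "a \<le> b"
    and st: "\<And>i. i \<in> S \<Longrightarrow> a \<le> s i \<and> s i < t i \<and> t i \<le> b"
    and dj: "\<And>i j. i \<in> S \<Longrightarrow> j \<in> S \<Longrightarrow> i \<noteq> j \<Longrightarrow> {s i<..<t i} \<inter> {s j<..<t j} = {}"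
    and E: "\<And>i. i \<in> S \<Longrightarrow> (G has_real_derivative g_real (s i)) (at (s i)) \<and> (G has_real_derivative g_real (t i)) (at (t i))"
  shows "\<bar>\<Sum>i\<in>S. \<alpha> i * (g_real (t i) - g_real (s i))\<bar> \<le> C * (\<Sum>i\<in>S. \<bar>\<alpha> i\<bar> powr p * mu (s i) (t i)) powr (1 / p)"
proof -
  define R where "R = (\<Sum>i\<in>S. \<bar>\<alpha> i\<bar> powr p * mu (s i) (t i))"
  have "R \<ge> 0" unfolding R_def by (intro sum_nonneg mult_nonneg_nonneg mu_nonneg) auto
  have sub: "{a..b} \<subseteq> I" by (rule I_Icc[OF ab(1,2)])
  have stI: "s i \<in> I" "t i \<in> I" if "i \<in> S" for i using sub st[OF that] by auto
  define \<delta> where "\<delta> m = 1 / real (Suc m)" for m :: nat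
  have \<delta>pos: "0 < \<delta> m" for m by (simp add: \<delta>_def)
  have \<delta>0: "\<delta> \<longlonglongrightarrow> 0" unfolding \<delta>_def[abs_def] by (rule LIMSEQ_Suc[OF lim_1_over_n])
  define X where "X m = (\<Sum>i\<in>S. \<alpha> i * ((G (s i + \<delta> m) - G (s i)) / \<delta> m - (G (t i) - G (t i - \<delta> m)) / \<delta> m))" for m
  have bound: "\<bar>X m\<bar> \<le> C * R powr (1 / p)" if m: "\<And>i. i \<in> S \<Longrightarrow> s i + \<delta> m \<le> t i - \<delta> m" for m
  proof -
    define u where "u x = (\<Sum>i\<in>S. \<alpha> i * bump (\<delta> m) (s i) (t i) x)" for x
    define H where "H x = (\<Sum>i\<in>S. \<alpha> i * trapezoid (\<delta> m) (s i) (t i) x)" for x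
    have le: "s i \<le> t i - \<delta> m" if "i \<in> S" for i using m[OF that] \<delta>pos[of m] by linarith
    have tz: "\<bar>trapezoid (\<delta> m) (s i) (t i) x\<bar> \<le> indicator {s i<..<t i} x" if "i \<in> S" for i x
      by (rule trapezoid_bound[OF \<delta>pos m[OF that]])
    have uH: "(u has_integral H x) {a..x}" for x
      unfolding u_def[abs_def] H_def
      by (intro has_integral_sum fin has_integral_mult_right bump_has_integral le) (use st in auto)
    have Hb: "H b = 0"
      unfolding H_def
    proof (rule sum.neutral, rule ballI)
      fix i assume "i \<in> S"
      then have "\<bar>trapezoid (\<delta> m) (s i) (t i) b\<bar> \<le> 0" using tz[of i b] st[of i] by (simp add: indicator_def)
      then show "\<alpha> i * trapezoid (\<delta> m) (s i) (t i) b = 0" by simp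
    qed
    have indmult: "(\<lambda>x. indicat_real {y..z} x * f x) absolutely_integrable_on {a..b}"
      if f: "f absolutely_integrable_on {a..b}" for f y z
    proof (rule absolutely_integrable_bounded_measurable_product_real[OF _ _ _ f])
      show "indicat_real {y..z} \<in> borel_measurable (lebesgue_on {a..b})"
        by (intro measurable_restrict_space1 borel_measurable_indicator) simp
      have "indicat_real {y..z} ` {a..b} \<subseteq> {0,1}" by (auto simp: indicator_def)
      then show "bounded (indicat_real {y..z} ` {a..b})" by (rule bounded_subset[rotated]) simp
    qed simp
    note indgr = indmult[OF g_real_loc_integrable(1)[OF ab(1,2)]]
    have indint: "indicat_real {y..z} absolutely_integrable_on {a..b}" for y z
      using indmult[of "\<lambda>_. 1" y z] absolutely_integrable_on_const[of "{a..b}" "1::real"] by simp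
    have ua: "u absolutely_integrable_on {a..b}"
      unfolding u_def[abs_def] bump_def
      by (intro absolutely_integrable_sum fin set_integrable_mult_right set_integrable_divide set_integral_diff indint)
    have ug_eq: "(\<lambda>x. u x * g_real x) = (\<lambda>x. \<Sum>i\<in>S. \<alpha> i * ((indicat_real {s i..s i + \<delta> m} x * g_real x - indicat_real {t i - \<delta> m..t i} x * g_real x) / \<delta> m))"
      unfolding u_def sum_distrib_right
      by (rule ext, rule sum.cong[OF refl]) (simp add: bump_def algebra_simps diff_divide_distrib)
    have ug: "(\<lambda>x. u x * g_real x) absolutely_integrable_on {a..b}"
      unfolding ug_eq
      by (intro absolutely_integrable_sum fin set_integrable_mult_right set_integrable_divide set_integral_diff indgr)
    have seg: "((\<lambda>x. indicat_real {y..z} x * g_real x) has_integral (G z - G y)) {a..b}"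
      if "a \<le> y" "y \<le> z" "z \<le> b" for y z
    proof -
      have yz: "y \<in> I" "z \<in> I" using subsetD[OF sub] that by auto
      have "g_real integrable_on {y..z}" using g_real_loc_integrable(1)[OF yz] by (simp add: absolutely_integrable_on_def)
      then have "(g_real has_integral (G z - G y)) {y..z}" using G[of y z] that I_Icc[OF yz] by (simp add: has_integral_integral)
      moreover have "{y..z} \<inter> {a..b} = {y..z}" using that by auto
      ultimately have "((\<lambda>x. if x \<in> {y..z} then g_real x else 0) has_integral (G z - G y)) {a..b}"
        by (simp only: has_integral_restrict_Int)
      moreover have "(\<lambda>x. if x \<in> {y..z} then g_real x else 0) = (\<lambda>x. indicat_real {y..z} x * g_real x)"
        by (simp add: fun_eq_iff indicator_def)
      ultimately show ?thesis by simp
    qed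
    have "((\<lambda>x. u x * g_real x) has_integral X m) {a..b}"
      unfolding ug_eq X_def diff_divide_distrib[symmetric]
    proof (intro has_integral_sum fin has_integral_mult_right has_integral_divide has_integral_diff seg)
      fix i assume "i \<in> S"
      then show "a \<le> s i" "s i \<le> s i + \<delta> m" "s i + \<delta> m \<le> b" "a \<le> t i - \<delta> m" "t i - \<delta> m \<le> t i" "t i \<le> b"
        using st[of i] m[of i] \<delta>pos[of m] le[of i] by linarith+
    qed
    then have XI: "integral {a..b} (\<lambda>x. u x * g_real x) = X m" by (rule integral_unique)
    have "(\<integral>\<^sup>+x. ennreal ((omega x * \<bar>H x\<bar>) powr p) * indicator {a..b} x \<partial>lebesgue)
       \<le> (\<integral>\<^sup>+x. (\<Sum>i\<in>S. ennreal (\<bar>\<alpha> i\<bar> powr p) * (ennreal (omega x powr p) * indicator {s i<..<t i} x)) \<partial>lebesgue)"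
    proof (rule nn_integral_mono_AE)
      have "AE x in lebesgue. x \<in> I \<longrightarrow> 0 < omega x \<and> w x = ereal (omega x)"
        using omega_ae by (rule AE_on_I_iff[THEN iffD1])
      then show "AE x in lebesgue. ennreal ((omega x * \<bar>H x\<bar>) powr p) * indicator {a..b} x
         \<le> (\<Sum>i\<in>S. ennreal (\<bar>\<alpha> i\<bar> powr p) * (ennreal (omega x powr p) * indicator {s i<..<t i} x))"
      proof eventually_elim
        fix x assume x: "x \<in> I \<longrightarrow> 0 < omega x \<and> w x = ereal (omega x)"
        show "ennreal ((omega x * \<bar>H x\<bar>) powr p) * indicator {a..b} x
         \<le> (\<Sum>i\<in>S. ennreal (\<bar>\<alpha> i\<bar> powr p) * (ennreal (omega x powr p) * indicator {s i<..<t i} x))"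
        proof (cases "x \<in> {a..b} \<and> (\<exists>k\<in>S. x \<in> {s k<..<t k})")
          case False
          have "H x = 0" if "x \<in> {a..b}"
            unfolding H_def
          proof (rule sum.neutral, rule ballI)
            fix i assume "i \<in> S"
            then show "\<alpha> i * trapezoid (\<delta> m) (s i) (t i) x = 0" using tz[of i x] False that by auto
          qed
          then show ?thesis by (cases "x \<in> {a..b}") auto
        next
          case True
          then obtain k where k: "k \<in> S" "x \<in> {s k<..<t k}" "x \<in> {a..b}" by blast
          have om: "0 < omega x" using x sub k(3) by blast
          have "H x = \<alpha> k * trapezoid (\<delta> m) (s k) (t k) x"
          proof -
            have "(\<Sum>i\<in>S - {k}. \<alpha> i * trapezoid (\<delta> m) (s i) (t i) x) = 0"
            proof (rule sum.neutral, rule ballI)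
              fix i assume i: "i \<in> S - {k}"
              then have "x \<notin> {s i<..<t i}" using dj[of i k] k by blast
              then show "\<alpha> i * trapezoid (\<delta> m) (s i) (t i) x = 0" using tz[of i x] i by auto
            qed
            then show ?thesis unfolding H_def sum.remove[OF fin k(1)] by simp
          qed
          then have "\<bar>H x\<bar> \<le> \<bar>\<alpha> k\<bar> * 1"
            using tz[OF k(1), of x] k(2) by (simp only: abs_mult) (intro mult_left_mono, auto)
          then have "(omega x * \<bar>H x\<bar>) powr p \<le> (omega x * \<bar>\<alpha> k\<bar>) powr p"
            using om p1 by (intro powr_mono2 mult_left_mono) auto
          also have "\<dots> = \<bar>\<alpha> k\<bar> powr p * omega x powr p" using om by (simp add: powr_mult mult.commute)
          finally have "ennreal ((omega x * \<bar>H x\<bar>) powr p) * indicator {a..b} x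
              \<le> ennreal (\<bar>\<alpha> k\<bar> powr p) * (ennreal (omega x powr p) * indicator {s k<..<t k} x)"
            using k by (simp add: ennreal_mult[symmetric] ennreal_leI)
          also have "\<dots> \<le> (\<Sum>i\<in>S. ennreal (\<bar>\<alpha> i\<bar> powr p) * (ennreal (omega x powr p) * indicator {s i<..<t i} x))"
            by (rule member_le_sum[OF k(1) _ fin]) simp
          finally show ?thesis .
        qed
      qed
    qed
    also have "\<dots> = (\<Sum>i\<in>S. ennreal (\<bar>\<alpha> i\<bar> powr p) * ennreal (mu (s i) (t i)))"
    proof -
      have m: "(\<lambda>x. ennreal (omega x powr p) * indicator {s i<..<t i} x) \<in> borel_measurable lebesgue" if "i \<in> S" for i
      proof -
        have "{s i<..<t i} \<subseteq> {s i..t i}" "{s i..t i} \<subseteq> I" using stI[OF that] by (auto intro: subsetD[OF I_Icc])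
        then have "{s i<..<t i} \<subseteq> I" by blast
        then have "omega \<in> borel_measurable (lebesgue_on {s i<..<t i})" by (rule measurable_restrict_mono[OF omega_meas])
        then have "(\<lambda>x. ennreal (omega x powr p)) \<in> borel_measurable (lebesgue_on {s i<..<t i})" by measurable
        then show ?thesis by (subst (asm) borel_measurable_restrict_space_iff_ennreal) auto
      qed
      show ?thesis
        using m by (subst nn_integral_sum) (auto simp: nn_integral_cmult mu_nn_integral stI intro!: sum.cong)
    qed
    also have "\<dots> = ennreal R"
      unfolding R_def by (subst sum_ennreal[symmetric]) (auto simp: ennreal_mult mu_nonneg)
    finally have nn: "(\<integral>\<^sup>+x. ennreal ((omega x * \<bar>H x\<bar>) powr p) * indicator {a..b} x \<partial>lebesgue) \<le> ennreal R" .
    have "ennreal \<bar>X m\<bar> \<le> ennreal C * ennpowr (\<integral>\<^sup>+x. ennreal ((omega x * \<bar>H x\<bar>) powr p) * indicator {a..b} x \<partial>lebesgue) (1 / p)"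
      using test_bound[OF ab ua uH Hb ug] by (simp only: XI)
    also have "\<dots> \<le> ennreal C * ennreal (R powr (1 / p))"
    proof (rule mult_left_mono)
      obtain r where r: "(\<integral>\<^sup>+x. ennreal ((omega x * \<bar>H x\<bar>) powr p) * indicator {a..b} x \<partial>lebesgue) = ennreal r" "0 \<le> r"
        using nn by (cases "\<integral>\<^sup>+x. ennreal ((omega x * \<bar>H x\<bar>) powr p) * indicator {a..b} x \<partial>lebesgue") (auto simp: top_unique)
      then have "r \<le> R" using nn \<open>R \<ge> 0\<close> by simp
      then have "r powr (1 / p) \<le> R powr (1 / p)" using r p1 by (intro powr_mono2) auto
      then show "ennpowr (\<integral>\<^sup>+x. ennreal ((omega x * \<bar>H x\<bar>) powr p) * indicator {a..b} x \<partial>lebesgue) (1 / p) \<le> ennreal (R powr (1 / p))"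
        by (simp add: r ennpowr_ennreal ennreal_leI)
    qed simp
    also have "\<dots> = ennreal (C * R powr (1 / p))" using C_nonneg by (simp add: ennreal_mult)
    finally show ?thesis using C_nonneg by (simp add: ennreal_le_iff)
  qed
  have "X \<longlonglongrightarrow> (\<Sum>i\<in>S. \<alpha> i * (g_real (s i) - g_real (t i)))"
    unfolding X_def[abs_def] \<delta>_def
    by (intro tendsto_sum tendsto_mult tendsto_const tendsto_diff difference_quotients_tendsto) (use E in auto)
  then have lim: "(\<lambda>m. \<bar>X m\<bar>) \<longlonglongrightarrow> \<bar>\<Sum>i\<in>S. \<alpha> i * (g_real (s i) - g_real (t i))\<bar>" by (rule tendsto_rabs)
  have "eventually (\<lambda>m. \<forall>i\<in>S. s i + \<delta> m \<le> t i - \<delta> m) sequentially"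
  proof (rule eventually_ball_finite[OF fin], rule ballI)
    fix i assume "i \<in> S"
    then have "0 < (t i - s i) / 2" using st by simp
    from order_tendstoD(2)[OF \<delta>0 this] show "eventually (\<lambda>m. s i + \<delta> m \<le> t i - \<delta> m) sequentially"
      by eventually_elim (simp add: field_simps)
  qed
  then have ev: "eventually (\<lambda>m. \<bar>X m\<bar> \<le> C * R powr (1 / p)) sequentially"
    by eventually_elim (rule bound, blast)
  have "\<bar>\<Sum>i\<in>S. \<alpha> i * (g_real (s i) - g_real (t i))\<bar> \<le> C * R powr (1 / p)"
    by (rule tendsto_upperbound[OF lim ev]) simp
  moreover have "(\<Sum>i\<in>S. \<alpha> i * (g_real (s i) - g_real (t i))) = - (\<Sum>i\<in>S. \<alpha> i * (g_real (t i) - g_real (s i)))"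
    by (simp add: sum_negf[symmetric] algebra_simps)
  ultimately show ?thesis by (simp add: R_def)
qed

end

section \<open>The absolutely continuous version\<close>

context cesaro_copson_dual begin

text \<open>
  The functional \<open>\<phi> \<mapsto> \<integral> \<phi> D\<gamma>\<close>, evaluated on step functions, has norm at most \<open>C\<close> on \<open>L\<^sup>p\<close> of the
  measure with density \<open>omega powr p\<close>; the index type is \<^typ>\<open>nat\<close> because a definition cannot
  quantify over types.
\<close>

definition dual_bound :: "(real \<Rightarrow> real) \<Rightarrow> bool" where
  "dual_bound \<gamma> \<longleftrightarrow> (\<forall>(S :: nat set) \<alpha> s t a b. finite S \<and> a \<in> I \<and> b \<in> I \<and> a \<le> b \<and>
     (\<forall>i\<in>S. a \<le> s i \<and> s i < t i \<and> t i \<le> b) \<and>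
     (\<forall>i\<in>S. \<forall>j\<in>S. i \<noteq> j \<longrightarrow> {s i<..<t i} \<inter> {s j<..<t j} = {}) \<longrightarrow>
     \<bar>\<Sum>i\<in>S. \<alpha> i * (\<gamma> (t i) - \<gamma> (s i))\<bar> \<le> C * (\<Sum>i\<in>S. \<bar>\<alpha> i\<bar> powr p * mu (s i) (t i)) powr (1 / p))"

lemma dual_boundD:
  assumes "dual_bound \<gamma>" "finite S" "a \<in> I" "b \<in> I" "a \<le> b"
    "\<And>i. i \<in> S \<Longrightarrow> a \<le> s i \<and> s i < t i \<and> t i \<le> b"
    "\<And>i j. i \<in> S \<Longrightarrow> j \<in> S \<Longrightarrow> i \<noteq> j \<Longrightarrow> {s i<..<t i} \<inter> {s j<..<t j} = {}"
  shows "\<bar>\<Sum>i\<in>(S :: nat set). \<alpha> i * (\<gamma> (t i) - \<gamma> (s i))\<bar> \<le> C * (\<Sum>i\<in>S. \<bar>\<alpha> i\<bar> powr p * mu (s i) (t i)) powr (1 / p)"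
  by (rule assms(1)[unfolded dual_bound_def, rule_format, of S a b]) (use assms(2-) in blast)

text \<open>
  With \<open>\<alpha> i = \<plusminus>1\<close> the bound controls the variation of \<open>\<gamma>\<close> over disjoint intervals by a power of the
  integral of the weight over them.
\<close>

lemma dual_bound_imp_AC_loc:
  assumes db: "dual_bound \<gamma>"
  shows "\<gamma> \<in> AC_loc I"
  unfolding AC_loc_def
proof (safe)
  fix a b assume ab: "a \<le> b" "{a..b} \<subseteq> I"
  then have abI: "a \<in> I" "b \<in> I" by auto
  show "abs_continuous_on_Icc a b \<gamma>"
    unfolding abs_continuous_on_Icc_def
  proof (intro allI impI)
    fix \<epsilon> :: real assume "0 < \<epsilon>"
    \<comment> \<open>chosen such that \<open>C * \<epsilon>' powr (1 / p) < \<epsilon>\<close>, also when \<open>C = 0\<close>\<close>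
    define \<epsilon>' where "\<epsilon>' = (\<epsilon> / (C + 1)) powr p"
    have "0 < \<epsilon>'" using \<open>0 < \<epsilon>\<close> C_nonneg by (simp add: \<epsilon>'_def)
    obtain \<delta> where "0 < \<delta>" and \<delta>: "\<forall>(n::nat) s t. (\<forall>i<n. a \<le> s i \<and> s i \<le> t i \<and> t i \<le> b) \<and>
        (\<forall>i<n. \<forall>j<n. i \<noteq> j \<longrightarrow> {s i<..<t i} \<inter> {s j<..<t j} = {}) \<and>
        (\<Sum>i<n. t i - s i) < \<delta> \<longrightarrow> (\<Sum>i<n. integral {s i..t i} (\<lambda>x. \<bar>omega x powr p\<bar>)) < \<epsilon>'"
      using sum_integral_disjoint_intervals_small[OF omega_powr_loc[OF abI] \<open>0 < \<epsilon>'\<close>] by (elim exE conjE)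
    show "\<exists>\<delta>>0. \<forall>(n::nat) s t. (\<forall>i<n. a \<le> s i \<and> s i \<le> t i \<and> t i \<le> b) \<and>
        (\<forall>i<n. \<forall>j<n. i \<noteq> j \<longrightarrow> {s i<..<t i} \<inter> {s j<..<t j} = {}) \<and>
        (\<Sum>i<n. t i - s i) < \<delta> \<longrightarrow> (\<Sum>i<n. \<bar>\<gamma> (t i) - \<gamma> (s i)\<bar>) < \<epsilon>"
    proof (intro exI[of _ \<delta>] conjI allI impI \<open>0 < \<delta>\<close>)
      fix n :: nat and s t
      assume st: "(\<forall>i<n. a \<le> s i \<and> s i \<le> t i \<and> t i \<le> b) \<and>
        (\<forall>i<n. \<forall>j<n. i \<noteq> j \<longrightarrow> {s i<..<t i} \<inter> {s j<..<t j} = {}) \<and> (\<Sum>i<n. t i - s i) < \<delta>"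
      define S where "S = {i. i < n \<and> s i < t i}"
      define \<alpha> where "\<alpha> i = sgn (\<gamma> (t i) - \<gamma> (s i))" for i
      have finS: "finite S" by (simp add: S_def)
      have sm: "(\<Sum>i<n. mu (s i) (t i)) < \<epsilon>'"
        using \<delta>[rule_format, of n s t] st by (simp add: mu_def)
      have "(\<Sum>i<n. \<bar>\<gamma> (t i) - \<gamma> (s i)\<bar>) = (\<Sum>i\<in>S. \<bar>\<gamma> (t i) - \<gamma> (s i)\<bar>)"
      proof (rule sum.mono_neutral_right)
        show "\<forall>i\<in>{..<n} - S. \<bar>\<gamma> (t i) - \<gamma> (s i)\<bar> = 0"
        proof
          fix i assume "i \<in> {..<n} - S"
          then have "i < n" "\<not> s i < t i" by (auto simp: S_def)
          moreover have "s i \<le> t i" using st \<open>i < n\<close> by blast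
          ultimately have "s i = t i" by linarith
          then show "\<bar>\<gamma> (t i) - \<gamma> (s i)\<bar> = 0" by simp
        qed
      qed (auto simp: S_def)
      also have "\<dots> = \<bar>\<Sum>i\<in>S. \<alpha> i * (\<gamma> (t i) - \<gamma> (s i))\<bar>"
        unfolding \<alpha>_def sgn_mult_self_eq by (simp add: mult.commute[of "sgn _"] abs_sgn[symmetric] sum_nonneg)
      also have "\<dots> \<le> C * (\<Sum>i\<in>S. \<bar>\<alpha> i\<bar> powr p * mu (s i) (t i)) powr (1 / p)"
        by (rule dual_boundD[OF db finS abI ab(1)]) (use st in \<open>auto simp: S_def\<close>)
      also have "\<dots> \<le> C * \<epsilon>' powr (1 / p)"
      proof (intro mult_left_mono powr_mono2 C_nonneg)
        have "(\<Sum>i\<in>S. \<bar>\<alpha> i\<bar> powr p * mu (s i) (t i)) \<le> (\<Sum>i\<in>S. mu (s i) (t i))"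
        proof (rule sum_mono)
          fix i
          have "\<bar>\<alpha> i\<bar> powr p \<le> 1" using p1 by (auto simp: \<alpha>_def sgn_if)
          then show "\<bar>\<alpha> i\<bar> powr p * mu (s i) (t i) \<le> mu (s i) (t i)"
            using mult_right_mono[OF _ mu_nonneg] by fastforce
        qed
        also have "\<dots> \<le> (\<Sum>i<n. mu (s i) (t i))" by (rule sum_mono2) (auto simp: S_def mu_nonneg)
        finally show "(\<Sum>i\<in>S. \<bar>\<alpha> i\<bar> powr p * mu (s i) (t i)) \<le> \<epsilon>'" using sm by linarith
        show "0 \<le> (\<Sum>i\<in>S. \<bar>\<alpha> i\<bar> powr p * mu (s i) (t i))"
          by (intro sum_nonneg mult_nonneg_nonneg mu_nonneg) auto
        show "0 \<le> 1 / p" using p1 by simp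
      qed
      also have "\<epsilon>' powr (1 / p) = \<epsilon> / (C + 1)"
        using p1 \<open>0 < \<epsilon>\<close> C_nonneg by (simp add: \<epsilon>'_def powr_powr)
      also have "C * (\<epsilon> / (C + 1)) < \<epsilon>" using \<open>0 < \<epsilon>\<close> C_nonneg by (simp add: field_simps)
      finally show "(\<Sum>i<n. \<bar>\<gamma> (t i) - \<gamma> (s i)\<bar>) < \<epsilon>" .
    qed
  qed
qed

text \<open>
  Let \<open>E\<close> be the set of points where the primitive of \<open>g_real\<close> has derivative \<open>g_real\<close>; its complement is
  negligible. On \<open>E\<close>, the function \<open>g_real\<close> has the modulus of continuity
  \<open>C * \<bar>W x - W t\<bar> powr (1 / p)\<close>, where \<open>W\<close> is a primitive of \<open>omega powr p\<close>, so it extends continuously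
  to \<open>I\<close>. For arbitrary endpoints the bound follows by approximating each interval from inside by
  intervals with endpoints in \<open>E\<close>, so that the right-hand side does not grow.
\<close>

lemma dual_bound_version:
  obtains \<gamma> where "dual_bound \<gamma>" "AE x in lebesgue_on I. g_real x = \<gamma> x"
proof -
  obtain u l :: "nat \<Rightarrow> real" where ul: "einterval c d = (\<Union>i. {l i .. u i})" "\<And>i. l i < u i"
    by (rule einterval_Icc_approximation[OF cd]) blast
  have x0: "l 0 \<in> einterval c d" using ul(2)[of 0] unfolding ul(1) by (intro UN_I[of 0]) auto
  obtain G where G: "\<And>s t. s \<le> t \<Longrightarrow> {s..t} \<subseteq> einterval c d \<Longrightarrow> G t - G s = integral {s..t} g_real"
    by (rule loc_integrable_antiderivative[OF x0, of g_real])
       (use g_real_loc_integrable(1) in \<open>auto simp: absolutely_integrable_on_def I\<close>)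
  obtain W where W: "\<And>s t. s \<le> t \<Longrightarrow> {s..t} \<subseteq> einterval c d \<Longrightarrow> W t - W s = integral {s..t} (\<lambda>x. omega x powr p)"
    by (rule loc_integrable_antiderivative[OF x0, of "\<lambda>x. omega x powr p"])
       (use omega_powr_loc in \<open>auto simp: absolutely_integrable_on_def I\<close>)
  have gri: "g_real absolutely_integrable_on {s..t}" if "s \<le> t" "{s..t} \<subseteq> einterval c d" for s t
    using that by (intro g_real_loc_integrable(1)) (auto simp: I)
  have wi: "(\<lambda>x. omega x powr p) absolutely_integrable_on {s..t}" if "s \<le> t" "{s..t} \<subseteq> einterval c d" for s t
    using that by (intro omega_powr_loc) (auto simp: I)
  have Wcont: "continuous_on I W"
    unfolding I by (rule AC_loc_einterval_continuous_on[OF indefinite_integral_AC_loc(1)[OF cd wi W]])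
  define E where "E = {x \<in> I. (G has_real_derivative g_real x) (at x)}"
  have "AE x in lebesgue_on I. (G has_real_derivative g_real x) (at x)"
    unfolding I by (rule indefinite_integral_AC_loc(2)[OF cd gri G])
  then have "AE x in lebesgue. x \<in> I \<longrightarrow> (G has_real_derivative g_real x) (at x)"
    by (rule AE_on_I_iff[THEN iffD1])
  then have Eae: "AE x in lebesgue. x \<in> I \<longrightarrow> x \<in> E" by eventually_elim (simp add: E_def)
  then obtain N where N: "{x \<in> space lebesgue. \<not> (x \<in> I \<longrightarrow> x \<in> E)} \<subseteq> N" "N \<in> null_sets lebesgue"
    unfolding eventually_ae_filter by blast
  have dense: "\<exists>e\<in>E. y < e \<and> e < z" if "y < z" "{y<..<z} \<subseteq> I" for y z
  proof (rule ccontr)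
    assume no: "\<not> ?thesis"
    have "{y<..<z} \<subseteq> N"
    proof
      fix x assume x: "x \<in> {y<..<z}"
      then have "x \<in> I" using that(2) by blast
      moreover have "x \<notin> E" using no x by auto
      ultimately show "x \<in> N" using subsetD[OF N(1), of x] by simp
    qed
    then have "negligible {y<..<z}" using N(2) negligible_subset by (auto simp: negligible_iff_null_sets)
    then show False using open_not_negligible[of "{y<..<z}"] \<open>y < z\<close> by auto
  qed
  have EI: "e \<in> I" if "e \<in> E" for e using that by (simp add: E_def)
  have Wmu: "W t - W s = mu s t" if "s \<in> I" "t \<in> I" "s \<le> t" for s t
    using W[of s t] I_Icc[OF that(1,2)] that(3) by (simp add: mu_def I)
  have two: "\<bar>g_real t - g_real s\<bar> \<le> C * \<bar>W t - W s\<bar> powr (1 / p)" if "s \<in> E" "t \<in> E" for s t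
  proof -
    have lt: "\<bar>g_real t - g_real s\<bar> \<le> C * \<bar>W t - W s\<bar> powr (1 / p)" if st: "s \<in> E" "t \<in> E" "s < t" for s t
    proof -
      have "\<bar>\<Sum>i\<in>{0::nat}. 1 * (g_real t - g_real s)\<bar> \<le> C * (\<Sum>i\<in>{0::nat}. \<bar>1\<bar> powr p * mu s t) powr (1 / p)"
        by (rule sum_bound_at_Lebesgue_points[of G _ s t]) (use G st EI in \<open>auto simp: E_def I\<close>)
      then show ?thesis using Wmu[of s t] st EI mu_nonneg[of s t] by simp
    qed
    show ?thesis using lt[of s t] lt[of t s] that
      by (cases s t rule: linorder_cases) (auto simp: abs_minus_commute)
  qed
  have modlim: "(\<lambda>n. C * \<bar>W x - W (e n)\<bar> powr (1 / p)) \<longlonglongrightarrow> C * \<bar>W x - W y\<bar> powr (1 / p)"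
    if "\<And>n. e n \<in> I" "e \<longlonglongrightarrow> y" "y \<in> I" for e x y
  proof -
    have "(\<lambda>n. W (e n)) \<longlonglongrightarrow> W y"
      by (rule continuous_on_tendsto_compose[OF Wcont that(2,3)]) (use that(1) in auto)
    then show ?thesis
      using p1 by (intro tendsto_mult tendsto_const tendsto_powr' tendsto_rabs tendsto_diff) auto
  qed
  have "\<exists>y. \<forall>t\<in>E. \<bar>y - g_real t\<bar> \<le> C * \<bar>W x - W t\<bar> powr (1 / p)" if x: "x \<in> I" for x
  proof -
    obtain r where r: "0 < r" "ball x r \<subseteq> I" using I_open x open_contains_ball by blast
    have "\<exists>e\<in>E. x < e \<and> e < x + min r (1 / real (Suc n))" for n
    proof (rule dense)
      show "{x<..<x + min r (1 / real (Suc n))} \<subseteq> I" using r(2) by (auto simp: ball_def dist_real_def subset_eq)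
    qed (use r(1) in simp)
    then obtain e where e: "\<And>n. e n \<in> E" "\<And>n. x < e n" "\<And>n. e n < x + min r (1 / real (Suc n))" by metis
    have ex: "e \<longlonglongrightarrow> x"
    proof (rule tendsto_sandwich[where f = "\<lambda>_. x" and h = "\<lambda>n. x + 1 / real (Suc n)"])
      show "(\<lambda>n. x + 1 / real (Suc n)) \<longlonglongrightarrow> x"
        using tendsto_add[OF tendsto_const[of x] LIMSEQ_Suc[OF lim_1_over_n]] by simp
      show "eventually (\<lambda>n. e n \<le> x + 1 / real (Suc n)) sequentially"
      proof (intro always_eventually allI)
        fix n show "e n \<le> x + 1 / real (Suc n)" using e(3)[of n] by linarith
      qed
    qed (use e(2) in \<open>auto intro!: always_eventually less_imp_le\<close>)
    have "Cauchy (\<lambda>n. g_real (e n))"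
    proof (rule metric_CauchyI)
      fix \<epsilon> :: real assume "0 < \<epsilon>"
      then have "0 < \<epsilon> / 2" by simp
      have "(\<lambda>n. C * \<bar>W x - W (e n)\<bar> powr (1 / p)) \<longlonglongrightarrow> C * \<bar>W x - W x\<bar> powr (1 / p)"
        by (rule modlim[OF _ ex x]) (use e EI in auto)
      then have "(\<lambda>n. W (e n)) \<longlonglongrightarrow> W x"
        using continuous_on_tendsto_compose[OF Wcont ex x] e(1) EI by auto
      then have CW: "Cauchy (\<lambda>n. W (e n))" by (rule LIMSEQ_imp_Cauchy)
      define \<eta> where "\<eta> = (\<epsilon> / (C + 1)) powr p"
      have "0 < \<eta>" using \<open>0 < \<epsilon>\<close> C_nonneg by (simp add: \<eta>_def)
      obtain M where M: "\<forall>m\<ge>M. \<forall>n\<ge>M. dist (W (e m)) (W (e n)) < \<eta>"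
        using metric_CauchyD[OF CW \<open>0 < \<eta>\<close>] by blast
      show "\<exists>M. \<forall>m\<ge>M. \<forall>n\<ge>M. dist (g_real (e m)) (g_real (e n)) < \<epsilon>"
      proof (intro exI[of _ M] allI impI)
        fix m n assume mn: "M \<le> m" "M \<le> n"
        have "dist (g_real (e m)) (g_real (e n)) \<le> C * \<bar>W (e m) - W (e n)\<bar> powr (1 / p)"
          using two[OF e(1)[of n] e(1)[of m]] by (simp add: dist_real_def)
        also have "\<dots> \<le> C * \<eta> powr (1 / p)"
          using M mn p1 C_nonneg by (intro mult_left_mono powr_mono2) (auto simp: dist_real_def less_imp_le)
        also have "\<eta> powr (1 / p) = \<epsilon> / (C + 1)"
          using p1 \<open>0 < \<epsilon>\<close> C_nonneg by (simp add: \<eta>_def powr_powr)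
        also have "C * (\<epsilon> / (C + 1)) < \<epsilon>" using \<open>0 < \<epsilon>\<close> C_nonneg by (simp add: field_simps)
        finally show "dist (g_real (e m)) (g_real (e n)) < \<epsilon>" .
      qed
    qed
    then obtain y where y: "(\<lambda>n. g_real (e n)) \<longlonglongrightarrow> y" using Cauchy_convergent_iff convergent_def by metis
    show ?thesis
    proof (intro exI[of _ y] ballI)
      fix t assume t: "t \<in> E"
      have 1: "(\<lambda>n. \<bar>g_real (e n) - g_real t\<bar>) \<longlonglongrightarrow> \<bar>y - g_real t\<bar>" by (intro tendsto_intros y)
      have 2: "(\<lambda>n. C * \<bar>W t - W (e n)\<bar> powr (1 / p)) \<longlonglongrightarrow> C * \<bar>W t - W x\<bar> powr (1 / p)"
        by (rule modlim[OF _ ex x]) (use e EI in auto)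
      have "\<bar>y - g_real t\<bar> \<le> C * \<bar>W t - W x\<bar> powr (1 / p)"
        by (rule tendsto_le[OF _ 2 1]) (use two[OF e(1) t] in \<open>auto simp: abs_minus_commute\<close>)
      then show "\<bar>y - g_real t\<bar> \<le> C * \<bar>W x - W t\<bar> powr (1 / p)" by (simp add: abs_minus_commute)
    qed
  qed
  then obtain \<gamma> where \<gamma>: "\<And>x t. x \<in> I \<Longrightarrow> t \<in> E \<Longrightarrow> \<bar>\<gamma> x - g_real t\<bar> \<le> C * \<bar>W x - W t\<bar> powr (1 / p)" by metis
  have \<gamma>E: "\<gamma> t = g_real t" if "t \<in> E" for t using \<gamma>[OF EI[OF that] that] by simp
  have \<gamma>lim: "(\<lambda>n. g_real (e n)) \<longlonglongrightarrow> \<gamma> x" if "\<And>n. e n \<in> E" "e \<longlonglongrightarrow> x" "x \<in> I" for e x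
  proof -
    have "(\<lambda>n. C * \<bar>W x - W (e n)\<bar> powr (1 / p)) \<longlonglongrightarrow> C * \<bar>W x - W x\<bar> powr (1 / p)"
      by (rule modlim[OF _ that(2,3)]) (use that EI in auto)
    then have z: "(\<lambda>n. C * \<bar>W x - W (e n)\<bar> powr (1 / p)) \<longlonglongrightarrow> 0" by simp
    have "(\<lambda>n. g_real (e n) - \<gamma> x) \<longlonglongrightarrow> 0"
      by (rule Lim_null_comparison[OF _ z]) (use \<gamma>[OF that(3) that(1)] in \<open>auto simp: abs_minus_commute intro!: always_eventually\<close>)
    then show ?thesis by (rule LIM_zero_cancel)
  qed
  have "dual_bound \<gamma>"
    unfolding dual_bound_def
  proof (intro allI impI, elim conjE)
    fix S :: "nat set" and \<alpha> s t a b
    assume fin: "finite S" and ab: "a \<in> I" "b \<in> I" "a \<le> b"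
      and st: "\<forall>i\<in>S. a \<le> s i \<and> s i < t i \<and> t i \<le> b"
      and dj: "\<forall>i\<in>S. \<forall>j\<in>S. i \<noteq> j \<longrightarrow> {s i<..<t i} \<inter> {s j<..<t j} = {}"
    have sub: "{a..b} \<subseteq> I" by (rule I_Icc[OF ab(1,2)])
    have stI: "s i \<in> I" "t i \<in> I" if "i \<in> S" for i
      using subsetD[OF sub, of "s i"] subsetD[OF sub, of "t i"] bspec[OF st that] by auto
    define mi where "mi i = (s i + t i) / 2" for i
    have mi: "s i < mi i" "mi i < t i" if "i \<in> S" for i using st that by (auto simp: mi_def)
    have "\<forall>n. \<forall>i\<in>S. \<exists>e. e \<in> E \<and> s i < e \<and> e < min (mi i) (s i + 1 / real (Suc n))"
    proof (intro allI ballI)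
      fix n i assume i: "i \<in> S"
      have "\<exists>e\<in>E. s i < e \<and> e < min (mi i) (s i + 1 / real (Suc n))"
      proof (rule dense)
        show "s i < min (mi i) (s i + 1 / real (Suc n))" using mi[OF i] by (simp del: of_nat_Suc)
        show "{s i<..<min (mi i) (s i + 1 / real (Suc n))} \<subseteq> I"
          using I_Icc[OF stI[OF i]] mi[OF i] by (auto simp: subset_eq simp del: of_nat_Suc)
      qed
      then show "\<exists>e. e \<in> E \<and> s i < e \<and> e < min (mi i) (s i + 1 / real (Suc n))" by blast
    qed
    then obtain \<sigma> where \<sigma>: "\<And>n i. i \<in> S \<Longrightarrow> \<sigma> n i \<in> E \<and> s i < \<sigma> n i \<and> \<sigma> n i < min (mi i) (s i + 1 / real (Suc n))"
      by metis
    have "\<forall>n. \<forall>i\<in>S. \<exists>e. e \<in> E \<and> max (mi i) (t i - 1 / real (Suc n)) < e \<and> e < t i"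
    proof (intro allI ballI)
      fix n i assume i: "i \<in> S"
      have "\<exists>e\<in>E. max (mi i) (t i - 1 / real (Suc n)) < e \<and> e < t i"
      proof (rule dense)
        show "max (mi i) (t i - 1 / real (Suc n)) < t i" using mi[OF i] by (simp del: of_nat_Suc)
        show "{max (mi i) (t i - 1 / real (Suc n))<..<t i} \<subseteq> I"
          using I_Icc[OF stI[OF i]] mi[OF i] by (auto simp: subset_eq simp del: of_nat_Suc)
      qed
      then show "\<exists>e. e \<in> E \<and> max (mi i) (t i - 1 / real (Suc n)) < e \<and> e < t i" by blast
    qed
    then obtain \<tau> where \<tau>: "\<And>n i. i \<in> S \<Longrightarrow> \<tau> n i \<in> E \<and> max (mi i) (t i - 1 / real (Suc n)) < \<tau> n i \<and> \<tau> n i < t i"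
      by metis
    have \<sigma>lim: "(\<lambda>n. \<sigma> n i) \<longlonglongrightarrow> s i" if i: "i \<in> S" for i
    proof (rule tendsto_sandwich[where f = "\<lambda>_. s i" and h = "\<lambda>n. s i + 1 / real (Suc n)"])
      show "(\<lambda>n. s i + 1 / real (Suc n)) \<longlonglongrightarrow> s i"
        using tendsto_add[OF tendsto_const[of "s i"] LIMSEQ_Suc[OF lim_1_over_n]] by simp
    qed (use \<sigma>[OF i] in \<open>auto intro!: always_eventually less_imp_le simp del: of_nat_Suc\<close>)
    have \<tau>lim: "(\<lambda>n. \<tau> n i) \<longlonglongrightarrow> t i" if i: "i \<in> S" for i
    proof (rule tendsto_sandwich[where f = "\<lambda>n. t i - 1 / real (Suc n)" and h = "\<lambda>_. t i"])
      show "(\<lambda>n. t i - 1 / real (Suc n)) \<longlonglongrightarrow> t i"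
        using tendsto_diff[OF tendsto_const[of "t i"] LIMSEQ_Suc[OF lim_1_over_n]] by simp
    qed (use \<tau>[OF i] in \<open>auto intro!: always_eventually less_imp_le simp del: of_nat_Suc\<close>)
    define R where "R = (\<Sum>i\<in>S. \<bar>\<alpha> i\<bar> powr p * mu (s i) (t i))"
    have bnd: "\<bar>\<Sum>i\<in>S. \<alpha> i * (g_real (\<tau> n i) - g_real (\<sigma> n i))\<bar> \<le> C * R powr (1 / p)" for n
    proof -
      have ord: "s i < \<sigma> n i" "\<sigma> n i < \<tau> n i" "\<tau> n i < t i" if "i \<in> S" for i
        using \<sigma>[OF that, of n] \<tau>[OF that, of n] by auto
      have "\<bar>\<Sum>i\<in>S. \<alpha> i * (g_real (\<tau> n i) - g_real (\<sigma> n i))\<bar>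
         \<le> C * (\<Sum>i\<in>S. \<bar>\<alpha> i\<bar> powr p * mu (\<sigma> n i) (\<tau> n i)) powr (1 / p)"
      proof (rule sum_bound_at_Lebesgue_points[OF _ fin ab])
        show "G t - G s = integral {s..t} g_real" if "s \<le> t" "{s..t} \<subseteq> I" for s t using G that by (simp add: I)
        show "a \<le> \<sigma> n i \<and> \<sigma> n i < \<tau> n i \<and> \<tau> n i \<le> b" if "i \<in> S" for i
          using ord[OF that] st that by (auto intro: order_trans less_imp_le)
        show "{\<sigma> n i<..<\<tau> n i} \<inter> {\<sigma> n j<..<\<tau> n j} = {}" if "i \<in> S" "j \<in> S" "i \<noteq> j" for i j
        proof -
          have "{\<sigma> n i<..<\<tau> n i} \<subseteq> {s i<..<t i}" "{\<sigma> n j<..<\<tau> n j} \<subseteq> {s j<..<t j}"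
            using ord[OF that(1)] ord[OF that(2)] by auto
          then show ?thesis using dj that by blast
        qed
        show "(G has_real_derivative g_real (\<sigma> n i)) (at (\<sigma> n i)) \<and> (G has_real_derivative g_real (\<tau> n i)) (at (\<tau> n i))"
          if "i \<in> S" for i using \<sigma>[OF that, of n] \<tau>[OF that, of n] by (auto simp: E_def)
      qed
      also have "\<dots> \<le> C * R powr (1 / p)"
      proof (intro mult_left_mono powr_mono2 C_nonneg)
        show "(\<Sum>i\<in>S. \<bar>\<alpha> i\<bar> powr p * mu (\<sigma> n i) (\<tau> n i)) \<le> R"
          unfolding R_def
        proof (intro sum_mono mult_left_mono)
          fix i assume i: "i \<in> S"
          show "mu (\<sigma> n i) (\<tau> n i) \<le> mu (s i) (t i)"
            using mu_mono[OF stI[OF i], of "\<sigma> n i" "\<tau> n i"] ord[OF i] by simp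
        qed simp
        show "0 \<le> (\<Sum>i\<in>S. \<bar>\<alpha> i\<bar> powr p * mu (\<sigma> n i) (\<tau> n i))"
          by (intro sum_nonneg mult_nonneg_nonneg mu_nonneg) auto
        show "0 \<le> 1 / p" using p1 by simp
      qed
      finally show ?thesis .
    qed
    have "(\<lambda>n. \<bar>\<Sum>i\<in>S. \<alpha> i * (g_real (\<tau> n i) - g_real (\<sigma> n i))\<bar>) \<longlonglongrightarrow> \<bar>\<Sum>i\<in>S. \<alpha> i * (\<gamma> (t i) - \<gamma> (s i))\<bar>"
      by (intro tendsto_rabs tendsto_sum tendsto_mult tendsto_const tendsto_diff \<gamma>lim \<sigma>lim \<tau>lim stI)
         (use \<sigma> \<tau> in auto)
    then show "\<bar>\<Sum>i\<in>S. \<alpha> i * (\<gamma> (t i) - \<gamma> (s i))\<bar> \<le> C * (\<Sum>i\<in>S. \<bar>\<alpha> i\<bar> powr p * mu (s i) (t i)) powr (1 / p)"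
      unfolding R_def[symmetric] by (rule tendsto_upperbound) (use bnd in auto)
  qed
  moreover have "AE x in lebesgue_on I. g_real x = \<gamma> x"
  proof -
    have "AE x in lebesgue. x \<in> I \<longrightarrow> g_real x = \<gamma> x" using Eae by eventually_elim (simp add: \<gamma>E)
    then show ?thesis by (rule AE_on_I_iff[THEN iffD2])
  qed
  ultimately show thesis by (rule that)
qed

end

section \<open>The norm of the derivative\<close>

text \<open>
  Difference quotients over intervals that contain the point: the error at each endpoint is
  small compared with its distance to the point, and these two distances add up to the length.
\<close>

lemma straddled_difference_quotients_tendsto:
  fixes f :: "real \<Rightarrow> real"
  assumes d: "(f has_real_derivative D) (at x)"
    and st: "\<And>n. s n \<le> x" "\<And>n. x \<le> t n" "\<And>n. s n < t n" and s: "s \<longlonglongrightarrow> x" and t: "t \<longlonglongrightarrow> x"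
  shows "(\<lambda>n. (f (t n) - f (s n)) / (t n - s n)) \<longlonglongrightarrow> D"
proof (rule tendstoI)
  fix e :: real assume "0 < e"
  then have "0 < e / 2" by simp
  have "\<forall>e>0. \<exists>\<delta>>0. \<forall>y. norm (y - x) < \<delta> \<longrightarrow> norm (f y - f x - (y - x) * D) \<le> e * norm (y - x)"
    using d unfolding has_field_derivative_def has_derivative_at_alt by (simp add: mult.commute)
  then obtain \<delta> where "0 < \<delta>" and \<delta>: "\<And>y. \<bar>y - x\<bar> < \<delta> \<Longrightarrow> \<bar>f y - f x - (y - x) * D\<bar> \<le> e / 2 * \<bar>y - x\<bar>"
    using \<open>0 < e / 2\<close> by (metis real_norm_def)
  have "eventually (\<lambda>n. dist (s n) x < \<delta>) sequentially" "eventually (\<lambda>n. dist (t n) x < \<delta>) sequentially"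
    using tendstoD[OF s \<open>0 < \<delta>\<close>] tendstoD[OF t \<open>0 < \<delta>\<close>] by auto
  then show "eventually (\<lambda>n. dist ((f (t n) - f (s n)) / (t n - s n)) D < e) sequentially"
  proof eventually_elim
    fix n assume sn: "dist (s n) x < \<delta>" and tn: "dist (t n) x < \<delta>"
    have 1: "\<bar>f (s n) - f x - (s n - x) * D\<bar> \<le> e / 2 * (x - s n)"
      using \<delta>[of "s n"] sn st(1)[of n] by (simp add: dist_real_def)
    have 2: "\<bar>f (t n) - f x - (t n - x) * D\<bar> \<le> e / 2 * (t n - x)"
      using \<delta>[of "t n"] tn st(2)[of n] by (simp add: dist_real_def)
    have pos: "0 < t n - s n" using st(3)[of n] by simp
    have "f (t n) - f (s n) - (t n - s n) * D = (f (t n) - f x - (t n - x) * D) - (f (s n) - f x - (s n - x) * D)"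
      by (simp add: algebra_simps)
    then have "\<bar>f (t n) - f (s n) - (t n - s n) * D\<bar> \<le> e / 2 * (t n - x) + e / 2 * (x - s n)"
      using 1 2 by linarith
    also have "\<dots> = e / 2 * (t n - s n)" unfolding distrib_left[symmetric] by simp
    finally have "\<bar>(f (t n) - f (s n) - (t n - s n) * D) / (t n - s n)\<bar> \<le> e / 2"
      using pos by (simp add: abs_divide pos_divide_le_eq)
    moreover have "(f (t n) - f (s n) - (t n - s n) * D) / (t n - s n) = (f (t n) - f (s n)) / (t n - s n) - D"
      using pos by (simp add: diff_divide_distrib)
    ultimately show "dist ((f (t n) - f (s n)) / (t n - s n)) D < e" using \<open>0 < e\<close> by (simp add: dist_real_def)
  qed
qed

context cesaro_copson_dual begin

text \<open>
  The coefficients are extremal in Hoelder's inequality: writing \<open>T\<close> for the sum, both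
  \<open>\<Sum> \<alpha> i * \<Delta> i\<close> and \<open>\<Sum> \<bar>\<alpha> i\<bar> powr p * m i\<close> equal \<open>T\<close>, hence \<open>T \<le> C * T powr (1 / p)\<close>. Intervals
  of weight \<open>0\<close> contribute nothing because of \<open>x / 0 = 0\<close>.
\<close>

lemma riesz_sum_bound:
  assumes db: "dual_bound \<gamma>" and "finite S" "a \<in> I" "b \<in> I" "a \<le> b"
    "\<And>i. i \<in> S \<Longrightarrow> a \<le> s i \<and> s i < t i \<and> t i \<le> b"
    "\<And>i j. i \<in> S \<Longrightarrow> j \<in> S \<Longrightarrow> i \<noteq> j \<Longrightarrow> {s i<..<t i} \<inter> {s j<..<t j} = {}"
  shows "(\<Sum>i\<in>(S :: nat set). \<bar>\<gamma> (t i) - \<gamma> (s i)\<bar> powr q / mu (s i) (t i) powr (q - 1)) \<le> C powr q"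
proof -
  define \<Delta> where "\<Delta> i = \<gamma> (t i) - \<gamma> (s i)" for i
  define m where "m i = mu (s i) (t i)" for i
  define T where "T = (\<Sum>i\<in>S. \<bar>\<Delta> i\<bar> powr q / m i powr (q - 1))"
  define \<alpha> where "\<alpha> i = sgn (\<Delta> i) * (\<bar>\<Delta> i\<bar> powr (q - 1) / m i powr (q - 1))" for i
  have m0: "0 \<le> m i" for i by (simp add: m_def mu_nonneg)
  have T0: "0 \<le> T" unfolding T_def by (intro sum_nonneg) auto
  have 1: "\<alpha> i * \<Delta> i = \<bar>\<Delta> i\<bar> powr q / m i powr (q - 1)" for i
  proof -
    have "\<bar>\<Delta> i\<bar> * \<bar>\<Delta> i\<bar> powr (q - 1) = \<bar>\<Delta> i\<bar> powr q"
      by (cases "\<Delta> i = 0") (simp_all add: powr_mult_base)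
    moreover have "sgn (\<Delta> i) * \<Delta> i = \<bar>\<Delta> i\<bar>" by (simp add: sgn_if abs_if)
    ultimately show ?thesis by (simp add: \<alpha>_def mult.assoc[symmetric] mult.commute)
  qed
  have 2: "\<bar>\<alpha> i\<bar> powr p * m i = \<bar>\<Delta> i\<bar> powr q / m i powr (q - 1)" for i
  proof (cases "\<Delta> i = 0 \<or> m i = 0")
    case True
    then show ?thesis by (auto simp: \<alpha>_def)
  next
    case False
    then have mp: "0 < m i" using m0[of i] by auto
    have "\<bar>\<alpha> i\<bar> = \<bar>\<Delta> i\<bar> powr (q - 1) / m i powr (q - 1)"
      using False by (simp add: \<alpha>_def abs_mult abs_sgn_eq)
    then have "\<bar>\<alpha> i\<bar> powr p = \<bar>\<Delta> i\<bar> powr q / m i powr q"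
      by (simp add: powr_divide powr_powr q_conj)
    moreover have "m i powr q = m i * m i powr (q - 1)" using mp by (simp add: powr_mult_base)
    ultimately show ?thesis using mp by simp
  qed
  have "\<bar>\<Sum>i\<in>S. \<alpha> i * (\<gamma> (t i) - \<gamma> (s i))\<bar> \<le> C * (\<Sum>i\<in>S. \<bar>\<alpha> i\<bar> powr p * mu (s i) (t i)) powr (1 / p)"
    by (rule dual_boundD[OF assms])
  then have "\<bar>T\<bar> \<le> C * T powr (1 / p)"
    by (simp only: \<Delta>_def[symmetric] m_def[symmetric] 1 2 T_def)
  then have le: "T \<le> C * T powr (1 / p)" by simp
  have "T \<le> C powr q"
  proof (cases "T = 0")
    case False
    then have Tp: "0 < T" using T0 by simp
    have "T = T powr (1 / q) * T powr (1 / p)"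
      using Tp pq by (simp add: powr_add[symmetric] add.commute)
    then have "T powr (1 / q) * T powr (1 / p) \<le> C * T powr (1 / p)" using le by simp
    then have "T powr (1 / q) \<le> C" using Tp by simp
    then have "(T powr (1 / q)) powr q \<le> C powr q" using q_pos by (intro powr_mono2) auto
    then show ?thesis using Tp q_pos by (simp add: powr_powr)
  qed simp
  then show ?thesis by (simp add: T_def \<Delta>_def m_def)
qed

text \<open>
  On the cell of a grid that contains \<open>x\<close>, the step function \<open>\<phi> n\<close> is formed from the difference quotients
  of \<open>\<gamma>\<close> and of a primitive of \<open>omega powr p\<close>. It converges almost everywhere to the integrand, its integral is
  a sum bounded in the preceding lemma, and Fatou's lemma applies.
\<close>

lemma deriv_norm_Ioo_le:
  assumes db: "dual_bound \<gamma>" and ab: "a \<in> I" "b \<in> I" "a < b"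
  shows "(\<integral>\<^sup>+x. ennreal ((\<bar>deriv \<gamma> x\<bar> / omega x) powr q) * indicator {a<..<b} x \<partial>lebesgue) \<le> ennreal (C powr q)"
proof -
  have sub: "{a..b} \<subseteq> I" by (rule I_Icc[OF ab(1,2)])
  have AC: "\<gamma> \<in> AC_loc (einterval c d)" using dual_bound_imp_AC_loc[OF db] by (simp add: I)
  define W where "W x = mu a x" for x
  define \<delta> where "\<delta> n = (b - a) / real (Suc n)" for n
  define x where "x n k = a + real k * \<delta> n" for n k
  define cc where "cc n k = (\<bar>\<gamma> (x n (Suc k)) - \<gamma> (x n k)\<bar> / \<delta> n) powr q / (mu (x n k) (x n (Suc k)) / \<delta> n) powr (q - 1)" for n k
  define \<phi> where "\<phi> n y = (\<Sum>k<Suc n. cc n k * indicator {x n k..<x n (Suc k)} y)" for n y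
  have \<delta>pos: "0 < \<delta> n" for n using ab by (simp add: \<delta>_def)
  have xS: "x n (Suc k) = x n k + \<delta> n" for n k by (simp add: x_def algebra_simps)
  have xmono: "x n k \<le> x n j" if "k \<le> j" for n k j using that \<delta>pos[of n] by (simp add: x_def mult_right_mono)
  have x0: "x n 0 = a" for n by (simp add: x_def)
  have xend: "x n (Suc n) = b" for n by (simp add: x_def \<delta>_def del: of_nat_Suc)
  have xin: "x n k \<in> {a..b}" if "k \<le> Suc n" for n k
    using xmono[of 0 k n] xmono[of k "Suc n" n] that by (auto simp: x0 xend)
  have cc0: "0 \<le> cc n k" for n k by (simp add: cc_def)
  have cc\<delta>: "cc n k * \<delta> n = \<bar>\<gamma> (x n (Suc k)) - \<gamma> (x n k)\<bar> powr q / mu (x n k) (x n (Suc k)) powr (q - 1)" for n k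
  proof -
    have "\<delta> n powr q = \<delta> n * \<delta> n powr (q - 1)" using \<delta>pos[of n] by (simp add: powr_mult_base)
    then show ?thesis
      using \<delta>pos[of n] by (simp add: cc_def powr_divide mu_nonneg)
  qed
  have int\<phi>: "(\<integral>\<^sup>+y. ennreal (\<phi> n y) \<partial>lebesgue) \<le> ennreal (C powr q)" for n
  proof -
    have "ennreal (\<phi> n y) = (\<Sum>k<Suc n. ennreal (cc n k) * indicator {x n k..<x n (Suc k)} y)" for y
    proof -
      have "ennreal (\<phi> n y) = (\<Sum>k<Suc n. ennreal (cc n k * indicator {x n k..<x n (Suc k)} y))"
        unfolding \<phi>_def by (rule sum_ennreal[symmetric]) (simp add: cc0)
      also have "\<dots> = (\<Sum>k<Suc n. ennreal (cc n k) * indicator {x n k..<x n (Suc k)} y)"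
        by (rule sum.cong[OF refl]) (simp add: indicator_def)
      finally show ?thesis .
    qed
    then have "(\<integral>\<^sup>+y. ennreal (\<phi> n y) \<partial>lebesgue) = (\<integral>\<^sup>+y. (\<Sum>k<Suc n. ennreal (cc n k) * indicator {x n k..<x n (Suc k)} y) \<partial>lebesgue)"
      by simp
    also have "\<dots> = (\<Sum>k<Suc n. \<integral>\<^sup>+y. ennreal (cc n k) * indicator {x n k..<x n (Suc k)} y \<partial>lebesgue)"
      by (rule nn_integral_sum) (intro borel_measurable_times_ennreal borel_measurable_const borel_measurable_indicator, simp)
    also have "\<dots> = (\<Sum>k<Suc n. ennreal (cc n k) * emeasure lebesgue {x n k..<x n (Suc k)})"
      by (intro sum.cong[OF refl] nn_integral_cmult_indicator) simp
    also have "\<dots> = (\<Sum>k<Suc n. ennreal (cc n k * \<delta> n))"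
      using \<delta>pos[of n] by (intro sum.cong refl) (simp add: xS ennreal_mult cc0)
    also have "\<dots> = ennreal (\<Sum>k<Suc n. cc n k * \<delta> n)"
      using cc0 \<delta>pos[of n] by (intro sum_ennreal) (simp add: less_imp_le)
    also have "\<dots> \<le> ennreal (C powr q)"
    proof (rule ennreal_leI)
      show "(\<Sum>k<Suc n. cc n k * \<delta> n) \<le> C powr q"
        unfolding cc\<delta>
      proof (rule riesz_sum_bound[OF db _ ab(1,2)])
        fix i assume "i \<in> {..<Suc n}"
        then show "a \<le> x n i \<and> x n i < x n (Suc i) \<and> x n (Suc i) \<le> b"
          using xin[of i n] xin[of "Suc i" n] \<delta>pos[of n] by (auto simp: xS)
      next
        fix i j :: nat assume "i \<noteq> j"
        then show "{x n i<..<x n (Suc i)} \<inter> {x n j<..<x n (Suc j)} = {}"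
          using xmono[of "Suc i" j n] xmono[of "Suc j" i n] by (cases "i < j") auto
      qed (use ab in auto)
    qed
    finally show ?thesis .
  qed
  have \<phi>m: "\<phi> n \<in> borel_measurable lebesgue" for n
    unfolding \<phi>_def[abs_def]
    by (intro borel_measurable_sum borel_measurable_times borel_measurable_const borel_measurable_indicator) auto
  have Wd: "AE y in lebesgue_on (einterval c d). ((\<lambda>z. if a \<le> z then mu a z else - mu z a) has_real_derivative omega y powr p) (at y)"
  proof (rule indefinite_integral_AC_loc(2)[OF cd])
    fix s t :: real assume st: "s \<le> t" "{s..t} \<subseteq> einterval c d"
    then have stI: "s \<in> I" "t \<in> I" by (auto simp: I)
    show "(\<lambda>x. omega x powr p) absolutely_integrable_on {s..t}" by (rule omega_powr_loc[OF stI])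
    show "(if a \<le> t then mu a t else - mu t a) - (if a \<le> s then mu a s else - mu s a) = integral {s..t} (\<lambda>x. omega x powr p)"
      unfolding mu_def[symmetric]
      using mu_combine[of a t s] mu_combine[of s t a] mu_combine[of s a t] st stI ab by auto
  qed
  have ae: "AE y in lebesgue. ennreal ((\<bar>deriv \<gamma> y\<bar> / omega y) powr q) * indicator {a<..<b} y \<le> liminf (\<lambda>n. ennreal (\<phi> n y))"
  proof -
    have "AE y in lebesgue_on I. (\<gamma> has_real_derivative deriv \<gamma> y) (at y)"
      using AC_loc_deriv(1)[OF cd AC] by (simp only: I)
    then have 1: "AE y in lebesgue. y \<in> I \<longrightarrow> (\<gamma> has_real_derivative deriv \<gamma> y) (at y)" by (rule AE_on_I_iff[THEN iffD1])
    have 2: "AE y in lebesgue. y \<in> I \<longrightarrow> ((\<lambda>z. if a \<le> z then mu a z else - mu z a) has_real_derivative omega y powr p) (at y)"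
      using Wd unfolding I[symmetric] by (rule AE_on_I_iff[THEN iffD1])
    have 3: "AE y in lebesgue. y \<in> I \<longrightarrow> 0 < omega y \<and> w y = ereal (omega y)"
      using omega_ae by (rule AE_on_I_iff[THEN iffD1])
    from 1 2 3 show ?thesis
    proof eventually_elim
      fix y assume d1: "y \<in> I \<longrightarrow> (\<gamma> has_real_derivative deriv \<gamma> y) (at y)"
        and d2: "y \<in> I \<longrightarrow> ((\<lambda>z. if a \<le> z then mu a z else - mu z a) has_real_derivative omega y powr p) (at y)"
        and om: "y \<in> I \<longrightarrow> 0 < omega y \<and> w y = ereal (omega y)"
      show "ennreal ((\<bar>deriv \<gamma> y\<bar> / omega y) powr q) * indicator {a<..<b} y \<le> liminf (\<lambda>n. ennreal (\<phi> n y))"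
      proof (cases "y \<in> {a<..<b}")
        case True
        then have yI: "y \<in> I" using sub by auto
        have omp: "0 < omega y" using om yI by blast
        define kk where "kk n = nat \<lfloor>(y - a) / \<delta> n\<rfloor>" for n
        have kk: "real (kk n) \<le> (y - a) / \<delta> n" "(y - a) / \<delta> n < real (kk n) + 1" for n
        proof -
          have "0 \<le> (y - a) / \<delta> n" using True \<delta>pos[of n] by simp
          then show "real (kk n) \<le> (y - a) / \<delta> n" "(y - a) / \<delta> n < real (kk n) + 1"
            unfolding kk_def by linarith+
        qed
        have sy: "x n (kk n) \<le> y" for n
        proof -
          have "real (kk n) * \<delta> n \<le> y - a" using kk(1)[of n] \<delta>pos[of n] by (simp add: pos_le_divide_eq)
          then show ?thesis by (simp add: x_def)
        qed
        have yt: "y < x n (Suc (kk n))" for n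
        proof -
          have "y - a < (real (kk n) + 1) * \<delta> n" using kk(2)[of n] \<delta>pos[of n] by (simp add: pos_divide_less_eq)
          then show ?thesis by (simp add: x_def add.commute)
        qed
        have kkn: "kk n < Suc n" for n
        proof (rule ccontr)
          assume "\<not> kk n < Suc n"
          then have "b \<le> x n (kk n)" using xmono[of "Suc n" "kk n" n] by (simp add: xend)
          then show False using sy[of n] True by simp
        qed
        have \<phi>y: "\<phi> n y = cc n (kk n)" for n
        proof -
          have "(\<Sum>k\<in>{..<Suc n} - {kk n}. cc n k * indicator {x n k..<x n (Suc k)} y) = 0"
          proof (rule sum.neutral, rule ballI)
            fix k assume "k \<in> {..<Suc n} - {kk n}"
            then have "k < kk n \<or> kk n < k" by auto
            then have "y \<notin> {x n k..<x n (Suc k)}"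
              using xmono[of "Suc k" "kk n" n] xmono[of "Suc (kk n)" k n] sy[of n] yt[of n] by auto
            then show "cc n k * indicator {x n k..<x n (Suc k)} y = 0" by simp
          qed
          then show ?thesis
            unfolding \<phi>_def using sy[of n] yt[of n] kkn[of n]
            by (subst sum.remove[of _ "kk n"]) auto
        qed
        have \<delta>0: "\<delta> \<longlonglongrightarrow> 0"
          unfolding \<delta>_def[abs_def] using tendsto_mult[OF tendsto_const[of "b - a"] LIMSEQ_Suc[OF lim_1_over_n]] by simp
        have slim: "(\<lambda>n. x n (kk n)) \<longlonglongrightarrow> y"
        proof (rule LIM_zero_cancel, rule Lim_null_comparison[OF _ \<delta>0], intro always_eventually allI)
          fix n show "norm (x n (kk n) - y) \<le> \<delta> n" using sy[of n] yt[of n] by (simp add: xS)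
        qed
        have tlim: "(\<lambda>n. x n (Suc (kk n))) \<longlonglongrightarrow> y"
        proof (rule LIM_zero_cancel, rule Lim_null_comparison[OF _ \<delta>0], intro always_eventually allI)
          fix n show "norm (x n (Suc (kk n)) - y) \<le> \<delta> n" using sy[of n] yt[of n] by (simp add: xS)
        qed
        have stlt: "x n (kk n) < x n (Suc (kk n))" for n using \<delta>pos[of n] by (simp add: xS)
        have diff: "x n (Suc (kk n)) - x n (kk n) = \<delta> n" for n by (simp add: xS)
        have q1': "(\<lambda>n. (\<gamma> (x n (Suc (kk n))) - \<gamma> (x n (kk n))) / \<delta> n) \<longlonglongrightarrow> deriv \<gamma> y"
          using straddled_difference_quotients_tendsto[OF d1[rule_format, OF yI] sy less_imp_le[OF yt] stlt slim tlim]
          by (simp only: diff)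
        have xa: "a \<le> x n (kk n)" "a \<le> x n (Suc (kk n))" "x n (kk n) \<in> I" "x n (Suc (kk n)) \<in> I" for n
          using xin[of "kk n" n] xin[of "Suc (kk n)" n] kkn[of n] sub by auto
        have muq: "mu a (x n (Suc (kk n))) - mu a (x n (kk n)) = mu (x n (kk n)) (x n (Suc (kk n)))" for n
          using mu_combine[OF ab(1) xa(4)[of n] xa(1)[of n]] stlt[of n] by simp
        have q2': "(\<lambda>n. mu (x n (kk n)) (x n (Suc (kk n))) / \<delta> n) \<longlonglongrightarrow> omega y powr p"
          using straddled_difference_quotients_tendsto[OF d2[rule_format, OF yI] sy less_imp_le[OF yt] stlt slim tlim]
          by (simp only: diff xa(1,2) if_True muq)
        have "(\<lambda>n. (\<bar>\<gamma> (x n (Suc (kk n))) - \<gamma> (x n (kk n))\<bar> / \<delta> n) powr q / (mu (x n (kk n)) (x n (Suc (kk n))) / \<delta> n) powr (q - 1))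
            \<longlonglongrightarrow> \<bar>deriv \<gamma> y\<bar> powr q / (omega y powr p) powr (q - 1)"
        proof (rule tendsto_divide)
          have "(\<lambda>n. \<bar>(\<gamma> (x n (Suc (kk n))) - \<gamma> (x n (kk n))) / \<delta> n\<bar>) \<longlonglongrightarrow> \<bar>deriv \<gamma> y\<bar>" by (rule tendsto_rabs[OF q1'])
          then have "(\<lambda>n. \<bar>\<gamma> (x n (Suc (kk n))) - \<gamma> (x n (kk n))\<bar> / \<delta> n) \<longlonglongrightarrow> \<bar>deriv \<gamma> y\<bar>"
            using \<delta>pos by (simp add: abs_divide abs_of_pos)
          then show "(\<lambda>n. (\<bar>\<gamma> (x n (Suc (kk n))) - \<gamma> (x n (kk n))\<bar> / \<delta> n) powr q) \<longlonglongrightarrow> \<bar>deriv \<gamma> y\<bar> powr q"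
            using q_pos \<delta>pos by (intro tendsto_powr' tendsto_const) (auto intro!: always_eventually simp: less_imp_le)
          show "(\<lambda>n. (mu (x n (kk n)) (x n (Suc (kk n))) / \<delta> n) powr (q - 1)) \<longlonglongrightarrow> (omega y powr p) powr (q - 1)"
            using q2' omp by (intro tendsto_powr tendsto_const) auto
          show "(omega y powr p) powr (q - 1) \<noteq> 0" using omp by simp
        qed
        moreover have "\<bar>deriv \<gamma> y\<bar> powr q / (omega y powr p) powr (q - 1) = (\<bar>deriv \<gamma> y\<bar> / omega y) powr q"
        proof -
          have "p * (q - 1) = q" using q_conj by (simp add: mult.commute)
          then show ?thesis using omp by (simp add: powr_powr powr_divide)
        qed
        ultimately have "(\<lambda>n. \<phi> n y) \<longlonglongrightarrow> (\<bar>deriv \<gamma> y\<bar> / omega y) powr q" unfolding \<phi>y by (simp add: cc_def)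
        then have "(\<lambda>n. ennreal (\<phi> n y)) \<longlonglongrightarrow> ennreal ((\<bar>deriv \<gamma> y\<bar> / omega y) powr q)" by (rule tendsto_ennrealI)
        then have "liminf (\<lambda>n. ennreal (\<phi> n y)) = ennreal ((\<bar>deriv \<gamma> y\<bar> / omega y) powr q)"
          by (rule lim_imp_Liminf[OF trivial_limit_sequentially])
        then show ?thesis using True by simp
      qed simp
    qed
  qed
  have "(\<integral>\<^sup>+x. ennreal ((\<bar>deriv \<gamma> x\<bar> / omega x) powr q) * indicator {a<..<b} x \<partial>lebesgue)
     \<le> (\<integral>\<^sup>+y. liminf (\<lambda>n. ennreal (\<phi> n y)) \<partial>lebesgue)"
    by (rule nn_integral_mono_AE[OF ae])
  also have "\<dots> \<le> liminf (\<lambda>n. \<integral>\<^sup>+y. ennreal (\<phi> n y) \<partial>lebesgue)"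
    by (rule nn_integral_liminf) (use \<phi>m in simp)
  also have "\<dots> \<le> ennreal (C powr q)"
    using int\<phi> by (intro Liminf_le) (auto intro: always_eventually)
  finally show ?thesis .
qed

lemma deriv_norm_le:
  assumes db: "dual_bound \<gamma>"
  shows "Lp_inv_weight_norm I q w (\<lambda>x. ereal (deriv \<gamma> x)) \<le> ennreal C"
proof -
  obtain u l :: "nat \<Rightarrow> real" where ul: "einterval c d = (\<Union>i. {l i .. u i})" "\<And>i. l i < u i"
      "(\<lambda>n. ereal (l n)) \<longlonglongrightarrow> c" "(\<lambda>n. ereal (u n)) \<longlonglongrightarrow> d"
    by (rule einterval_Icc_approximation[OF cd]) blast
  have sub: "{l n..u n} \<subseteq> I" for n using ul(1) I by blast
  have luI: "l n \<in> I" "u n \<in> I" for n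
    using subsetD[OF sub[of n], of "l n"] subsetD[OF sub[of n], of "u n"] ul(2)[of n] by simp_all
  define f where "f x = ennreal ((\<bar>deriv \<gamma> x\<bar> / omega x) powr q)" for x
  have AC: "\<gamma> \<in> AC_loc (einterval c d)" using dual_bound_imp_AC_loc[OF db] by (simp add: I)
  have dm: "deriv \<gamma> \<in> borel_measurable (lebesgue_on I)" unfolding I by (rule AC_loc_deriv(2)[OF cd AC])
  have fm: "f \<in> borel_measurable (lebesgue_on I)" unfolding f_def[abs_def] using dm omega_meas by measurable
  have "(\<integral>\<^sup>+x. f x \<partial>lebesgue_on I) = (\<integral>\<^sup>+x. liminf (\<lambda>n. f x * indicator {l n<..<u n} x) \<partial>lebesgue_on I)"
  proof (rule nn_integral_cong)
    fix x assume "x \<in> space (lebesgue_on I)"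
    then have cx: "c < ereal x" and xd: "ereal x < d" by (auto simp: I einterval_def)
    have "eventually (\<lambda>n. ereal (l n) < ereal x) sequentially" by (rule order_tendstoD(2)[OF ul(3) cx])
    moreover have "eventually (\<lambda>n. ereal x < ereal (u n)) sequentially" by (rule order_tendstoD(1)[OF ul(4) xd])
    ultimately have "eventually (\<lambda>n. f x * indicator {l n<..<u n} x = f x) sequentially"
      by eventually_elim simp
    then have "(\<lambda>n. f x * indicator {l n<..<u n} x) \<longlonglongrightarrow> f x" by (rule tendsto_eventually)
    then show "f x = liminf (\<lambda>n. f x * indicator {l n<..<u n} x)"
      by (rule lim_imp_Liminf[OF trivial_limit_sequentially, symmetric])
  qed
  also have "\<dots> \<le> liminf (\<lambda>n. \<integral>\<^sup>+x. f x * indicator {l n<..<u n} x \<partial>lebesgue_on I)"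
  proof (rule nn_integral_liminf)
    fix n
    have "{l n<..<u n} \<subseteq> I" using sub[of n] by auto
    then show "(\<lambda>x. f x * indicator {l n<..<u n} x) \<in> borel_measurable (lebesgue_on I)"
      by (intro borel_measurable_times_ennreal fm borel_measurable_indicator) (simp add: sets_restrict_space_iff)
  qed
  also have "\<dots> \<le> ennreal (C powr q)"
  proof (intro Liminf_le always_eventually allI)
    fix n
    have "(\<integral>\<^sup>+x. f x * indicator {l n<..<u n} x \<partial>lebesgue_on I) \<le> (\<integral>\<^sup>+x. f x * indicator {l n<..<u n} x \<partial>lebesgue)"
      unfolding nn_integral_restrict_space[of I lebesgue, simplified]
      by (rule nn_integral_mono) (simp add: indicator_def)
    also have "\<dots> \<le> ennreal (C powr q)" unfolding f_def by (rule deriv_norm_Ioo_le[OF db luI ul(2)])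
    finally show "(\<integral>\<^sup>+x. f x * indicator {l n<..<u n} x \<partial>lebesgue_on I) \<le> ennreal (C powr q)" .
  qed simp
  finally have le: "(\<integral>\<^sup>+x. f x \<partial>lebesgue_on I) \<le> ennreal (C powr q)" .
  then obtain r where r: "(\<integral>\<^sup>+x. f x \<partial>lebesgue_on I) = ennreal r" "0 \<le> r"
    by (cases "\<integral>\<^sup>+x. f x \<partial>lebesgue_on I") (auto simp: top_unique)
  then have "r \<le> C powr q" using le by simp
  then have "r powr (1 / q) \<le> (C powr q) powr (1 / q)" using r q_pos by (intro powr_mono2) auto
  also have "\<dots> = C" using q_pos C_nonneg by (simp add: powr_powr)
  finally show ?thesis
    unfolding Lp_inv_weight_norm_eq f_def[symmetric] r by (simp add: ennpowr_ennreal r(2) ennreal_leI)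
qed

end

section \<open>Oscillating functions\<close>

lemma cos_has_integral:
  fixes a L :: real
  assumes "0 < L" "0 < N" "a \<le> x"
  shows "((\<lambda>y. cos (2 * pi * N * (y - a) / L)) has_integral L / (2 * pi * N) * sin (2 * pi * N * (x - a) / L)) {a..x}"
proof -
  have "((\<lambda>y. cos (2 * pi * N * (y - a) / L)) has_integral
      (L / (2 * pi * N) * sin (2 * pi * N * (x - a) / L) - L / (2 * pi * N) * sin (2 * pi * N * (a - a) / L))) {a..x}"
  proof (rule fundamental_theorem_of_calculus[OF assms(3)])
    fix y
    have "((\<lambda>y. L / (2 * pi * N) * sin (2 * pi * N * (y - a) / L)) has_real_derivative cos (2 * pi * N * (y - a) / L)) (at y within {a..x})"
      using assms by (auto intro!: derivative_eq_intros simp: field_simps)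
    then show "((\<lambda>y. L / (2 * pi * N) * sin (2 * pi * N * (y - a) / L)) has_vector_derivative cos (2 * pi * N * (y - a) / L)) (at y within {a..x})"
      by (simp add: has_real_derivative_iff_has_vector_derivative)
  qed
  then show ?thesis by simp
qed

text \<open>
  \<open>\<bar>cos\<bar> \<ge> cos\<^sup>2\<close>, and \<open>cos\<^sup>2\<close> has mean \<open>1 / 2\<close> over whole periods.
\<close>

lemma integral_abs_cos_ge:
  fixes a b :: real and N :: nat
  assumes "a < b" "0 < N"
  shows "(b - a) / 2 \<le> integral {a..b} (\<lambda>y. \<bar>cos (2 * pi * real N * (y - a) / (b - a))\<bar>)"
proof -
  have "sin (2 * pi * (2 * real N)) = 0"
    using sin_npi2[of "4 * N"] by (simp add: mult.commute mult.left_commute) 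
  moreover have "((\<lambda>y. cos (2 * pi * (2 * real N) * (y - a) / (b - a))) has_integral
      (b - a) / (2 * pi * (2 * real N)) * sin (2 * pi * (2 * real N) * (b - a) / (b - a))) {a..b}"
    by (rule cos_has_integral) (use assms in auto)
  ultimately have "((\<lambda>y. cos (2 * pi * (2 * real N) * (y - a) / (b - a))) has_integral 0) {a..b}"
    using assms by simp
  from has_integral_divide[OF has_integral_add[OF has_integral_const_real[of "1::real" a b] this], of 2]
  have "((\<lambda>y. (1 + cos (2 * pi * (2 * real N) * (y - a) / (b - a))) / 2) has_integral (b - a) / 2) {a..b}"
    using assms by simp
  moreover have "(\<lambda>y. \<bar>cos (2 * pi * real N * (y - a) / (b - a))\<bar>) integrable_on {a..b}"
    using assms by (intro integrable_continuous_real continuous_intros) auto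
  moreover have "(1 + cos (2 * pi * (2 * real N) * (y - a) / (b - a))) / 2 \<le> \<bar>cos (2 * pi * real N * (y - a) / (b - a))\<bar>" for y
  proof -
    define \<theta> where "\<theta> = 2 * pi * real N * (y - a) / (b - a)"
    have "2 * pi * (2 * real N) * (y - a) / (b - a) = 2 * \<theta>" by (simp add: \<theta>_def)
    then have "(1 + cos (2 * pi * (2 * real N) * (y - a) / (b - a))) / 2 = \<bar>cos \<theta>\<bar> * \<bar>cos \<theta>\<bar>"
      by (simp add: cos_double_cos power2_eq_square)
    also have "\<dots> \<le> \<bar>cos \<theta>\<bar> * 1" by (intro mult_left_mono) auto
    finally show ?thesis by (simp add: \<theta>_def)
  qed
  ultimately show ?thesis by (meson has_integral_le integrable_integral)
qed

context cesaro_copson begin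

text \<open>
  On the \<open>k\<close>-th interval \<open>f\<close> is a cosine with an integral number \<open>N k\<close> of periods, of \<open>L\<^sup>1\<close> norm at most
  \<open>m k\<close> and at least \<open>m k / 2\<close>. Its primitive is bounded by \<open>m k / N k\<close> and vanishes at both endpoints, so
  the norm of \<open>f\<close> is finite once the frequencies are large, whereas each interval contributes at least
  \<open>1 / 2\<close> to the integral of \<open>\<bar>f \<gamma>\<bar>\<close>. The summability assumption is local integrability of \<open>f\<close>
  up to the near end.
\<close>

lemma oscillating_function_not_integrable:
  fixes a b e m :: "nat \<Rightarrow> real"
  assumes ab: "\<And>k. a k \<in> I" "\<And>k. b k \<in> I" "\<And>k. a k < b k"
    and dj: "\<And>j k. j \<noteq> k \<Longrightarrow> {a j..b j} \<inter> {a k..b k} = {}"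
    and e: "\<And>k. 0 \<le> e k" "\<And>k x. x \<in> {a k..b k} \<Longrightarrow> e k \<le> \<bar>\<gamma> x\<bar>"
    and m: "\<And>k. 0 < m k" "\<And>k. 1 \<le> m k * e k"
    and sm: "\<And>x. x \<in> I \<Longrightarrow> summable (\<lambda>k. if {a k..b k} \<inter> I_sub I \<nu> x = {} then 0 else m k)"
    and \<gamma>m: "\<gamma> \<in> borel_measurable (lebesgue_on I)"
  obtains f where "(\<lambda>x. ereal (f x)) \<in> Ch_space I \<nu> p w"
    "(\<integral>\<^sup>+x. ennreal \<bar>f x * \<gamma> x\<bar> \<partial>lebesgue_on I) = \<infinity>"
proof -
  define M where "M k = integral {a k..b k} (\<lambda>x. omega x powr p)" for k
  have sub: "{a k..b k} \<subseteq> I" for k by (rule I_Icc[OF ab(1,2)])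
  have \<omega>i: "(\<lambda>x. omega x powr p) absolutely_integrable_on {a k..b k}" for k by (rule omega_powr_loc[OF ab(1,2)])
  have M0: "0 \<le> M k" for k
    unfolding M_def using \<omega>i[of k] by (intro Henstock_Kurzweil_Integration.integral_nonneg) (auto simp: absolutely_integrable_on_def)
  \<comment> \<open>frequencies so large that the primitives contribute at most a geometric series to the norm\<close>
  have "\<exists>N::nat. 0 < N \<and> (m k / real N) powr p * M k \<le> (1/2) ^ k" for k
  proof -
    define D where "D = (M k * 2 ^ k + 1) powr (1 / p)"
    have Bp: "0 < M k * 2 ^ k + 1" using mult_nonneg_nonneg[OF M0[of k], of "2 ^ k"] by simp
    then have Dp: "0 < D" unfolding D_def by simp
    obtain N where N: "m k * D < real N" using reals_Archimedean2 by blast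
    have "0 < m k * D" using m(1)[of k] Dp by simp
    then have Np: "0 < real N" using N by linarith
    have "m k / real N \<le> 1 / D" using N Np Dp by (simp add: field_simps)
    then have "(m k / real N) powr p \<le> (1 / D) powr p" using m(1)[of k] Np p1 by (intro powr_mono2) auto
    also have "\<dots> = 1 / (M k * 2 ^ k + 1)"
      using p1 Bp by (simp add: D_def powr_divide powr_powr)
    finally have "(m k / real N) powr p * M k \<le> 1 / (M k * 2 ^ k + 1) * M k" using M0 by (rule mult_right_mono)
    also have "\<dots> \<le> (1/2) ^ k"
    proof -
      have "M k / (M k * 2 ^ k + 1) \<le> 1 / 2 ^ k" using Bp by (simp add: divide_simps)
      then show ?thesis by (simp add: power_divide)
    qed
    finally show ?thesis using Np by (intro exI[of _ N]) simp
  qed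
  then obtain N :: "nat \<Rightarrow> nat" where Np: "\<And>k. 0 < N k" and Nb: "\<And>k. (m k / real (N k)) powr p * M k \<le> (1/2) ^ k" by metis
  define L where "L k = b k - a k" for k
  have Lp: "0 < L k" for k using ab(3) by (simp add: L_def)
  define v where "v k y = m k / L k * cos (2 * pi * real (N k) * (y - a k) / L k)" for k y
  define H where "H k x = m k / L k * (L k / (2 * pi * real (N k)) * sin (2 * pi * real (N k) * (x - a k) / L k))" for k x
  define ff where "ff k y = indicator {a k..b k} y * v k y" for k y
  define f where "f y = (\<Sum>k. ff k y)" for y
  have vint: "v k absolutely_integrable_on {a k..b k}" for k
    unfolding v_def[abs_def] using Lp[of k] by (intro absolutely_integrable_continuous_real continuous_intros) auto
  have vH: "(v k has_integral H k x) {a k..x}" if "x \<in> {a k..b k}" for k x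
    unfolding v_def[abs_def] H_def
    by (intro has_integral_mult_right cos_has_integral) (use Lp Np that in auto)
  have Hb: "H k (b k) = 0" for k
  proof -
    have "sin (2 * pi * real (N k)) = 0" using sin_npi2[of "2 * N k"] by (simp add: mult.commute mult.left_commute)
    then show ?thesis using Lp[of k] by (simp add: H_def L_def[symmetric])
  qed
  have Hle: "\<bar>H k x\<bar> \<le> m k / real (N k)" for k x
  proof -
    have "\<bar>H k x\<bar> = m k / (2 * pi * real (N k)) * \<bar>sin (2 * pi * real (N k) * (x - a k) / L k)\<bar>"
      using Lp[of k] m(1)[of k] Np[of k] by (simp add: H_def abs_mult)
    also have "\<dots> \<le> m k / (2 * pi * real (N k)) * 1" using m(1)[of k] by (intro mult_left_mono) auto
    also have "\<dots> \<le> m k / real (N k)"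
      using m(1)[of k] Np[of k] pi_gt3 by (simp add: field_simps)
    finally show ?thesis .
  qed
  have vle: "\<bar>v k y\<bar> \<le> m k / L k" for k y
  proof -
    have "\<bar>v k y\<bar> \<le> m k / L k * 1" unfolding v_def abs_mult using m(1)[of k] Lp[of k] by (intro mult_mono) auto
    then show ?thesis by simp
  qed
  have ffi: "integrable lebesgue (ff k)" for k using vint[of k] by (simp add: set_integrable_def ff_def[abs_def])
  have ff_single: "ff j y = 0" if "y \<in> {a k..b k}" "j \<noteq> k" for j k y
    using dj[OF that(2)] that(1) by (auto simp: ff_def indicator_def)
  have ff_none: "ff j y = 0" if "\<And>k. y \<notin> {a k..b k}" for j y using that[of j] by (simp add: ff_def)
  have f_in: "f y = ff k y" if "y \<in> {a k..b k}" for k y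
    unfolding f_def using suminf_finite[of "{k}" "\<lambda>j. ff j y"] ff_single[OF that] by simp
  have f_out: "f y = 0" if "\<And>k. y \<notin> {a k..b k}" for y
    unfolding f_def using ff_none[OF that] by simp
  have fin_supp: "\<exists>K. finite K \<and> (\<forall>j. j \<notin> K \<longrightarrow> ff j y = 0)" for y
  proof (cases "\<exists>k. y \<in> {a k..b k}")
    case True
    then obtain k where "y \<in> {a k..b k}" by blast
    then show ?thesis using ff_single by (intro exI[of _ "{k}"]) auto
  next
    case False
    then show ?thesis using ff_none by (intro exI[of _ "{}"]) auto
  qed
  have abs_sum: "ennreal (\<bar>f y\<bar> * r) = (\<Sum>k. ennreal (\<bar>ff k y\<bar> * r))" for y r
  proof (cases "\<exists>k. y \<in> {a k..b k}")
    case True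
    then obtain k where k: "y \<in> {a k..b k}" by blast
    have "(\<Sum>j. ennreal (\<bar>ff j y\<bar> * r)) = ennreal (\<bar>ff k y\<bar> * r)"
      using suminf_finite[of "{k}" "\<lambda>j. ennreal (\<bar>ff j y\<bar> * r)"] ff_single[OF k] by simp
    then show ?thesis using f_in[OF k] by simp
  next
    case False
    then show ?thesis using f_out[of y] ff_none[of y] by simp
  qed
  have fm: "f \<in> borel_measurable lebesgue"
    unfolding f_def[abs_def] using ffi by (intro borel_measurable_suminf) auto
  have part: "(\<integral>\<^sup>+y. ennreal \<bar>ff k y\<bar> * indicator S y \<partial>lebesgue) \<le> ennreal (if {a k..b k} \<inter> S = {} then 0 else m k)" for k S
  proof (cases "{a k..b k} \<inter> S = {}")
    case True
    have "(\<integral>\<^sup>+y. ennreal \<bar>ff k y\<bar> * indicator S y \<partial>lebesgue) = (\<integral>\<^sup>+(y::real). 0 \<partial>lebesgue)"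
      by (rule nn_integral_cong) (use True in \<open>auto simp: ff_def indicator_def\<close>)
    then show ?thesis by simp
  next
    case False
    have "(\<integral>\<^sup>+y. ennreal \<bar>ff k y\<bar> * indicator S y \<partial>lebesgue) \<le> (\<integral>\<^sup>+y. ennreal (m k / L k) * indicator {a k..b k} y \<partial>lebesgue)"
      using vle by (intro nn_integral_mono) (auto simp: ff_def indicator_def intro!: ennreal_leI)
    also have "\<dots> = ennreal (m k / L k) * ennreal (L k)"
      using Lp[of k] by (subst nn_integral_cmult_indicator) (auto simp: L_def)
    also have "\<dots> = ennreal (m k)" using Lp[of k] m(1)[of k] by (simp add: ennreal_mult[symmetric])
    finally show ?thesis using False by simp
  qed
  have loc: "(\<Sum>k. \<integral>\<^sup>+y. ennreal \<bar>ff k y\<bar> * indicator (I_sub I \<nu> x) y \<partial>lebesgue) < top" if x: "x \<in> I" for x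
  proof -
    have "(\<Sum>k. \<integral>\<^sup>+y. ennreal \<bar>ff k y\<bar> * indicator (I_sub I \<nu> x) y \<partial>lebesgue)
        \<le> (\<Sum>k. ennreal (if {a k..b k} \<inter> I_sub I \<nu> x = {} then 0 else m k))"
      by (intro suminf_le part summableI)
    also have "\<dots> < top"
      unfolding less_top[symmetric] by (rule ennreal_suminf_neq_top[OF sm[OF x]]) (use m(1) in \<open>simp add: less_imp_le\<close>)
    finally show ?thesis .
  qed
  have sums_nn: "(\<integral>\<^sup>+y. ennreal \<bar>f y\<bar> * indicator S y \<partial>lebesgue) = (\<Sum>k. \<integral>\<^sup>+y. ennreal \<bar>ff k y\<bar> * indicator S y \<partial>lebesgue)"
    if "S \<in> sets lebesgue" for S
  proof -
    have "ennreal \<bar>f y\<bar> * indicator S y = (\<Sum>k. ennreal \<bar>ff k y\<bar> * indicator S y)" for y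
      unfolding ennreal_suminf_multc abs_sum[of y 1, unfolded mult_1_right] ..
    then have "(\<integral>\<^sup>+y. ennreal \<bar>f y\<bar> * indicator S y \<partial>lebesgue) = (\<integral>\<^sup>+y. (\<Sum>k. ennreal \<bar>ff k y\<bar> * indicator S y) \<partial>lebesgue)"
      by (simp only:)
    also have "\<dots> = (\<Sum>k. \<integral>\<^sup>+y. ennreal \<bar>ff k y\<bar> * indicator S y \<partial>lebesgue)"
      using that ffi by (intro nn_integral_suminf borel_measurable_times_ennreal borel_measurable_indicator) auto
    finally show ?thesis .
  qed
  have F: "\<bar>ext_integral (I_sub I \<nu> x) (\<lambda>y. ereal (f y))\<bar> \<le> (if x \<in> {a k..b k} then m k / real (N k) else \<bar>ext_integral (I_sub I \<nu> x) (\<lambda>y. ereal (f y))\<bar>)"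
    and F0: "(\<And>k. x \<notin> {a k..b k}) \<Longrightarrow> ext_integral (I_sub I \<nu> x) (\<lambda>y. ereal (f y)) = 0" if x: "x \<in> I" for x k
  proof -
    define g where "g k y = indicator (I_sub I \<nu> x) y * ff k y" for k y
    have gi: "integrable lebesgue (g k)" for k
      unfolding g_def[abs_def] using integrable_mult_indicator[of "I_sub I \<nu> x" lebesgue "ff k"] ffi by simp
    have gae: "AE y in lebesgue. summable (\<lambda>k. norm (g k y))"
    proof (rule AE_I2)
      fix y
      obtain K where "finite K" "\<forall>j. j \<notin> K \<longrightarrow> ff j y = 0" using fin_supp by blast
      then show "summable (\<lambda>k. norm (g k y))" by (intro summable_finite[of K]) (auto simp: g_def)
    qed
    have gsum: "summable (\<lambda>k. \<integral>y. norm (g k y) \<partial>lebesgue)"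
    proof (rule summable_suminf_not_top)
      have e: "ennreal (\<integral>y. norm (g k y) \<partial>lebesgue) = (\<integral>\<^sup>+y. ennreal \<bar>ff k y\<bar> * indicator (I_sub I \<nu> x) y \<partial>lebesgue)" for k
      proof -
        have "ennreal (\<integral>y. norm (g k y) \<partial>lebesgue) = (\<integral>\<^sup>+y. ennreal (norm (g k y)) \<partial>lebesgue)"
          by (rule nn_integral_eq_integral[symmetric, OF integrable_norm[OF gi]]) simp
        also have "\<dots> = (\<integral>\<^sup>+y. ennreal \<bar>ff k y\<bar> * indicator (I_sub I \<nu> x) y \<partial>lebesgue)"
          by (rule nn_integral_cong) (simp add: g_def indicator_def)
        finally show ?thesis .
      qed
      show "(\<Sum>k. ennreal (\<integral>y. norm (g k y) \<partial>lebesgue)) \<noteq> top"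
        unfolding e by (rule less_imp_neq[OF loc[OF x]])
    qed simp
    have "ext_integral (I_sub I \<nu> x) (\<lambda>y. ereal (f y)) = (\<integral>y. (\<Sum>k. g k y) \<partial>lebesgue)"
    proof -
      have "ext_integral (I_sub I \<nu> x) (\<lambda>y. ereal (f y)) = (\<integral>y. indicator (I_sub I \<nu> x) y * f y \<partial>lebesgue)"
        by (simp add: ext_integral_def integral_restrict_space)
      also have "\<dots> = (\<integral>y. (\<Sum>k. g k y) \<partial>lebesgue)"
        by (intro Bochner_Integration.integral_cong) (auto simp: g_def f_def indicator_def)
      finally show ?thesis .
    qed
    also have "\<dots> = (\<Sum>k. \<integral>y. g k y \<partial>lebesgue)" by (rule integral_suminf[OF gi gae gsum])
    finally have eq: "ext_integral (I_sub I \<nu> x) (\<lambda>y. ereal (f y)) = (\<Sum>k. \<integral>y. g k y \<partial>lebesgue)" .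
    have gk: "\<bar>\<integral>y. g k y \<partial>lebesgue\<bar> = \<bar>H k x\<bar> * indicator {a k..b k} x" for k
      using I_sub_integral_compact_support[OF ab(1,2) less_imp_le[OF ab(3)] vint vH Hb x, of k]
      by (simp add: g_def ff_def set_lebesgue_integral_def indicator_inter_arith mult.assoc)
    show "ext_integral (I_sub I \<nu> x) (\<lambda>y. ereal (f y)) = 0" if "\<And>k. x \<notin> {a k..b k}"
    proof -
      have "(\<integral>y. g k y \<partial>lebesgue) = 0" for k using gk[of k] that[of k] by simp
      then show ?thesis by (simp add: eq)
    qed
    show "\<bar>ext_integral (I_sub I \<nu> x) (\<lambda>y. ereal (f y))\<bar> \<le> (if x \<in> {a k..b k} then m k / real (N k) else \<bar>ext_integral (I_sub I \<nu> x) (\<lambda>y. ereal (f y))\<bar>)"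
    proof (cases "x \<in> {a k..b k}")
      case True
      have "(\<integral>y. g j y \<partial>lebesgue) = 0" if "j \<noteq> k" for j
      proof -
        have "x \<notin> {a j..b j}" using dj[OF that] True by blast
        then show ?thesis using gk[of j] by simp
      qed
      then have "(\<Sum>j. \<integral>y. g j y \<partial>lebesgue) = (\<integral>y. g k y \<partial>lebesgue)"
        using suminf_finite[of "{k}" "\<lambda>j. \<integral>y. g j y \<partial>lebesgue"] by simp
      then show ?thesis using eq gk[of k] True Hle[of k x] by simp
    next
      case False
      show ?thesis unfolding if_not_P[OF False] by (rule order_refl)
    qed
  qed
  have "(\<lambda>x. ereal (f x)) \<in> L1_loc_1 I \<nu>"
    unfolding L1_loc_1_def measurable_funs_def
  proof (intro CollectI conjI ballI)
    show "(\<lambda>x. ereal (f x)) \<in> borel_measurable (lebesgue_on I)"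
      by (intro measurable_restrict_space1 borel_measurable_ereal fm)
    fix x assume x: "x \<in> I"
    have "(\<integral>\<^sup>+ y. e2ennreal \<bar>ereal (f y)\<bar> \<partial>lebesgue_on (I_sub I \<nu> x)) = (\<integral>\<^sup>+y. ennreal \<bar>f y\<bar> * indicator (I_sub I \<nu> x) y \<partial>lebesgue)"
      by (simp add: nn_integral_restrict_space e2ennreal_ereal)
    then show "(\<integral>\<^sup>+ y. e2ennreal \<bar>ereal (f y)\<bar> \<partial>lebesgue_on (I_sub I \<nu> x)) < \<infinity>"
      unfolding infinity_ennreal_def using sums_nn[OF I_sub_sets(1), of x] loc[OF x] by (simp only:)
  qed
  moreover have "Ch_norm I \<nu> p w (\<lambda>x. ereal (f x)) < \<infinity>"
  proof -
    define \<Psi> where "\<Psi> k x = ennreal ((m k / real (N k)) powr p) * (ennreal (omega x powr p) * indicator {a k..b k} x)" for k x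
    have indm: "(\<lambda>x. ennreal (omega x powr p) * indicator {a k..b k} x) \<in> borel_measurable (lebesgue_on I)" for k
      using sub[of k] omega_meas
      by (intro borel_measurable_times_ennreal borel_measurable_indicator) (auto simp: sets_restrict_space_iff)
    have "(\<integral>\<^sup>+x. ennreal ((omega x * \<bar>ext_integral (I_sub I \<nu> x) (\<lambda>y. ereal (f y))\<bar>) powr p) \<partial>lebesgue_on I)
        \<le> (\<integral>\<^sup>+x. (\<Sum>k. \<Psi> k x) \<partial>lebesgue_on I)"
    proof (rule nn_integral_mono_AE)
      have "AE x in lebesgue_on I. x \<in> I" by (rule AE_I2) simp
      with omega_ae show "AE x in lebesgue_on I. ennreal ((omega x * \<bar>ext_integral (I_sub I \<nu> x) (\<lambda>y. ereal (f y))\<bar>) powr p) \<le> (\<Sum>k. \<Psi> k x)"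
      proof eventually_elim
        fix x assume om: "0 < omega x \<and> w x = ereal (omega x)" and x: "x \<in> I"
        show "ennreal ((omega x * \<bar>ext_integral (I_sub I \<nu> x) (\<lambda>y. ereal (f y))\<bar>) powr p) \<le> (\<Sum>k. \<Psi> k x)"
        proof (cases "\<exists>k. x \<in> {a k..b k}")
          case True
          then obtain k where k: "x \<in> {a k..b k}" by blast
          have "\<bar>ext_integral (I_sub I \<nu> x) (\<lambda>y. ereal (f y))\<bar> \<le> m k / real (N k)"
            using F[OF x, of k] k by simp
          then have "(omega x * \<bar>ext_integral (I_sub I \<nu> x) (\<lambda>y. ereal (f y))\<bar>) powr p \<le> (omega x * (m k / real (N k))) powr p"
            using om p1 by (intro powr_mono2 mult_left_mono) auto
          also have "\<dots> = (m k / real (N k)) powr p * omega x powr p"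
            using om m(1)[of k] by (subst powr_mult) (auto simp: less_imp_le)
          finally have "ennreal ((omega x * \<bar>ext_integral (I_sub I \<nu> x) (\<lambda>y. ereal (f y))\<bar>) powr p) \<le> \<Psi> k x"
            using k by (simp add: \<Psi>_def ennreal_mult[symmetric] ennreal_leI)
          also have "\<dots> \<le> (\<Sum>k. \<Psi> k x)" using sum_le_suminf[of "\<lambda>k. \<Psi> k x" "{k}"] by simp
          finally show ?thesis .
        next
          case False
          then show ?thesis using F0[OF x] by simp
        qed
      qed
    qed
    also have "\<dots> = (\<Sum>k. \<integral>\<^sup>+x. \<Psi> k x \<partial>lebesgue_on I)"
    proof (rule nn_integral_suminf)
      show "\<Psi> k \<in> borel_measurable (lebesgue_on I)" for k
        unfolding \<Psi>_def[abs_def] by (rule borel_measurable_times_ennreal[OF borel_measurable_const indm])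
    qed
    also have "\<dots> \<le> (\<Sum>k. ennreal ((1/2) ^ k))"
    proof (intro suminf_le summableI)
      fix k
      have "(\<integral>\<^sup>+x. \<Psi> k x \<partial>lebesgue_on I) = ennreal ((m k / real (N k)) powr p) * (\<integral>\<^sup>+x. ennreal (omega x powr p) * indicator {a k..b k} x \<partial>lebesgue_on I)"
        unfolding \<Psi>_def by (rule nn_integral_cmult[OF indm])
      also have "(\<integral>\<^sup>+x. ennreal (omega x powr p) * indicator {a k..b k} x \<partial>lebesgue_on I) = (\<integral>\<^sup>+x. ennreal (indicator {a k..b k} x * omega x powr p) \<partial>lebesgue)"
        unfolding nn_integral_restrict_space[of I lebesgue, simplified]
        using sub[of k] by (intro nn_integral_cong) (auto simp: indicator_def)
      also have "\<dots> = ennreal (M k)"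
        using \<omega>i[of k] set_lebesgue_integral_eq_integral(2)[OF \<omega>i[of k]]
        by (subst nn_integral_eq_integral) (auto simp: set_integrable_def set_lebesgue_integral_def M_def)
      also have "ennreal ((m k / real (N k)) powr p) * ennreal (M k) \<le> ennreal ((1/2) ^ k)"
        using Nb[of k] M0[of k] by (simp add: ennreal_mult[symmetric] ennreal_leI)
      finally show "(\<integral>\<^sup>+x. \<Psi> k x \<partial>lebesgue_on I) \<le> ennreal ((1/2) ^ k)" .
    qed
    also have "\<dots> < top"
      unfolding less_top[symmetric] by (rule ennreal_suminf_neq_top) (auto intro: summable_geometric)
    finally show ?thesis unfolding Ch_norm_eq ennpowr_def by (auto simp: less_top)
  qed
  ultimately have Ch: "(\<lambda>x. ereal (f x)) \<in> Ch_space I \<nu> p w" by (simp add: Ch_space_def)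
  have "(\<integral>\<^sup>+x. ennreal \<bar>f x * \<gamma> x\<bar> \<partial>lebesgue_on I) = \<infinity>"
  proof -
    have ffm: "ff k \<in> borel_measurable (lebesgue_on I)" for k
      using ffi[of k] by (intro measurable_restrict_space1) auto
    have "(\<integral>\<^sup>+x. ennreal \<bar>f x * \<gamma> x\<bar> \<partial>lebesgue_on I) = (\<integral>\<^sup>+x. (\<Sum>k. ennreal (\<bar>ff k x\<bar> * \<bar>\<gamma> x\<bar>)) \<partial>lebesgue_on I)"
      by (simp only: abs_mult abs_sum)
    also have "\<dots> = (\<Sum>k. \<integral>\<^sup>+x. ennreal (\<bar>ff k x\<bar> * \<bar>\<gamma> x\<bar>) \<partial>lebesgue_on I)"
      using ffm \<gamma>m by (intro nn_integral_suminf) auto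
    also have "\<dots> \<ge> (\<Sum>k. ennreal (1 / 2))"
    proof (intro suminf_le summableI)
      fix k
      have ci: "(\<lambda>y. \<bar>cos (2 * pi * real (N k) * (y - a k) / L k)\<bar>) absolutely_integrable_on {a k..b k}"
        using Lp[of k] by (intro absolutely_integrable_continuous_real continuous_intros) auto
      have "1 / 2 \<le> e k * (m k / L k) * ((b k - a k) / 2)"
        using m(2)[of k] Lp[of k] by (simp add: L_def[symmetric] mult.commute)
      also have "\<dots> \<le> e k * (m k / L k) * integral {a k..b k} (\<lambda>y. \<bar>cos (2 * pi * real (N k) * (y - a k) / L k)\<bar>)"
        using integral_abs_cos_ge[OF ab(3) Np, of k] e(1)[of k] m(1)[of k] Lp[of k]
        by (intro mult_left_mono) (auto simp: L_def)
      finally have "ennreal (1 / 2) \<le> ennreal (e k * (m k / L k) * integral {a k..b k} (\<lambda>y. \<bar>cos (2 * pi * real (N k) * (y - a k) / L k)\<bar>))"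
        by (rule ennreal_leI)
      also have "\<dots> = (\<integral>\<^sup>+y. ennreal (e k * (m k / L k)) * ennreal (indicator {a k..b k} y * \<bar>cos (2 * pi * real (N k) * (y - a k) / L k)\<bar>) \<partial>lebesgue)"
      proof -
        define cs where "cs y = \<bar>cos (2 * pi * real (N k) * (y - a k) / L k)\<bar>" for y
        have ci': "cs absolutely_integrable_on {a k..b k}" using ci by (simp add: cs_def[abs_def])
        have "ennreal (integral {a k..b k} cs) = (\<integral>\<^sup>+y. ennreal (indicator {a k..b k} y * cs y) \<partial>lebesgue)"
        proof -
          have "integral {a k..b k} cs = (\<integral>y. indicator {a k..b k} y * cs y \<partial>lebesgue)"
            using set_lebesgue_integral_eq_integral(2)[OF ci'] by (simp add: set_lebesgue_integral_def)
          moreover have "integrable lebesgue (\<lambda>y. indicator {a k..b k} y * cs y)"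
            using ci' by (simp add: set_integrable_def)
          ultimately show ?thesis
            using nn_integral_eq_integral[of lebesgue "\<lambda>y. indicator {a k..b k} y * cs y"] by (simp add: cs_def)
        qed
        moreover have "(\<lambda>y. ennreal (indicator {a k..b k} y * cs y)) \<in> borel_measurable lebesgue"
          using ci' by (intro measurable_compose[OF _ measurable_ennreal]) (auto simp: set_integrable_def)
        moreover have "0 \<le> e k * (m k / L k)" using e(1)[of k] m(1)[of k] Lp[of k] by simp
        ultimately have "ennreal (e k * (m k / L k) * integral {a k..b k} cs)
            = (\<integral>\<^sup>+y. ennreal (e k * (m k / L k)) * ennreal (indicator {a k..b k} y * cs y) \<partial>lebesgue)"
          by (simp only: nn_integral_cmult ennreal_mult')
        then show ?thesis by (simp only: cs_def[abs_def])
      qed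
      also have "\<dots> \<le> (\<integral>\<^sup>+x. ennreal (\<bar>ff k x\<bar> * \<bar>\<gamma> x\<bar>) \<partial>lebesgue_on I)"
        unfolding nn_integral_restrict_space[of I lebesgue, simplified]
      proof (rule nn_integral_mono)
        fix y
        show "ennreal (e k * (m k / L k)) * ennreal (indicator {a k..b k} y * \<bar>cos (2 * pi * real (N k) * (y - a k) / L k)\<bar>)
           \<le> ennreal (\<bar>ff k y\<bar> * \<bar>\<gamma> y\<bar>) * indicator I y"
        proof (cases "y \<in> {a k..b k}")
          case True
          have "e k * (m k / L k) * \<bar>cos (2 * pi * real (N k) * (y - a k) / L k)\<bar> = \<bar>ff k y\<bar> * e k"
            using True m(1)[of k] Lp[of k] by (simp add: ff_def v_def abs_mult)
          also have "\<dots> \<le> \<bar>ff k y\<bar> * \<bar>\<gamma> y\<bar>" using e(2)[OF True] by (intro mult_left_mono) auto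
          finally have "ennreal (e k * (m k / L k) * \<bar>cos (2 * pi * real (N k) * (y - a k) / L k)\<bar>) \<le> ennreal (\<bar>ff k y\<bar> * \<bar>\<gamma> y\<bar>)"
            by (rule ennreal_leI)
          moreover have "y \<in> I" using True sub by blast
          moreover have "0 \<le> e k * (m k / L k)" using e(1)[of k] m(1)[of k] Lp[of k] by simp
          ultimately show ?thesis using True by (simp only: ennreal_mult'[symmetric] indicator_simps mult_1 mult_1_right)
        qed simp
      qed
      finally show "ennreal (1 / 2) \<le> (\<integral>\<^sup>+x. ennreal (\<bar>ff k x\<bar> * \<bar>\<gamma> x\<bar>) \<partial>lebesgue_on I)" .
    qed
    finally have "(\<Sum>k::nat. ennreal (1 / 2)) \<le> (\<integral>\<^sup>+x. ennreal \<bar>f x * \<gamma> x\<bar> \<partial>lebesgue_on I)" .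
    moreover have "(\<Sum>k::nat. ennreal (1 / 2)) = \<infinity>"
    proof (rule ccontr)
      assume "(\<Sum>k::nat. ennreal (1 / 2)) \<noteq> \<infinity>"
      then have "summable (\<lambda>k::nat. 1 / 2 :: real)" by (intro summable_suminf_not_top) auto
      then show False by (simp add: summable_const_iff)
    qed
    ultimately show ?thesis by (simp add: top_unique)
  qed
  with Ch show thesis by (rule that)
qed

end

section \<open>Boundedness, vanishing and the characterisation\<close>

context cesaro_copson_dual begin

lemma no_oscillation:
  fixes a b e m :: "nat \<Rightarrow> real"
  assumes \<gamma>: "\<gamma> \<in> borel_measurable (lebesgue_on I)" and ae: "AE x in lebesgue_on I. g x = ereal (\<gamma> x)"
    and ab: "\<And>k. a k \<in> I" "\<And>k. b k \<in> I" "\<And>k. a k < b k"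
    and dj: "\<And>j k. j \<noteq> k \<Longrightarrow> {a j..b j} \<inter> {a k..b k} = {}"
    and e: "\<And>k. 0 \<le> e k" "\<And>k x. x \<in> {a k..b k} \<Longrightarrow> e k \<le> \<bar>\<gamma> x\<bar>"
    and m: "\<And>k. 0 < m k" "\<And>k. 1 \<le> m k * e k"
    and sm: "\<And>x. x \<in> I \<Longrightarrow> summable (\<lambda>k. if {a k..b k} \<inter> I_sub I \<nu> x = {} then 0 else m k)"
  shows False
proof -
  obtain f where f: "(\<lambda>x. ereal (f x)) \<in> Ch_space I \<nu> p w"
    and inf: "(\<integral>\<^sup>+x. ennreal \<bar>f x * \<gamma> x\<bar> \<partial>lebesgue_on I) = \<infinity>"
    by (rule oscillating_function_not_integrable[of a b e \<gamma> m, OF ab dj e m sm \<gamma>]) blast+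
  have "(\<integral>\<^sup>+x. ennreal \<bar>f x * \<gamma> x\<bar> \<partial>lebesgue_on I) = (\<integral>\<^sup>+x. e2ennreal \<bar>ereal (f x) * g x\<bar> \<partial>lebesgue_on I)"
    by (rule nn_integral_cong_AE, use ae in eventually_elim) (simp add: e2ennreal_ereal)
  also have "\<dots> < \<infinity>" using J_bound(1)[OF f] by (simp add: ext_integrable_on_def)
  finally show False using inf by simp
qed

lemma continuous_on_nbhd_Icc:
  assumes cont: "continuous_on I \<gamma>" and V: "open V" "V \<subseteq> I" "x \<in> V" and "0 < (\<eta> :: real)"
  shows "\<exists>a b. a < b \<and> a \<in> I \<and> b \<in> I \<and> {a..b} \<subseteq> V \<and> (\<forall>y\<in>{a..b}. \<bar>\<gamma> y - \<gamma> x\<bar> < \<eta>)"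
proof -
  have "isCont \<gamma> x" using cont V I_open by (meson continuous_on_eq_continuous_at subsetD)
  then obtain \<delta> where \<delta>: "0 < \<delta>" "\<And>y. dist y x < \<delta> \<Longrightarrow> dist (\<gamma> y) (\<gamma> x) < \<eta>"
    using \<open>0 < \<eta>\<close> unfolding continuous_at_eps_delta by blast
  obtain r where r: "0 < r" "cball x r \<subseteq> V" using V open_contains_cball by blast
  define \<rho> where "\<rho> = min r (\<delta> / 2)"
  have \<rho>: "0 < \<rho>" "\<rho> \<le> r" "\<rho> < \<delta>" using r \<delta> by (auto simp: \<rho>_def)
  have sub: "{x - \<rho>..x + \<rho>} \<subseteq> V" using r(2) \<rho> by (auto simp: cball_eq_atLeastAtMost subset_eq)
  moreover have "x - \<rho> \<in> I" "x + \<rho> \<in> I"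
    using subsetD[OF sub, of "x - \<rho>"] subsetD[OF sub, of "x + \<rho>"] V(2) \<rho> by auto
  moreover have "\<bar>\<gamma> y - \<gamma> x\<bar> < \<eta>" if "y \<in> {x - \<rho>..x + \<rho>}" for y
    using \<delta>(2)[of y] that \<rho> by (auto simp: dist_real_def)
  ultimately show ?thesis using \<rho>(1) by (intro exI[of _ "x - \<rho>"] exI[of _ "x + \<rho>"]) auto
qed

text \<open>
  If \<open>\<gamma>\<close> is unbounded, small intervals around points with rapidly growing values
  of \<open>\<bar>\<gamma>\<bar>\<close> carry the oscillation, with summable masses. They are disjoint since the values of \<open>\<bar>\<gamma>\<bar>\<close> on them
  are: these stay within distance \<open>1\<close> of centers that are more than \<open>2\<close> apart.
\<close>

lemma version_bounded:
  assumes cont: "continuous_on I \<gamma>" and ae: "AE x in lebesgue_on I. g x = ereal (\<gamma> x)"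
  shows "\<exists>B. \<forall>x\<in>I. \<bar>\<gamma> x\<bar> \<le> B"
proof (rule ccontr)
  assume "\<not> ?thesis"
  then have "\<forall>B. \<exists>x. x \<in> I \<and> B < \<bar>\<gamma> x\<bar>" by (meson not_le)
  then obtain X where X: "\<And>B. X B \<in> I" "\<And>B. B < \<bar>\<gamma> (X B)\<bar>" by metis
  define y where "y = rec_nat (X 2) (\<lambda>k z. X (\<bar>\<gamma> z\<bar> + 2 + 2 ^ Suc k))"
  have y0: "y 0 = X 2" and yS: "\<And>k. y (Suc k) = X (\<bar>\<gamma> (y k)\<bar> + 2 + 2 ^ Suc k)" by (simp_all add: y_def)
  have yI: "y k \<in> I" for k by (cases k) (simp_all add: y0 yS X)
  have large: "2 ^ k + 1 < \<bar>\<gamma> (y k)\<bar>" for k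
  proof (cases k)
    case 0
    then show ?thesis using X(2)[of 2] by (simp add: y0)
  next
    case (Suc j)
    then show ?thesis using X(2)[of "\<bar>\<gamma> (y j)\<bar> + 2 + 2 ^ Suc j"] by (simp add: yS)
  qed
  have gapS: "\<bar>\<gamma> (y k)\<bar> + 2 < \<bar>\<gamma> (y (Suc k))\<bar>" for k
  proof -
    have "(0::real) < 2 ^ Suc k" by simp
    then show ?thesis using X(2)[of "\<bar>\<gamma> (y k)\<bar> + 2 + 2 ^ Suc k"] unfolding yS by linarith
  qed
  have gap: "\<bar>\<gamma> (y j)\<bar> + 2 < \<bar>\<gamma> (y k)\<bar>" if "j < k" for j k
    using that
  proof (induction k)
    case (Suc k)
    then show ?case using gapS[of k] by (cases "j = k") auto
  qed simp
  have "\<exists>a b. a < b \<and> a \<in> I \<and> b \<in> I \<and> {a..b} \<subseteq> I \<and> (\<forall>z\<in>{a..b}. \<bar>\<gamma> z - \<gamma> (y k)\<bar> < 1)" for k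
    by (rule continuous_on_nbhd_Icc[OF cont I_open subset_refl yI]) simp
  then obtain a b where ab: "\<And>k. a k < b k" "\<And>k. a k \<in> I" "\<And>k. b k \<in> I"
    and near: "\<And>k z. z \<in> {a k..b k} \<Longrightarrow> \<bar>\<gamma> z - \<gamma> (y k)\<bar> < 1" by metis
  have dj: "{a j..b j} \<inter> {a k..b k} = {}" if "j < k" for j k
  proof (rule ccontr)
    assume "\<not> ?thesis"
    then obtain z where z: "z \<in> {a j..b j}" "z \<in> {a k..b k}" by blast
    then show False using near[OF z(1)] near[OF z(2)] gap[OF that] by linarith
  qed
  show False
  proof (rule no_oscillation[of \<gamma> a b "\<lambda>k. 2 ^ k" "\<lambda>k. (1/2) ^ k", OF _ ae ab(2,3,1)])
    show "\<gamma> \<in> borel_measurable (lebesgue_on I)" by (rule continuous_imp_measurable_on_sets_lebesgue[OF cont I_sets])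
    show "{a j..b j} \<inter> {a k..b k} = {}" if "j \<noteq> k" for j k
      using dj[of j k] dj[of k j] that by (cases "j < k") auto
    show "2 ^ k \<le> \<bar>\<gamma> x\<bar>" if "x \<in> {a k..b k}" for k x using near[OF that] large[of k] by linarith
    show "summable (\<lambda>k. if {a k..b k} \<inter> I_sub I \<nu> x = {} then 0 else (1/2::real) ^ k)" for x
      by (rule summable_comparison_test[OF _ summable_geometric[of "1/2::real"]]) auto
  qed (simp_all add: power_one_over)
qed

text \<open>
  If \<open>\<gamma>\<close> has nonzero values arbitrarily close to the far end, the masses may be taken as large as
  the values require: intervals that move to the far end meet each \<open>I_sub I \<nu> x\<close> only finitely
  often. The points \<open>Bs k\<close> pass all intervals chosen so far and exhaust \<open>I\<close>.
\<close>

lemma version_vanishes_eventually: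
  assumes cont: "continuous_on I \<gamma>" and ae: "AE x in lebesgue_on I. g x = ereal (\<gamma> x)"
  obtains b where "b \<in> I" "\<And>x. x \<in> I \<Longrightarrow> x \<notin> I_sub I \<nu> b \<Longrightarrow> \<gamma> x = 0"
proof -
  have "\<exists>b\<in>I. \<forall>x\<in>I. x \<notin> I_sub I \<nu> b \<longrightarrow> \<gamma> x = 0"
  proof (rule ccontr)
    assume "\<not> ?thesis"
    then have far: "\<exists>x. x \<in> I \<and> x \<notin> I_sub I \<nu> B \<and> \<gamma> x \<noteq> 0" if "B \<in> I" for B using that by blast
    have "\<exists>a b e. a < b \<and> a \<in> I \<and> b \<in> I \<and> {a..b} \<inter> I_sub I \<nu> B = {} \<and> 0 < e \<and> (\<forall>y\<in>{a..b}. e \<le> \<bar>\<gamma> y\<bar>)"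
      if B: "B \<in> I" for B
    proof -
      obtain x where x: "x \<in> I" "x \<notin> I_sub I \<nu> B" "\<gamma> x \<noteq> 0" using far[OF B] by blast
      have eq: "I - I_sub I \<nu> B = (if \<nu> = 1 then I \<inter> {B<..} else I \<inter> {..<B})" by (auto simp: I_sub_def)
      have op: "open (I - I_sub I \<nu> B)" unfolding eq using I_open by auto
      obtain a b where "a < b" "a \<in> I" "b \<in> I" "{a..b} \<subseteq> I - I_sub I \<nu> B"
        and near: "\<forall>y\<in>{a..b}. \<bar>\<gamma> y - \<gamma> x\<bar> < \<bar>\<gamma> x\<bar> / 2"
        using continuous_on_nbhd_Icc[OF cont op, of x "\<bar>\<gamma> x\<bar> / 2"] x by auto
      moreover have "\<bar>\<gamma> x\<bar> / 2 \<le> \<bar>\<gamma> y\<bar>" if "y \<in> {a..b}" for y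
      proof -
        have "\<bar>\<gamma> y - \<gamma> x\<bar> < \<bar>\<gamma> x\<bar> / 2" using near that by blast
        moreover have "\<bar>\<gamma> x\<bar> \<le> \<bar>\<gamma> y\<bar> + \<bar>\<gamma> y - \<gamma> x\<bar>" by linarith
        ultimately show ?thesis by linarith
      qed
      ultimately show ?thesis using x(3)
        by (intro exI[of _ a] exI[of _ b] exI[of _ "\<bar>\<gamma> x\<bar> / 2"]) auto
    qed
    then have "\<forall>B. \<exists>a b e. B \<in> I \<longrightarrow> a < b \<and> a \<in> I \<and> b \<in> I \<and> {a..b} \<inter> I_sub I \<nu> B = {} \<and> 0 < e \<and> (\<forall>y\<in>{a..b}. e \<le> \<bar>\<gamma> y\<bar>)"
      by blast
    then obtain fa fb fe where sel: "\<And>B. B \<in> I \<Longrightarrow> fa B < fb B \<and> fa B \<in> I \<and> fb B \<in> I \<and> {fa B..fb B} \<inter> I_sub I \<nu> B = {}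
        \<and> 0 < fe B \<and> (\<forall>y\<in>{fa B..fb B}. fe B \<le> \<bar>\<gamma> y\<bar>)"
      by metis
    obtain u l :: "nat \<Rightarrow> real" where ul: "einterval c d = (\<Union>i. {l i .. u i})" "\<And>i. l i < u i" "incseq u" "decseq l"
      by (rule einterval_Icc_approximation[OF cd]) blast
    have lusub: "{l n..u n} \<subseteq> I" for n using ul(1) I by blast
    define z where "z n = (if \<nu> = 1 then u n else l n)" for n
    have zI: "z n \<in> I" for n
      using subsetD[OF lusub[of n], of "l n"] subsetD[OF lusub[of n], of "u n"] ul(2)[of n] by (simp add: z_def)
    \<comment> \<open>the one of two points that is closer to the far end\<close>
    define jn where "jn s t = (if \<nu> = 1 then max s t else min s t)" for s t :: real
    have jnI: "jn s t \<in> I" if "s \<in> I" "t \<in> I" for s t using that by (simp add: jn_def max_def min_def)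
    have jnsub: "I_sub I \<nu> s \<subseteq> I_sub I \<nu> (jn s t)" "I_sub I \<nu> t \<subseteq> I_sub I \<nu> (jn s t)" for s t
      by (auto simp: I_sub_def jn_def)
    \<comment> \<open>the endpoint of the chosen interval that is closer to the far end\<close>
    define en where "en B = (if \<nu> = 1 then fb B else fa B)" for B
    define Bs where "Bs = rec_nat (z 0) (\<lambda>k B. jn (jn B (z (Suc k))) (en B))"
    have Bs0: "Bs 0 = z 0" and BsS: "\<And>k. Bs (Suc k) = jn (jn (Bs k) (z (Suc k))) (en (Bs k))" by (simp_all add: Bs_def)
    have BI: "Bs k \<in> I" for k
    proof (induction k)
      case (Suc k)
      then have "en (Bs k) \<in> I" using sel[of "Bs k"] by (simp add: en_def)
      then show ?case unfolding BsS by (intro jnI Suc zI)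
    qed (simp add: Bs0 zI)
    note s = sel[OF BI]
    have "I_sub I \<nu> (Bs k) \<subseteq> I_sub I \<nu> (Bs (Suc k))" for k
      unfolding BsS using jnsub by blast
    then have mono: "I_sub I \<nu> (Bs j) \<subseteq> I_sub I \<nu> (Bs k)" if "j \<le> k" for j k
      using lift_Suc_mono_le[of "\<lambda>k. I_sub I \<nu> (Bs k)"] that by blast
    have zB: "I_sub I \<nu> (z k) \<subseteq> I_sub I \<nu> (Bs k)" for k
    proof (cases k)
      case (Suc j)
      then show ?thesis unfolding Suc BsS using jnsub by blast
    qed (simp add: Bs0)
    have JB: "{fa (Bs k)..fb (Bs k)} \<subseteq> I_sub I \<nu> (Bs (Suc k))" for k
    proof -
      have "{fa (Bs k)..fb (Bs k)} \<subseteq> I" using s[of k] by (intro I_Icc) auto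
      then have "{fa (Bs k)..fb (Bs k)} \<subseteq> I_sub I \<nu> (en (Bs k))" by (auto simp: I_sub_def en_def)
      then show ?thesis unfolding BsS using jnsub(2) by blast
    qed
    have dj: "{fa (Bs j)..fb (Bs j)} \<inter> {fa (Bs k)..fb (Bs k)} = {}" if "j < k" for j k
    proof -
      have "{fa (Bs j)..fb (Bs j)} \<subseteq> I_sub I \<nu> (Bs k)" using JB[of j] mono[of "Suc j" k] that by auto
      then show ?thesis using s[of k] by blast
    qed
    show False
    proof (rule no_oscillation[of \<gamma> "\<lambda>k. fa (Bs k)" "\<lambda>k. fb (Bs k)" "\<lambda>k. fe (Bs k)" "\<lambda>k. 1 / fe (Bs k)", OF _ ae])
      show "\<gamma> \<in> borel_measurable (lebesgue_on I)" by (rule continuous_imp_measurable_on_sets_lebesgue[OF cont I_sets])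
      show "{fa (Bs j)..fb (Bs j)} \<inter> {fa (Bs k)..fb (Bs k)} = {}" if "j \<noteq> k" for j k
        using dj[of j k] dj[of k j] that by (cases "j < k") auto
      show "fe (Bs k) \<le> \<bar>\<gamma> x\<bar>" if "x \<in> {fa (Bs k)..fb (Bs k)}" for k x using s[of k] that by blast
      show "0 \<le> fe (Bs k)" "0 < 1 / fe (Bs k)" "1 \<le> 1 / fe (Bs k) * fe (Bs k)" for k using s[of k] by auto
      show "summable (\<lambda>k. if {fa (Bs k)..fb (Bs k)} \<inter> I_sub I \<nu> x = {} then 0 else 1 / fe (Bs k))" if x: "x \<in> I" for x
      proof -
        obtain n where n: "x \<in> {l n..u n}" using x ul(1) I by auto
        have "{fa (Bs k)..fb (Bs k)} \<inter> I_sub I \<nu> x = {}" if "n \<le> k" for k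
        proof -
          have "u n \<le> u k" "l k \<le> l n" using ul(3,4) that by (auto simp: incseq_def decseq_def)
          then have "I_sub I \<nu> x \<subseteq> I_sub I \<nu> (z k)" using n by (auto simp: I_sub_def z_def)
          then show ?thesis using zB[of k] s[of k] by blast
        qed
        then show ?thesis by (intro summable_finite[of "{..<n}"]) (auto simp: not_less)
      qed
    qed (use s in auto)
  qed
  then show thesis using that by blast
qed

lemma representative_exists:
  obtains \<gamma> where "Ch_representative I \<nu> p w g \<gamma>"
    "Lp_inv_weight_norm I q w (\<lambda>x. ereal (deriv \<gamma> x)) \<le> ennreal C"
proof -
  obtain \<gamma> where db: "dual_bound \<gamma>" and ae0: "AE x in lebesgue_on I. g_real x = \<gamma> x"
    by (rule dual_bound_version) blast
  have ae: "AE x in lebesgue_on I. g x = ereal (\<gamma> x)"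
    using ae0 g_real_ae by eventually_elim simp
  have AC: "\<gamma> \<in> AC_loc I" by (rule dual_bound_imp_AC_loc[OF db])
  have AC': "\<gamma> \<in> AC_loc (einterval c d)" using AC by (simp add: I)
  have cont: "continuous_on I \<gamma>" unfolding I by (rule AC_loc_einterval_continuous_on[OF AC'])
  have norm: "Lp_inv_weight_norm I q w (\<lambda>x. ereal (deriv \<gamma> x)) \<le> ennreal C" by (rule deriv_norm_le[OF db])
  obtain B where B: "\<And>x. x \<in> I \<Longrightarrow> \<bar>\<gamma> x\<bar> \<le> B" using version_bounded[OF cont ae] by blast
  obtain b0 where b0: "b0 \<in> I" "\<And>x. x \<in> I \<Longrightarrow> x \<notin> I_sub I \<nu> b0 \<Longrightarrow> \<gamma> x = 0"
    by (rule version_vanishes_eventually[OF cont ae]) blast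
  \<comment> \<open>moving the point a little towards the far end makes \<open>\<gamma>\<close> vanish at the point itself\<close>
  obtain r where r: "0 < r" "cball b0 r \<subseteq> I" using I_open b0(1) open_contains_cball by blast
  define b where "b = (if \<nu> = 1 then b0 + r else b0 - r)"
  have bI: "b \<in> I" by (rule subsetD[OF r(2)]) (use r(1) in \<open>auto simp: b_def dist_real_def\<close>)
  have b_far: "b \<notin> I_sub I \<nu> b0" using r(1) by (auto simp: b_def I_sub_def)
  have \<gamma>b: "\<gamma> b = 0" by (rule b0(2)[OF bI b_far])
  have zero: "\<gamma> x = 0" if "x \<in> I" "x \<notin> I_sub I \<nu> b" for x
    using b0(2)[OF that(1)] that r(1) by (auto simp: I_sub_def b_def split: if_splits)
  have dzero: "deriv \<gamma> x = 0" if "x \<in> I" "x \<notin> I_sub I \<nu> b" for x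
  proof -
    have eq: "I - I_sub I \<nu> b = (if \<nu> = 1 then I \<inter> {b<..} else I \<inter> {..<b})" by (auto simp: I_sub_def)
    have op: "open (I - I_sub I \<nu> b)" unfolding eq using I_open by auto
    have "((\<lambda>_. 0) has_real_derivative 0) (at x)" by simp
    then have "(\<gamma> has_real_derivative 0) (at x)"
      by (rule has_field_derivative_transform_within_open[OF _ op]) (use that zero in auto)
    then show ?thesis by (rule DERIV_imp_deriv)
  qed
  have Licc: "(LINT y:{s..t}|lebesgue. deriv \<gamma> y) = \<gamma> t - \<gamma> s" if "s \<le> t" "s \<in> I" "t \<in> I" for s t
  proof -
    have st: "{s..t} \<subseteq> einterval c d" using I_Icc[OF that(2,3)] by (simp add: I)
    have "(LINT y:{s..t}|lebesgue. deriv \<gamma> y) = integral {s..t} (deriv \<gamma>)"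
      by (rule set_lebesgue_integral_eq_integral(2)[OF AC_loc_deriv(3)[OF cd AC' that(1) st]])
    also have "\<dots> = \<gamma> t - \<gamma> s" by (rule AC_loc_deriv(4)[OF cd AC' that(1) st])
    finally show ?thesis .
  qed
  have form: "\<gamma> x = (-1) ^ \<nu> * indicator (I_sub I \<nu> b) x * (\<integral>y. deriv \<gamma> y \<partial>lebesgue_on (I_sub_star I \<nu> x))" if x: "x \<in> I" for x
  proof (cases "x \<in> I_sub I \<nu> b")
    case False
    then show ?thesis using zero[OF x] by simp
  next
    case True
    define S where "S = (if \<nu> = 1 then {x..b} else {b..x})"
    have xb: "if \<nu> = 1 then x \<le> b else b \<le> x" using True by (simp add: I_sub_def)
    have SI: "S \<subseteq> I" using I_Icc[OF x bI] I_Icc[OF bI x] by (simp add: S_def)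
    have "(\<integral>y. deriv \<gamma> y \<partial>lebesgue_on (I_sub_star I \<nu> x)) = (\<integral>y. indicator (I_sub_star I \<nu> x) y * deriv \<gamma> y \<partial>lebesgue)"
      by (simp add: integral_restrict_space)
    also have "\<dots> = (LINT y:S|lebesgue. deriv \<gamma> y)"
      unfolding set_lebesgue_integral_def
    proof (rule Bochner_Integration.integral_cong[OF refl])
      fix y
      show "indicator (I_sub_star I \<nu> x) y * deriv \<gamma> y = indicator S y *\<^sub>R deriv \<gamma> y"
      proof (cases "y \<in> S")
        case True
        then have "y \<in> I_sub_star I \<nu> x" using SI by (auto simp: I_sub_star_def S_def)
        then show ?thesis using True by simp
      next
        case False
        then have "y \<in> I_sub_star I \<nu> x \<Longrightarrow> y \<notin> I_sub I \<nu> b" by (auto simp: I_sub_star_def I_sub_def S_def split: if_splits)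
        then show ?thesis using False dzero[of y] I_sub_subset(2)[of x] by (auto simp: indicator_def)
      qed
    qed
    finally have int: "(\<integral>y. deriv \<gamma> y \<partial>lebesgue_on (I_sub_star I \<nu> x)) = (LINT y:S|lebesgue. deriv \<gamma> y)" .
    show ?thesis
    proof (cases "\<nu> = 1")
      case 1: True
      have "S = {x..b}" "x \<le> b" using 1 xb by (simp_all only: S_def if_True simp_thms)
      then show ?thesis unfolding int using Licc[of x b] x bI \<gamma>b True 1 by simp
    next
      case False
      then have "\<nu> = 2" using nu by simp
      have "S = {b..x}" "b \<le> x" using False xb by (simp_all only: S_def if_False)
      then show ?thesis unfolding int using Licc[of b x] x bI \<gamma>b True \<open>\<nu> = 2\<close> by simp
    qed
  qed
  have \<gamma>m: "\<gamma> \<in> borel_measurable (lebesgue_on I)" by (rule continuous_imp_measurable_on_sets_lebesgue[OF cont I_sets])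
  have Linf: "(\<lambda>x. ereal (\<gamma> x)) \<in> L_infinity I"
    unfolding L_infinity_def measurable_funs_def
  proof (intro CollectI conjI)
    show "(\<lambda>x. ereal (\<gamma> x)) \<in> borel_measurable (lebesgue_on I)" using \<gamma>m by (rule borel_measurable_ereal)
    then have "(\<lambda>x. \<bar>ereal (\<gamma> x)\<bar>) \<in> borel_measurable (lebesgue_on I)" by (rule borel_measurable_ereal_abs)
    moreover have "AE x in lebesgue_on I. \<bar>ereal (\<gamma> x)\<bar> \<le> ereal B" by (rule AE_I2) (use B in simp)
    ultimately have "esssup (lebesgue_on I) (\<lambda>x. \<bar>ereal (\<gamma> x)\<bar>) \<le> ereal B" by (rule esssup_I)
    then show "esssup (lebesgue_on I) (\<lambda>x. \<bar>ereal (\<gamma> x)\<bar>) < \<infinity>" by (rule le_less_trans) simp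
  qed
  have Lp: "(\<lambda>x. ereal (deriv \<gamma> x)) \<in> Lp_inv_weight I (p / (p - 1)) w"
    unfolding Lp_inv_weight_def measurable_funs_def q_def[symmetric]
  proof (intro CollectI conjI)
    show "(\<lambda>x. ereal (deriv \<gamma> x)) \<in> borel_measurable (lebesgue_on I)"
      using AC_loc_deriv(2)[OF cd AC'] unfolding I by (rule borel_measurable_ereal)
    show "Lp_inv_weight_norm I q w (\<lambda>x. ereal (deriv \<gamma> x)) < \<infinity>" using norm by (rule le_less_trans) simp
  qed
  have "Ch_representative I \<nu> p w g \<gamma>"
    unfolding Ch_representative_def using ae AC Linf Lp form bI by blast
  then show thesis using norm by (rule that)
qed

end

lemma (in cesaro_copson) representative_deriv_unique:
  assumes "Ch_representative I \<nu> p w g \<gamma>" "Ch_representative I \<nu> p w g \<gamma>'"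
  shows "Lp_inv_weight_norm I r w (\<lambda>x. ereal (deriv \<gamma> x)) = Lp_inv_weight_norm I r w (\<lambda>x. ereal (deriv \<gamma>' x))"
proof -
  have cont: "continuous_on I \<gamma>" "continuous_on I \<gamma>'"
    and ae: "AE x in lebesgue_on I. g x = ereal (\<gamma> x)" "AE x in lebesgue_on I. g x = ereal (\<gamma>' x)"
    using representative_facts[OF assms(1)] representative_facts[OF assms(2)] by blast+
  have "AE x in lebesgue_on I. \<bar>\<gamma> x - \<gamma>' x\<bar> \<le> 0" using ae by eventually_elim simp
  then have "\<bar>\<gamma> x - \<gamma>' x\<bar> \<le> 0" if "x \<in> I" for x
    by (rule continuous_on_AE_le_imp_le[OF I_open _ _ that, rotated]) (intro continuous_intros cont)
  then have eq: "\<gamma> x = \<gamma>' x" if "x \<in> I" for x using that by fastforce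
  have "deriv \<gamma> x = deriv \<gamma>' x" if "x \<in> I" for x
    by (rule deriv_cong_ev[OF _ refl]) (rule eventually_mono[OF eventually_nhds_in_open[OF I_open that]], rule eq)
  then show ?thesis
    unfolding Lp_inv_weight_norm_eq
    by (intro arg_cong[where f = "\<lambda>z. ennpowr z (1 / r)"] nn_integral_cong) simp
qed

theorem theorem3p2:
  fixes c d :: ereal and I :: "real set" and p :: real and \<nu> :: nat
    and w g :: "real \<Rightarrow> ereal"
  assumes "c < d" and "I = einterval c d"
    and "1 < p" and "\<nu> \<in> {1, 2}"
    and "w \<in> measurable_funs I" and "AE x in lebesgue_on I. 0 < w x"
    and "(\<lambda>x. enn2ereal (ennpowr (e2ennreal (w x)) p)) \<in> L1_loc_2 I \<nu>"
    and "g \<in> measurable_funs I"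
  shows "(J_Ch I \<nu> p w g < \<infinity> \<longleftrightarrow> (\<exists>\<gamma>. Ch_representative I \<nu> p w g \<gamma>)) \<and>
    (\<forall>\<gamma>. Ch_representative I \<nu> p w g \<gamma> \<longrightarrow>
       J_Ch I \<nu> p w g = Lp_inv_weight_norm I (p / (p - 1)) w (\<lambda>x. ereal (deriv \<gamma> x)))"
proof -
  interpret cesaro_copson c d I p \<nu> w
    by unfold_locales (rule assms)+
  have dual: "cesaro_copson_dual c d I p \<nu> w g" if "J_Ch I \<nu> p w g < \<infinity>"
    by unfold_locales (use that assms in auto)
  show ?thesis
  proof (intro conjI iffI allI impI)
    assume "J_Ch I \<nu> p w g < \<infinity>"
    then interpret cesaro_copson_dual c d I p \<nu> w g by (rule dual)
    show "\<exists>\<gamma>. Ch_representative I \<nu> p w g \<gamma>" by (rule representative_exists) blast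
  next
    assume "\<exists>\<gamma>. Ch_representative I \<nu> p w g \<gamma>"
    then show "J_Ch I \<nu> p w g < \<infinity>" using representative_J_le(2) assms(8) by blast
  next
    fix \<gamma> assume rep: "Ch_representative I \<nu> p w g \<gamma>"
    then interpret cesaro_copson_dual c d I p \<nu> w g
      by (intro dual representative_J_le(2) assms(8))
    obtain \<gamma>' where \<gamma>': "Ch_representative I \<nu> p w g \<gamma>'"
      "Lp_inv_weight_norm I q w (\<lambda>x. ereal (deriv \<gamma>' x)) \<le> ennreal C"
      by (rule representative_exists)
    have "Lp_inv_weight_norm I q w (\<lambda>x. ereal (deriv \<gamma> x)) \<le> J_Ch I \<nu> p w g"
      unfolding J_eq_C representative_deriv_unique[OF rep \<gamma>'(1)] by (rule \<gamma>'(2))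
    then show "J_Ch I \<nu> p w g = Lp_inv_weight_norm I (p / (p - 1)) w (\<lambda>x. ereal (deriv \<gamma> x))"
      unfolding q_def[symmetric] by (intro antisym representative_J_le(1)[OF rep assms(8)])
  qed
qed

end
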